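(* Let $d\ge2$ and let $\mathsf U$ be as in the context. There exist strictly positive constants $c_-=c_-(d)$, $c_+=c_+(d)$, $c$ and $\ell_0<\infty$ such that, for any $\ell>\ell_0$, the following holds: \begin{itemize} \item If $d=2$, for all $N>e^{c\ell}$, $$ e^{-e^{-c_+\ell}\,|\Lambda_N|}\ \ge\ \mathrm P_N\bigl(|X_i|\le\ell,\ \forall i\in\Lambda_N\bigr)\ \ge\ e^{-e^{-c_-\ell}\,|\Lambda_N|}. $$ \item If $d\ge3$, for all $N>e^{c\ell^2}$, $$ e^{-e^{-c_+\ell^2}\,|\Lambda_N|}\ \ge\ \mathrm P_N\bigl(|X_i|\le\ell,\ \forall i\in\Lambda_N\bigr)\ \ge\ e^{-e^{-c_-\ell^2}\,|\Lambda_N|}. $$ \end{itemize}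
   Context: Let $\Lambda_N=\{-N,\dots,N\}^d\subset\mathbb Z^d$. The function $\mathsf U:\mathbb R\to\mathbb R$ is even, twice differentiable, and satisfies $c_0<\mathsf U''<1/c_0$ for some $c_0>0$. $\mathrm P_N$ denotes the Gibbs measure with $0$ boundary conditions, without positivity constraint, external field or pinning: $$ \mathrm P_N(\mathrm dX)=\frac1{Z_N}\exp\Bigl\{-\sum_{\langle i,j\rangle\cap\Lambda_N\ne\emptyset}\mathsf U(X_i-X_j)\Bigr\}\prod_{i\in\Lambda_N}\mathrm dX_i\prod_{i\in\mathbb Z^d\setminus\Lambda_N}\delta_0(\mathrm dX_i), $$ where $X_i\in\mathbb R$, $\mathrm dX_i$ is Lebesgue measure on $\mathbb R$, $\delta_0$ is the Dirac mass at $0$, the sum is over unordered nearest-neighbour pairs of $\mathbb Z^d$ with at least one element in $\Lambda_N$, and $Z_N$ is the normalizing constant. *)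

theory Defs
  imports "HOL-Analysis.Analysis"
begin

(* The lattice Z^d is the type int ^ 'd, with d = CARD('d); configurations are functions on it. *)

definition lattice_box :: "nat \<Rightarrow> (int ^ 'd::finite) set" where
  "lattice_box N = {i. \<forall>k. \<bar>i $ k\<bar> \<le> int N}"

definition nearest_neighbours :: "int ^ 'd::finite \<Rightarrow> int ^ 'd \<Rightarrow> bool" where
  "nearest_neighbours i j \<longleftrightarrow> (\<Sum>k\<in>UNIV. \<bar>i $ k - j $ k\<bar>) = 1"

definition oriented_edges :: "nat \<Rightarrow> ((int ^ 'd::finite) \<times> (int ^ 'd)) set" where
  "oriented_edges N = {(i, j). nearest_neighbours i j \<and> {i, j} \<inter> lattice_box N \<noteq> {}}"

(* The sum over unordered nearest-neighbour pairs. Each of them is counted twice in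
   oriented_edges, with equal contributions since U is even; hence the factor 1/2. *)
definition energy :: "(real \<Rightarrow> real) \<Rightarrow> nat \<Rightarrow> (int ^ 'd::finite \<Rightarrow> real) \<Rightarrow> real" where
  "energy U N X = (\<Sum>(i, j)\<in>oriented_edges N. U (X i - X j)) / 2"

(* The product of Lebesgue measures on the box and of Dirac masses at 0 outside of it,
   obtained as the image of Lebesgue measure on the box under extension by 0. *)
definition reference_measure :: "nat \<Rightarrow> (int ^ 'd::finite \<Rightarrow> real) measure" where
  "reference_measure N =
     distr (PiM (lattice_box N) (\<lambda>_. lborel)) (PiM UNIV (\<lambda>_. borel))
       (\<lambda>x i. if i \<in> lattice_box N then x i else 0)"

definition partition_function ::
  "(real \<Rightarrow> real) \<Rightarrow> nat \<Rightarrow> 'd::finite itself \<Rightarrow> ennreal" where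
  "partition_function U N _ =
     (\<integral>\<^sup>+ X. ennreal (exp (- energy U N X)) \<partial>(reference_measure N :: (int ^ 'd \<Rightarrow> real) measure))"

definition gibbs_measure ::
  "(real \<Rightarrow> real) \<Rightarrow> nat \<Rightarrow> (int ^ 'd::finite \<Rightarrow> real) measure" where
  "gibbs_measure U N =
     density (reference_measure N)
       (\<lambda>X. ennreal (exp (- energy U N X)) / partition_function U N TYPE('d))"

definition confinement_probability ::
  "(real \<Rightarrow> real) \<Rightarrow> nat \<Rightarrow> real \<Rightarrow> 'd::finite itself \<Rightarrow> real" where
  "confinement_probability U N l _ =
     measure (gibbs_measure U N :: (int ^ 'd \<Rightarrow> real) measure)
       {X. \<forall>i\<in>lattice_box N. \<bar>X i\<bar> \<le> l}"

lemma finite_lattice_box: "finite (lattice_box N :: (int ^ 'd::finite) set)"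
proof -
  have "(lattice_box N :: (int ^ 'd) set) \<subseteq> vec_lambda ` (PiE UNIV (\<lambda>_. {- int N..int N}))"
  proof
    fix i :: "int ^ 'd" assume "i \<in> lattice_box N"
    then have "(\<lambda>k. i $ k) \<in> PiE UNIV (\<lambda>_. {- int N..int N})"
      by (auto simp: lattice_box_def abs_le_iff minus_le_iff)
    then show "i \<in> vec_lambda ` (PiE UNIV (\<lambda>_. {- int N..int N}))"
      by (metis image_eqI vec_nth_inverse)
  qed
  then show ?thesis
    by (rule finite_subset) (auto intro!: finite_imageI finite_PiE)
qed

lemma finite_oriented_edges:
  "finite (oriented_edges N :: ((int ^ 'd::finite) \<times> (int ^ 'd)) set)"
proof -
  have nb: "\<bar>i $ k - j $ k\<bar> \<le> 1" if "nearest_neighbours i j" for i j :: "int ^ 'd" and k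
    using that member_le_sum[of k UNIV "\<lambda>k. \<bar>i $ k - j $ k\<bar>"]
    by (auto simp: nearest_neighbours_def)
  have "i \<in> lattice_box (Suc N) \<and> j \<in> lattice_box (Suc N)"
    if "(i, j) \<in> oriented_edges N" for i j :: "int ^ 'd"
  proof -
    have "\<bar>i $ k\<bar> \<le> int (Suc N) \<and> \<bar>j $ k\<bar> \<le> int (Suc N)" for k
    proof -
      have "\<bar>i $ k\<bar> \<le> int N \<or> \<bar>j $ k\<bar> \<le> int N" "\<bar>i $ k - j $ k\<bar> \<le> 1"
        using that nb[of i j k] by (auto simp: oriented_edges_def lattice_box_def)
      then show ?thesis by linarith
    qed
    then show ?thesis by (simp add: lattice_box_def)
  qed
  then have "oriented_edges N \<subseteq> (lattice_box (Suc N) \<times> lattice_box (Suc N) :: ((int ^ 'd) \<times> (int ^ 'd)) set)"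
    by auto
  then show ?thesis
    by (rule finite_subset) (simp add: finite_lattice_box)
qed

end

theory Submission
  imports Defs "HOL-Probability.Distributions"
begin

text \<open>
  The confinement probability is the ratio of the mass of the confined configurations to the mass of all
  configurations (\<open>confinement_probability_eq\<close>). Two devices control such masses. First, on a set
  of configurations that is symmetric under \<open>X \<mapsto> - X\<close>, a shift by \<open>\<phi>\<close> costs at most a factor
  \<open>exp (- D / (2 c))\<close>, where \<open>D\<close> is the Dirichlet form of \<open>\<phi>\<close>: averaging over the shifts by \<open>\<phi>\<close> and
  \<open>- \<phi>\<close> removes the linear term in the energy (\<open>shifted_weight_ge\<close>). Secondly, the weight is strongly
  log-concave, and the Prekopa-Leindler inequality for midpoints (\<open>prekopa_leindler_midpoint\<close>)
  compares it with its values at midpoints of configurations.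

  Upper bound. Place bumps \<open>\<phi>\<^sub>t\<close> of height \<open>1\<close> around the sites \<open>t\<close> of a sparse set \<open>T\<close>. Adding \<open>0\<close>, \<open>3 l \<phi>\<^sub>t\<close> or
  \<open>- 3 l \<phi>\<^sub>t\<close> for each \<open>t\<close> independently to the confined configurations produces \<open>3 ^ card T\<close> disjoint
  sets. A bump costs a factor \<open>q\<close>, so the mass of the confined configurations is at most
  \<open>1 / (1 + 2 q) ^ card T\<close> times the total (\<open>spread_confined_mass\<close>). From dimension three on,
  point masses have \<open>q = exp (- C l\<^sup>2)\<close>. In dimension two, logarithmic bumps of radius \<open>exp l\<close> have a
  Dirichlet form of order \<open>1 / l\<close>, so \<open>q = exp (- C l)\<close>, at a density \<open>exp (- 2 l)\<close>
  (\<open>dirichlet_form_log_profile\<close>).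

  Lower bound. Pin the field to zero on the sites with a coordinate divisible by \<open>M\<close>. Each pinned site
  costs a constant factor, both in the confined mass (\<open>confined_mass_pin_site\<close>, a shift) and in the free mass
  (\<open>free_mass_pin_site\<close>, by Prekopa-Leindler, provided that the site has a neighbour that is
  already zero). This contributes an exponent of order \<open>card (lattice_box N) / M\<close>. Off the grid the
  field decouples into cells of width less than \<open>M\<close> (\<open>confined_mass_of_cells\<close>). In a cell, again by
  Prekopa-Leindler, a single height exceeds \<open>l\<close> in absolute value with probability at most
  \<open>2 exp (- c l\<^sup>2 / (2 K))\<close>, where \<open>K\<close> bounds the Green function of the cell (\<open>tail_mass\<close>). Comparing averages over the
  columns of a wedge gives \<open>K\<close> of order \<open>ln M\<close> in dimension two and a constant \<open>K\<close> from dimension three on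
  (\<open>green_bound_planar\<close>, \<open>green_bound_spatial\<close>). With \<open>M = exp (a l)\<close> or \<open>M = exp (a l\<^sup>2)\<close>
  for a small \<open>a\<close>, a union bound over the \<open>M ^ d\<close> sites of a cell succeeds, and the exponents of
  both contributions are \<open>exp (- C l)\<close> or \<open>exp (- C l\<^sup>2)\<close> times the volume.
\<close>

section \<open>Integration over configurations\<close>

text \<open>The integral over the heights in \<open>V\<close> of a function of the whole configuration, all other heights
  being \<open>0\<close>. Working with functions of whole configurations lets the set \<open>V\<close> of free sites vary
  while the integrand stays the same, and \<open>box_integral_insert\<close> then replaces every appeal to the product
  measure by an induction over \<open>V\<close>.\<close>

definition box_integral :: "'i set \<Rightarrow> (('i \<Rightarrow> real) \<Rightarrow> ennreal) \<Rightarrow> ennreal" where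
  "box_integral V F =
     (\<integral>\<^sup>+ x. F (\<lambda>i. if i \<in> V then x i else 0) \<partial>PiM V (\<lambda>_. lborel))"

abbreviation config_algebra :: "('i \<Rightarrow> real) measure" where
  "config_algebra \<equiv> PiM UNIV (\<lambda>_. borel)"

definition supported :: "'i set \<Rightarrow> ('i \<Rightarrow> real) set" where
  "supported V = {X. \<forall>i. i \<notin> V \<longrightarrow> X i = 0}"

lemma measurable_zero_extension [measurable]:
  "(\<lambda>x i. if i \<in> V then x i else 0) \<in> measurable (PiM V (\<lambda>_. lborel)) config_algebra"
proof (rule measurable_PiM_single')
  fix i :: 'a
  show "(\<lambda>x. if i \<in> V then x i else 0) \<in> borel_measurable (PiM V (\<lambda>_. lborel))"
    by (cases "i \<in> V") auto
qed auto

lemma measurable_fun_upd_config [measurable]: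
  "(\<lambda>X. X(i := a)) \<in> measurable config_algebra config_algebra"
proof (rule measurable_PiM_single')
  fix j :: 'a
  show "(\<lambda>X. (X(i := a)) j) \<in> borel_measurable config_algebra"
    by (cases "j = i") auto
qed auto

lemma measurable_fun_upd_config_pair [measurable]:
  "(\<lambda>(X, a). X(i := a)) \<in> measurable (config_algebra \<Otimes>\<^sub>M borel) config_algebra"
proof (rule measurable_PiM_single')
  fix j :: 'a
  show "(\<lambda>p. (case p of (X, a) \<Rightarrow> X(i := a)) j) \<in> borel_measurable (config_algebra \<Otimes>\<^sub>M borel)"
    by (cases "j = i") (auto simp: case_prod_beta)
qed auto

lemma box_integral_empty: "box_integral {} F = F (\<lambda>_. 0)"
  by (simp add: box_integral_def PiM_empty nn_integral_count_space_finite)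

lemma box_integral_mono:
  assumes "\<And>X. X \<in> supported V \<Longrightarrow> F X \<le> G X"
  shows "box_integral V F \<le> box_integral V G"
  unfolding box_integral_def by (intro nn_integral_mono assms) (auto simp: supported_def)

lemma box_integral_cong:
  assumes "\<And>X. X \<in> supported V \<Longrightarrow> F X = G X"
  shows "box_integral V F = box_integral V G"
  by (intro antisym box_integral_mono) (simp_all add: assms)

lemma box_integral_add:
  assumes [measurable]: "F \<in> borel_measurable config_algebra" "G \<in> borel_measurable config_algebra"
  shows "box_integral V (\<lambda>X. F X + G X) = box_integral V F + box_integral V G"
  unfolding box_integral_def by (subst nn_integral_add) auto

lemma box_integral_cmult:
  assumes [measurable]: "F \<in> borel_measurable config_algebra"
  shows "box_integral V (\<lambda>X. c * F X) = c * box_integral V F"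
  unfolding box_integral_def by (subst nn_integral_cmult) auto

lemma box_integral_sum:
  assumes [measurable]: "\<And>s. s \<in> S \<Longrightarrow> F s \<in> borel_measurable config_algebra"
  shows "box_integral V (\<lambda>X. \<Sum>s\<in>S. F s X) = (\<Sum>s\<in>S. box_integral V (F s))"
  unfolding box_integral_def by (subst nn_integral_sum) auto

lemma product_sigma_finite_lborel: "product_sigma_finite (\<lambda>_. lborel)"
  by standard

lemma box_integral_slice_measurable [measurable]:
  assumes [measurable]: "F \<in> borel_measurable config_algebra"
  assumes V: "finite V"
  shows "(\<lambda>a. box_integral V (\<lambda>X. F (X(i := a)))) \<in> borel_measurable borel"
proof -
  interpret product_sigma_finite "\<lambda>_::'a. lborel :: real measure" by (rule product_sigma_finite_lborel)
  interpret sigma_finite_measure "PiM V (\<lambda>_. lborel :: real measure)" 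
    using V by (rule sigma_finite)
  have [measurable]: "(\<lambda>p. F ((\<lambda>j. if j \<in> V then snd p j else 0)(i := fst p)))
      \<in> borel_measurable (borel \<Otimes>\<^sub>M PiM V (\<lambda>_. lborel))"
  proof -
    have 1: "(\<lambda>p. (\<lambda>j. if j \<in> V then snd p j else 0)) \<in> measurable (borel \<Otimes>\<^sub>M PiM V (\<lambda>_. lborel)) config_algebra"
      by measurable
    have "(\<lambda>p. (\<lambda>(X, a). X(i := a)) ((\<lambda>j. if j \<in> V then snd p j else 0), fst p))
      \<in> measurable (borel \<Otimes>\<^sub>M PiM V (\<lambda>_. lborel)) config_algebra"
      using 1 by measurable
    then show ?thesis by simp
  qed
  show ?thesis unfolding box_integral_def
    by (rule borel_measurable_nn_integral) (simp add: case_prod_beta)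
qed

lemma box_integral_insert:
  assumes [measurable]: "F \<in> borel_measurable config_algebra"
    and V: "finite V" "i \<notin> V"
  shows "box_integral (insert i V) F = (\<integral>\<^sup>+ a. box_integral V (\<lambda>X. F (X(i := a))) \<partial>lborel)"
proof -
  interpret product_sigma_finite "\<lambda>_::'a. lborel :: real measure" by (rule product_sigma_finite_lborel)
  have *: "(\<lambda>j. if j \<in> insert i V then (x(i := y)) j else 0) = (\<lambda>j. if j \<in> V then x j else 0)(i := y)" 
    for x :: "'a \<Rightarrow> real" and y
    using V by auto
  show ?thesis unfolding box_integral_def
    by (subst product_nn_integral_insert_rev[OF V]) (simp_all only: *, measurable)
qed

text \<open>Invariance under translations (\<open>s = 1\<close>) and under the reflection \<open>X \<mapsto> - X\<close> (\<open>s = - 1\<close>) in one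
  statement, since both reduce to the one-dimensional substitution rule.\<close>

lemma box_integral_affine:
  fixes V :: "'i set" and s :: real
  assumes "finite V" "\<bar>s\<bar> = 1"
  shows "F \<in> borel_measurable config_algebra \<Longrightarrow> \<phi> \<in> supported V \<Longrightarrow>
    box_integral V (\<lambda>X. F (\<lambda>i. s * X i + \<phi> i)) = box_integral V F"
  using assms(1)
proof (induction V arbitrary: F \<phi> rule: finite_induct)
  case empty
  then show ?case by (simp add: box_integral_empty supported_def)
next
  case (insert i V)
  note [measurable] = insert.prems(1)
  have [measurable]: "(\<lambda>X i. s * X i + \<phi> i) \<in> measurable config_algebra config_algebra"
    by (rule measurable_PiM_single') auto
  have \<phi>: "\<phi>(i := 0) \<in> supported V" using insert.prems by (auto simp: supported_def)
  have *: "(\<lambda>j. s * (X(i := a)) j + \<phi> j) = (\<lambda>j. s * X j + (\<phi>(i := 0)) j)(i := \<phi> i + s * a)" for X a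
    by auto
  have "box_integral (insert i V) (\<lambda>X. F (\<lambda>i. s * X i + \<phi> i)) =
     (\<integral>\<^sup>+ a. box_integral V (\<lambda>X. F ((\<lambda>j. s * X j + (\<phi>(i := 0)) j)(i := \<phi> i + s * a))) \<partial>lborel)"
    by (subst box_integral_insert) (use insert.hyps * in auto)
  also have "\<dots> = (\<integral>\<^sup>+ a. box_integral V (\<lambda>X. F (X(i := \<phi> i + s * a))) \<partial>lborel)"
    by (intro nn_integral_cong insert.IH[OF _ \<phi>]) measurable
  also have "\<dots> = (\<integral>\<^sup>+ a. box_integral V (\<lambda>X. F (X(i := a))) \<partial>lborel)"
    using assms(2) insert.hyps
    by (subst (2) nn_integral_real_affine[of _ s "\<phi> i"]) auto
  also have "\<dots> = box_integral (insert i V) F"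
    by (subst box_integral_insert) (use insert.hyps in auto)
  finally show ?case .
qed

lemma box_integral_product:
  fixes V B :: "'i set"
  assumes "finite B" "finite V"
  shows "\<lbrakk>V \<inter> B = {}; F \<in> borel_measurable config_algebra; f \<in> borel_measurable config_algebra;
    g \<in> borel_measurable config_algebra;
    \<And>X Y. X \<in> supported V \<Longrightarrow> Y \<in> supported B \<Longrightarrow> F (\<lambda>i. X i + Y i) = f X * g Y\<rbrakk> \<Longrightarrow>
    box_integral (V \<union> B) F = box_integral V f * box_integral B g"
  using assms(1)
proof (induction B arbitrary: F g rule: finite_induct)
  case empty
  have "box_integral V F = box_integral V (\<lambda>X. g (\<lambda>_. 0) * f X)"
  proof (rule box_integral_cong)
    fix X assume "X \<in> supported V"
    then show "F X = g (\<lambda>_. 0) * f X"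
      using empty(5)[of X "\<lambda>_. 0"] by (simp add: supported_def mult.commute)
  qed
  then show ?case
    by (subst (asm) box_integral_cmult) (use empty(3) in \<open>simp_all add: box_integral_empty mult.commute\<close>)
next
  case (insert i B)
  note [measurable] = insert.prems(2-4)
  have "box_integral (V \<union> insert i B) F = (\<integral>\<^sup>+ a. box_integral (V \<union> B) (\<lambda>X. F (X(i := a))) \<partial>lborel)"
    using insert.prems(1) insert.hyps assms(2) by (simp add: box_integral_insert)
  also have "\<dots> = (\<integral>\<^sup>+ a. box_integral V f * box_integral B (\<lambda>X. g (X(i := a))) \<partial>lborel)"
  proof (intro nn_integral_cong insert.IH)
    fix a :: real and X Y assume XY: "X \<in> supported V" "Y \<in> supported B"
    have "Y(i := a) \<in> supported (insert i B)" using XY by (auto simp: supported_def)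
    moreover have "(\<lambda>j. X j + (Y(i := a)) j) = (\<lambda>i. X i + Y i)(i := a)"
      using XY insert.prems(1) by (auto simp: supported_def)
    ultimately show "F ((\<lambda>i. X i + Y i)(i := a)) = f X * g (Y(i := a))"
      using insert.prems(5)[OF XY(1)] by metis
  qed (use insert.prems(1) in blast, measurable)
  also have "\<dots> = box_integral V f * box_integral (insert i B) g"
    using insert.hyps by (simp add: box_integral_insert nn_integral_cmult)
  finally show ?case .
qed

section \<open>The Prekopa-Leindler inequality for midpoints\<close>

text \<open>The one-dimensional Brunn-Minkowski inequality. If \<open>A\<close> had a largest element \<open>a\<close> and \<open>B\<close> a least
  element \<open>b\<close>, then the midpoints of \<open>b\<close> with \<open>A\<close> would lie to the left of \<open>(a + b) / 2\<close> and those of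
  \<open>a\<close> with \<open>B\<close> to its right, so that both could be counted in \<open>C\<close>. Choosing \<open>a\<close> and \<open>b\<close> up to \<open>e\<close>
  avoids any compactness argument.\<close>

lemma midpoint_set_measure:
  fixes A B C :: "real set"
  assumes [measurable]: "A \<in> sets borel" "B \<in> sets borel" "C \<in> sets borel"
    and ne: "A \<noteq> {}" "B \<noteq> {}" and bdd: "bdd_above A" "bdd_below B"
    and mid: "\<And>a b. a \<in> A \<Longrightarrow> b \<in> B \<Longrightarrow> (a + b) / 2 \<in> C"
  shows "emeasure lborel A + emeasure lborel B \<le> 2 * emeasure lborel C"
proof (rule ennreal_le_epsilon)
  fix e :: real assume e: "e > 0"
  obtain a where a: "a \<in> A" "Sup A - e / 2 < a"
    using e ne(1) less_cSup_iff[OF ne(1) bdd(1), of "Sup A - e / 2"] by auto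
  obtain b where b: "b \<in> B" "b < Inf B + e / 2"
    using e ne(2) cInf_less_iff[OF ne(2) bdd(2), of "Inf B + e / 2"] by auto
  have "emeasure lborel A \<le> emeasure lborel (A \<inter> {..a}) + emeasure lborel {Sup A - e / 2..Sup A}"
    using a(2) cSup_upper[OF _ bdd(1)]
    by (intro order_trans[OF emeasure_mono emeasure_subadditive]) force+
  then have A: "emeasure lborel A \<le> emeasure lborel (A \<inter> {..a}) + ennreal (e / 2)"
    using e by simp
  have "emeasure lborel B \<le> emeasure lborel (B \<inter> {b..}) + emeasure lborel {Inf B..Inf B + e / 2}"
    using b(2) cInf_lower[OF _ bdd(2)]
    by (intro order_trans[OF emeasure_mono emeasure_subadditive]) force+
  then have B: "emeasure lborel B \<le> emeasure lborel (B \<inter> {b..}) + ennreal (e / 2)"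
    using e by simp
  have A': "emeasure lborel (A \<inter> {..a}) = 2 * (\<integral>\<^sup>+z. indicator (A \<inter> {..a}) (- b + 2 * z) \<partial>lborel)"
    by (subst nn_integral_indicator[symmetric], measurable)
      (subst nn_integral_real_affine[of _ 2 "- b"], auto)
  have B': "emeasure lborel (B \<inter> {b..}) = 2 * (\<integral>\<^sup>+z. indicator (B \<inter> {b..}) (- a + 2 * z) \<partial>lborel)"
    by (subst nn_integral_indicator[symmetric], measurable)
      (subst nn_integral_real_affine[of _ 2 "- a"], auto)
  \<comment> \<open>The two translates meet in the point \<open>(a + b) / 2\<close> only.\<close>
  have *: "indicator (A \<inter> {..a}) (- b + 2 * z) + indicator (B \<inter> {b..}) (- a + 2 * z)
      \<le> indicator C z + (indicator {(a + b) / 2} z :: ennreal)" for z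
  proof -
    have "z \<in> C" if "- b + 2 * z \<in> A" using mid[OF that b(1)] by simp
    moreover have "z \<in> C" if "- a + 2 * z \<in> B" using mid[OF a(1) that] by simp
    moreover have "z = (a + b) / 2" if "- b + 2 * z \<le> a" "- a + 2 * z \<ge> b" using that by simp
    ultimately show ?thesis by (auto simp: indicator_def)
  qed
  let ?u = "\<lambda>z. indicator (A \<inter> {..a}) (- b + 2 * z) :: ennreal"
  let ?v = "\<lambda>z. indicator (B \<inter> {b..}) (- a + 2 * z) :: ennreal"
  have [measurable]: "?u \<in> borel_measurable lborel" "?v \<in> borel_measurable lborel" by measurable
  have "(\<integral>\<^sup>+z. ?u z \<partial>lborel) + (\<integral>\<^sup>+z. ?v z \<partial>lborel) = (\<integral>\<^sup>+z. ?u z + ?v z \<partial>lborel)"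
    by (rule nn_integral_add[symmetric]) fact+
  also have "\<dots> \<le> (\<integral>\<^sup>+z. indicator C z + (indicator {(a + b) / 2} z :: ennreal) \<partial>lborel)"
    by (rule nn_integral_mono) (rule *)
  also have "\<dots> = emeasure lborel C"
    by (subst nn_integral_add) auto
  finally have C: "emeasure lborel (A \<inter> {..a}) + emeasure lborel (B \<inter> {b..}) \<le> 2 * emeasure lborel C"
    unfolding A' B' distrib_left[symmetric] by (rule mult_left_mono) simp
  have "emeasure lborel A + emeasure lborel B \<le>
     (emeasure lborel (A \<inter> {..a}) + ennreal (e / 2)) + (emeasure lborel (B \<inter> {b..}) + ennreal (e / 2))"
    by (intro add_mono A B)
  also have "\<dots> = (emeasure lborel (A \<inter> {..a}) + emeasure lborel (B \<inter> {b..})) + (ennreal (e / 2) + ennreal (e / 2))"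
    by (simp only: ac_simps)
  also have "\<dots> \<le> 2 * emeasure lborel C + (ennreal (e / 2) + ennreal (e / 2))"
    by (intro add_mono C order_refl)
  also have "ennreal (e / 2) + ennreal (e / 2) = ennreal e"
    using e by (subst ennreal_plus[symmetric]) auto
  finally show "emeasure lborel A + emeasure lborel B \<le> 2 * emeasure lborel C + ennreal e" .
qed

lemma layer_cake:
  fixes f :: "real \<Rightarrow> ennreal"
  assumes [measurable]: "f \<in> borel_measurable borel"
  shows layer_cake_le: "(\<integral>\<^sup>+t. indicator {0<..<1} t * emeasure lborel {x. ennreal t < f x} \<partial>lborel)
      \<le> (\<integral>\<^sup>+x. f x \<partial>lborel)" 
    and layer_cake_eq: "(\<And>x. f x \<le> 1) \<Longrightarrow> (\<integral>\<^sup>+t. indicator {0<..<1} t * emeasure lborel {x. ennreal t < f x} \<partial>lborel)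
        = (\<integral>\<^sup>+x. f x \<partial>lborel)"
proof -
  let ?L = "\<integral>\<^sup>+t. indicator {0<..<1} t * emeasure lborel {x. ennreal t < f x} \<partial>lborel"
  have "?L = (\<integral>\<^sup>+t. \<integral>\<^sup>+x. indicator {0<..<1} t * indicator {x. ennreal t < f x} x \<partial>lborel \<partial>lborel)"
    by (simp add: nn_integral_cmult)
  also have "\<dots> = (\<integral>\<^sup>+x. \<integral>\<^sup>+t. indicator {0<..<1} t * indicator {x. ennreal t < f x} x \<partial>lborel \<partial>lborel)"
    by (rule lborel_pair.Fubini') measurable
  finally have eq: "?L = (\<integral>\<^sup>+x. \<integral>\<^sup>+t. indicator {0<..<1} t * indicator {x. ennreal t < f x} x \<partial>lborel \<partial>lborel)" .
  have *: "(\<integral>\<^sup>+t. indicator {0<..<1} t * indicator {x. ennreal t < f x} x \<partial>lborel) = min 1 (f x)" for x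
  proof -
    obtain r where r: "min 1 (f x) = ennreal r" "0 \<le> r" "r \<le> 1"
    proof (cases "f x \<le> 1")
      case True
      then show ?thesis using that[of "enn2real (f x)"] by (cases "f x") (auto simp: min_def top_unique)
    next
      case False
      then show ?thesis using that[of 1] by (auto simp: min_def)
    qed
    have "ennreal t < f x \<longleftrightarrow> t < r" if "0 < t" "t < 1" for t
    proof -
      have "ennreal t < f x \<longleftrightarrow> ennreal t < min 1 (f x)" using that by (simp add: ennreal_less_one_iff)
      then show ?thesis using that by (simp add: r ennreal_less_iff)
    qed
    then have "(\<lambda>t. indicator {0<..<1} t * indicator {x. ennreal t < f x} x :: ennreal) = indicator {0<..<r}"
      using r by (fastforce simp: indicator_def fun_eq_iff)
    then show ?thesis using r by simp
  qed
  show "?L \<le> (\<integral>\<^sup>+x. f x \<partial>lborel)"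
    unfolding eq * by (intro nn_integral_mono) auto
  show "?L = (\<integral>\<^sup>+x. f x \<partial>lborel)" if "\<And>x. f x \<le> 1"
    unfolding eq * using that by (intro nn_integral_cong) auto
qed

lemma ennreal_mult_le_square_of_sum:
  fixes F G H :: ennreal
  assumes "F + G \<le> 2 * H"
  shows "F * G \<le> H\<^sup>2"
proof (cases "H = top")
  case False
  then obtain h where h: "H = ennreal h" "h \<ge> 0" by (cases H) auto
  have "F + G \<le> ennreal (2 * h)" using assms h by (simp add: ennreal_mult)
  then have "F \<noteq> top" "G \<noteq> top" by (auto simp: top_unique)
  then obtain f g where fg: "F = ennreal f" "G = ennreal g" "f \<ge> 0" "g \<ge> 0" 
    by (cases F; cases G) auto
  have "ennreal (f + g) \<le> ennreal (2 * h)"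
    using \<open>F + G \<le> ennreal (2 * h)\<close> fg by simp
  then have le: "f + g \<le> 2 * h" using h fg by (subst (asm) ennreal_le_iff) auto
  have "4 * (f * g) \<le> (f + g)\<^sup>2" 
    using zero_le_power2[of "f - g"] by (simp add: power2_eq_square algebra_simps)
  also have "\<dots> \<le> (2 * h)\<^sup>2" using le fg by (intro power_mono) auto
  finally have "f * g \<le> h\<^sup>2" by (simp add: power_mult_distrib)
  then have "ennreal (f * g) \<le> ennreal (h\<^sup>2)" by (rule ennreal_leI)
  then show ?thesis using fg h by (simp add: ennreal_mult ennreal_power)
qed (simp add: power2_eq_square)

text \<open>When both suprema are \<open>1\<close>, the superlevel sets of \<open>f\<close> and \<open>g\<close> at a common level \<open>t < 1\<close> are nonempty
  and their midpoints lie in the superlevel set of \<open>h\<close>. Integrating Brunn-Minkowski over \<open>t\<close> gives an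
  arithmetic mean, which is stronger than the geometric mean of the general inequality.\<close>

lemma prekopa_leindler_normalised:
  fixes f g h :: "real \<Rightarrow> ennreal"
  assumes [measurable]: "f \<in> borel_measurable borel" "g \<in> borel_measurable borel" "h \<in> borel_measurable borel"
    and f: "\<And>x. f x \<le> 1" "(SUP x. f x) = 1" "\<And>x. x > b \<Longrightarrow> f x = 0"
    and g: "\<And>x. g x \<le> 1" "(SUP x. g x) = 1" "\<And>x. x < a \<Longrightarrow> g x = 0"
    and le: "\<And>x y. f x * g y \<le> (h ((x + y) / 2))\<^sup>2"
  shows "(\<integral>\<^sup>+x. f x \<partial>lborel) + (\<integral>\<^sup>+x. g x \<partial>lborel) \<le> 2 * (\<integral>\<^sup>+x. h x \<partial>lborel)"
proof -
  let ?I = "indicator {0<..<1::real} :: real \<Rightarrow> ennreal"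
  have *: "?I t * emeasure lborel {x. ennreal t < f x} + ?I t * emeasure lborel {x. ennreal t < g x}
      \<le> 2 * (?I t * emeasure lborel {x. ennreal t < h x})" for t
  proof (cases "0 < t \<and> t < 1")
    case True
    have "emeasure lborel {x. ennreal t < f x} + emeasure lborel {x. ennreal t < g x}
      \<le> 2 * emeasure lborel {x. ennreal t < h x}"
    proof (rule midpoint_set_measure)
      show "{x. ennreal t < f x} \<noteq> {}" "{x. ennreal t < g x} \<noteq> {}"
        using True f(2) g(2) less_SUP_iff[of "ennreal t" f UNIV] less_SUP_iff[of "ennreal t" g UNIV]
        by (auto simp: ennreal_less_one_iff)
      show "bdd_above {x. ennreal t < f x}" 
        by (rule bdd_aboveI[of _ b]) (metis f(3) linorder_not_less mem_Collect_eq not_less_zero)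
      show "bdd_below {x. ennreal t < g x}"
        by (rule bdd_belowI[of _ a]) (metis g(3) linorder_not_less mem_Collect_eq not_less_zero)
      show "(x + y) / 2 \<in> {x. ennreal t < h x}"
        if "x \<in> {x. ennreal t < f x}" "y \<in> {x. ennreal t < g x}" for x y
      proof (rule ccontr)
        assume "(x + y) / 2 \<notin> {x. ennreal t < h x}"
        then have "(h ((x + y) / 2))\<^sup>2 \<le> (ennreal t)\<^sup>2" by (simp add: power_mono)
        moreover have "(ennreal t)\<^sup>2 < f x * g y"
        proof -
        obtain r s where rs: "f x = ennreal r" "g y = ennreal s" "0 \<le> r" "0 \<le> s"
          using f(1)[of x] g(1)[of y] by (cases "f x"; cases "g y") (auto simp: top_unique)
        then have "t < r" "t < s" using that True by (auto simp: ennreal_less_iff)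
        then have "t * t < r * s" using True by (intro mult_strict_mono) auto
        then show ?thesis
          using True rs by (simp add: power2_eq_square ennreal_less_iff flip: ennreal_mult)
      qed
        ultimately show False using le[of x y] by auto
      qed
    qed measurable
    then show ?thesis using True by simp
  qed auto
  have "(\<integral>\<^sup>+x. f x \<partial>lborel) + (\<integral>\<^sup>+x. g x \<partial>lborel) = 
     (\<integral>\<^sup>+t. ?I t * emeasure lborel {x. ennreal t < f x} + ?I t * emeasure lborel {x. ennreal t < g x} \<partial>lborel)"
    using f g by (simp add: nn_integral_add layer_cake_eq)
  also have "\<dots> \<le> (\<integral>\<^sup>+t. 2 * (?I t * emeasure lborel {x. ennreal t < h x}) \<partial>lborel)"
    by (intro nn_integral_mono *)
  also have "\<dots> = 2 * (\<integral>\<^sup>+t. ?I t * emeasure lborel {x. ennreal t < h x} \<partial>lborel)"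
    by (rule nn_integral_cmult) measurable
  also have "\<dots> \<le> 2 * (\<integral>\<^sup>+x. h x \<partial>lborel)"
    by (intro mult_left_mono layer_cake_le) auto
  finally show ?thesis .
qed

lemma prekopa_leindler_bounded:
  fixes f g h :: "real \<Rightarrow> ennreal"
  assumes [measurable]: "f \<in> borel_measurable borel" "g \<in> borel_measurable borel" "h \<in> borel_measurable borel"
    and f: "\<And>x. f x \<le> ennreal c" "\<And>x. x > b \<Longrightarrow> f x = 0"
    and g: "\<And>x. g x \<le> ennreal c" "\<And>x. x < a \<Longrightarrow> g x = 0"
    and le: "\<And>x y. f x * g y \<le> (h ((x + y) / 2))\<^sup>2"
  shows "(\<integral>\<^sup>+x. f x \<partial>lborel) * (\<integral>\<^sup>+x. g x \<partial>lborel) \<le> (\<integral>\<^sup>+x. h x \<partial>lborel)\<^sup>2"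
proof (cases "(SUP x. f x) = 0 \<or> (SUP x. g x) = 0")
  case True
  then have "(\<forall>x. f x = 0) \<or> (\<forall>x. g x = 0)"
    using SUP_upper[of _ UNIV f] SUP_upper[of _ UNIV g] by (metis UNIV_I le_zero_eq)
  then show ?thesis by auto
next
  case False
  have "(SUP x. f x) \<le> ennreal c" "(SUP x. g x) \<le> ennreal c"
    using f g by (auto intro: SUP_least)
  then obtain s t where st: "(SUP x. f x) = ennreal s" "(SUP x. g x) = ennreal t" "0 \<le> s" "0 \<le> t"
    by (cases "SUP x. f x"; cases "SUP x. g x") (auto simp: top_unique)
  with False have pos: "s > 0" "t > 0" by (auto simp: less_le)
  \<comment> \<open>The normalisation of \<open>h\<close> that matches dividing \<open>f\<close> and \<open>g\<close> by their suprema.\<close>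
  define r where "r = sqrt (s * t)"
  have r: "r > 0" "r\<^sup>2 = s * t" using pos by (auto simp: r_def)
  let ?f = "\<lambda>x. ennreal (1 / s) * f x" and ?g = "\<lambda>x. ennreal (1 / t) * g x" and ?h = "\<lambda>x. ennreal (1 / r) * h x"
  have const: "ennreal (1 / s) * ennreal (1 / t) = ennreal (1 / (s * t))"
    using pos by (simp flip: ennreal_mult)
  have const': "(ennreal (1 / r))\<^sup>2 = ennreal (1 / (s * t))"
    using r pos by (simp add: ennreal_power power_divide)
  have If: "(\<integral>\<^sup>+x. ?f x \<partial>lborel) = ennreal (1 / s) * (\<integral>\<^sup>+x. f x \<partial>lborel)"
    and Ig: "(\<integral>\<^sup>+x. ?g x \<partial>lborel) = ennreal (1 / t) * (\<integral>\<^sup>+x. g x \<partial>lborel)"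
    and Ih: "(\<integral>\<^sup>+x. ?h x \<partial>lborel) = ennreal (1 / r) * (\<integral>\<^sup>+x. h x \<partial>lborel)"
    by (rule nn_integral_cmult, simp)+
  have sf: "(SUP x. ?f x) = 1"
    using pos by (subst SUP_mult_left_ennreal[symmetric]) (simp add: st flip: ennreal_mult)
  have sg: "(SUP x. ?g x) = 1"
    using pos by (subst SUP_mult_left_ennreal[symmetric]) (simp add: st flip: ennreal_mult)
  have "(\<integral>\<^sup>+x. ?f x \<partial>lborel) + (\<integral>\<^sup>+x. ?g x \<partial>lborel) \<le> 2 * (\<integral>\<^sup>+x. ?h x \<partial>lborel)"
  proof (rule prekopa_leindler_normalised)
    show "?f x \<le> 1" for x using sf SUP_upper[of x UNIV ?f] by simp
    show "?g x \<le> 1" for x using sg SUP_upper[of x UNIV ?g] by simp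
    show "?f x * ?g y \<le> (?h ((x + y) / 2))\<^sup>2" for x y
    proof -
      have "?f x * ?g y = ennreal (1 / (s * t)) * (f x * g y)"
        unfolding const[symmetric] by (simp only: ac_simps)
      also have "\<dots> \<le> ennreal (1 / (s * t)) * (h ((x + y) / 2))\<^sup>2"
        by (intro mult_left_mono le) auto
      also have "\<dots> = (?h ((x + y) / 2))\<^sup>2"
        unfolding const'[symmetric] by (simp only: power_mult_distrib)
      finally show ?thesis .
    qed
  qed (use f g sf sg in auto)
  then have "(\<integral>\<^sup>+x. ?f x \<partial>lborel) * (\<integral>\<^sup>+x. ?g x \<partial>lborel) \<le> (\<integral>\<^sup>+x. ?h x \<partial>lborel)\<^sup>2"
    by (rule ennreal_mult_le_square_of_sum)
  also have "(\<integral>\<^sup>+x. ?f x \<partial>lborel) * (\<integral>\<^sup>+x. ?g x \<partial>lborel) =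
      ennreal (1 / (s * t)) * ((\<integral>\<^sup>+x. f x \<partial>lborel) * (\<integral>\<^sup>+x. g x \<partial>lborel))"
    unfolding If Ig const[symmetric] by (simp only: ac_simps)
  also have "(\<integral>\<^sup>+x. ?h x \<partial>lborel)\<^sup>2 = ennreal (1 / (s * t)) * (\<integral>\<^sup>+x. h x \<partial>lborel)\<^sup>2"
    unfolding Ih const'[symmetric] by (simp only: power_mult_distrib)
  finally show ?thesis
    using pos by (subst (asm) ennreal_mult_le_mult_iff) auto
qed

text \<open>Truncating the values and the supports preserves the hypothesis, because it only decreases \<open>f\<close> and
  \<open>g\<close>; monotone convergence removes the truncation.\<close>

theorem prekopa_leindler_midpoint_real:
  fixes f g h :: "real \<Rightarrow> ennreal"
  assumes [measurable]: "f \<in> borel_measurable borel" "g \<in> borel_measurable borel" "h \<in> borel_measurable borel"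
    and le: "\<And>x y. f x * g y \<le> (h ((x + y) / 2))\<^sup>2"
  shows "(\<integral>\<^sup>+x. f x \<partial>lborel) * (\<integral>\<^sup>+x. g x \<partial>lborel) \<le> (\<integral>\<^sup>+x. h x \<partial>lborel)\<^sup>2"
proof -
  define f' where "f' n x = min (f x) (of_nat n) * indicator {..real n} x" for n x
  define g' where "g' n x = min (g x) (of_nat n) * indicator {- real n..} x" for n x
  have [measurable]: "f' n \<in> borel_measurable borel" "g' n \<in> borel_measurable borel" for n
    unfolding f'_def[abs_def] g'_def[abs_def] by measurable
  have mono: "incseq f'" "incseq g'"
    by (auto simp: incseq_def le_fun_def f'_def g'_def indicator_def intro: min.coboundedI2)
  have lim: "(SUP n. min (u x) (of_nat n) * indicator (D n) x) = u x"
    if D: "\<And>n. real n \<ge> \<bar>x\<bar> \<Longrightarrow> x \<in> D n" for u :: "real \<Rightarrow> ennreal" and x D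
  proof (rule antisym)
    show "(SUP n. min (u x) (of_nat n) * indicator (D n) x) \<le> u x"
      by (rule SUP_least) (auto simp: indicator_def)
    show "u x \<le> (SUP n. min (u x) (of_nat n) * indicator (D n) x)"
    proof (rule dense_le)
      fix y assume y: "y < u x"
      then obtain r where r: "y = ennreal r" "r \<ge> 0" by (cases y) auto
      obtain n :: nat where n: "real n \<ge> max \<bar>x\<bar> r" using real_arch_simple by blast
      then have "x \<in> D n" using D by auto
      have "y \<le> of_nat n" using n r by (simp add: ennreal_of_nat_eq_real_of_nat ennreal_leI)
      then have "y \<le> min (u x) (of_nat n) * indicator (D n) x"
        using y \<open>x \<in> D n\<close> by simp
      then show "y \<le> (SUP n. min (u x) (of_nat n) * indicator (D n) x)"
        by (rule SUP_upper2[rotated]) simp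
    qed
  qed
  have F: "(\<integral>\<^sup>+x. f x \<partial>lborel) = (SUP n. \<integral>\<^sup>+x. f' n x \<partial>lborel)"
  proof -
    have "f x = (SUP n. f' n x)" for x
      unfolding f'_def by (rule lim[symmetric]) auto
    then have "(\<integral>\<^sup>+x. f x \<partial>lborel) = (\<integral>\<^sup>+x. (SUP n. f' n x) \<partial>lborel)" by simp
    also have "\<dots> = (SUP n. \<integral>\<^sup>+x. f' n x \<partial>lborel)"
      by (rule nn_integral_monotone_convergence_SUP) (use mono in auto)
    finally show ?thesis .
  qed
  have G: "(\<integral>\<^sup>+x. g x \<partial>lborel) = (SUP n. \<integral>\<^sup>+x. g' n x \<partial>lborel)"
  proof -
    have "g x = (SUP n. g' n x)" for x
      unfolding g'_def by (rule lim[symmetric]) auto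
    then have "(\<integral>\<^sup>+x. g x \<partial>lborel) = (\<integral>\<^sup>+x. (SUP n. g' n x) \<partial>lborel)" by simp
    also have "\<dots> = (SUP n. \<integral>\<^sup>+x. g' n x \<partial>lborel)"
      by (rule nn_integral_monotone_convergence_SUP) (use mono in auto)
    finally show ?thesis .
  qed
  have bounded: "(\<integral>\<^sup>+x. f' n x \<partial>lborel) * (\<integral>\<^sup>+x. g' n x \<partial>lborel) \<le> (\<integral>\<^sup>+x. h x \<partial>lborel)\<^sup>2" for n
  proof (rule prekopa_leindler_bounded[where c = "real n" and b = "real n" and a = "- real n"])
    show "f' n x * g' n y \<le> (h ((x + y) / 2))\<^sup>2" for x y
      using order_trans[OF mult_mono le, of "f' n x" x "g' n y" y]
      by (auto simp: f'_def g'_def indicator_def)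
  qed (auto simp: f'_def g'_def indicator_def simp: ennreal_of_nat_eq_real_of_nat)
  have "(\<integral>\<^sup>+x. f' m x \<partial>lborel) * (\<integral>\<^sup>+x. g' n x \<partial>lborel) \<le> (\<integral>\<^sup>+x. h x \<partial>lborel)\<^sup>2" for m n
  proof -
    have "f' m x \<le> f' (max m n) x" "g' n x \<le> g' (max m n) x" for x
      using mono by (auto simp: incseq_def le_fun_def)
    then show ?thesis
      by (intro order_trans[OF mult_mono bounded[of "max m n"]] nn_integral_mono) auto
  qed
  then show ?thesis
    unfolding F G by (auto simp: SUP_mult_left_ennreal SUP_mult_right_ennreal intro!: SUP_least)
qed

text \<open>The inequality is stable under integrating out a coordinate: for fixed values \<open>a\<close> and \<open>b\<close> at the
  new site, the induction hypothesis says that the partial integrals satisfy the assumption of the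
  one-dimensional inequality. Only configurations supported in \<open>V\<close> matter, which is what allows
  inequalities for the Dirichlet form with zero boundary conditions to enter later.\<close>

theorem prekopa_leindler_midpoint:
  fixes V :: "'i set"
  assumes "finite V"
  shows "\<lbrakk>F \<in> borel_measurable config_algebra; G \<in> borel_measurable config_algebra;
      H \<in> borel_measurable config_algebra;
      \<And>X Y. X \<in> supported V \<Longrightarrow> Y \<in> supported V \<Longrightarrow> F X * G Y \<le> (H (\<lambda>i. (X i + Y i) / 2))\<^sup>2\<rbrakk> \<Longrightarrow>
    box_integral V F * box_integral V G \<le> (box_integral V H)\<^sup>2"
  using assms
proof (induction V arbitrary: F G H rule: finite_induct)
  case empty
  then show ?case
    using empty(4)[of "\<lambda>_. 0" "\<lambda>_. 0"] by (simp add: box_integral_empty supported_def)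
next
  case (insert i V)
  note [measurable] = insert.prems(1-3)
  have "box_integral V (\<lambda>X. F (X(i := a))) * box_integral V (\<lambda>X. G (X(i := b)))
      \<le> (box_integral V (\<lambda>X. H (X(i := (a + b) / 2))))\<^sup>2" for a b
  proof (rule insert.IH)
    fix X Y assume XY: "X \<in> supported V" "Y \<in> supported V"
    then have "X(i := a) \<in> supported (insert i V)" "Y(i := b) \<in> supported (insert i V)"
      by (auto simp: supported_def)
    moreover have "(\<lambda>j. ((X(i := a)) j + (Y(i := b)) j) / 2) = (\<lambda>j. (X j + Y j) / 2)(i := (a + b) / 2)"
      by auto
    ultimately show "F (X(i := a)) * G (Y(i := b)) \<le> (H ((\<lambda>j. (X j + Y j) / 2)(i := (a + b) / 2)))\<^sup>2"
      using insert.prems(4) by metis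
  qed measurable
  then show ?case
    unfolding box_integral_insert[OF insert.prems(1) insert.hyps]
      box_integral_insert[OF insert.prems(2) insert.hyps] box_integral_insert[OF insert.prems(3) insert.hyps]
    using insert.hyps by (intro prekopa_leindler_midpoint_real) measurable
qed

lemma ennreal_le_if_square_le:
  fixes a b :: ennreal
  assumes "a\<^sup>2 \<le> b\<^sup>2"
  shows "a \<le> b"
proof (rule ccontr)
  assume "\<not> a \<le> b"
  then have ab: "b < a" by simp
  then obtain s where s: "b = ennreal s" "s \<ge> 0" by (cases b) auto
  show False
  proof (cases a)
    case (real r)
    then have "s < r" using ab s by (simp add: ennreal_less_iff)
    then have "s\<^sup>2 < r\<^sup>2" using s by (intro power_strict_mono) auto
    moreover have "r\<^sup>2 \<le> s\<^sup>2" using assms real s by (simp add: ennreal_power)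
    ultimately show False by simp
  next
    case top
    then show False using assms s by (simp add: ennreal_power power2_eq_square top_unique ennreal_mult_eq_top_iff)
  qed
qed

section \<open>The Dirichlet form of a configuration\<close>

definition dirichlet_form :: "nat \<Rightarrow> (int ^ 'd::finite \<Rightarrow> real) \<Rightarrow> real" where
  "dirichlet_form N X = (\<Sum>(i, j)\<in>oriented_edges N. (X i - X j)\<^sup>2) / 2"

definition confined :: "nat \<Rightarrow> real \<Rightarrow> (int ^ 'd::finite \<Rightarrow> real) set" where
  "confined N l = {X. \<forall>i\<in>lattice_box N. \<bar>X i\<bar> \<le> l}"

lemma confined_measurable [measurable]: 
  "(\<lambda>X. indicator (confined N l) X :: ennreal) \<in> borel_measurable config_algebra"
proof -
  have "indicator (confined N l) X = (\<Prod>i\<in>lattice_box N. indicator {-l..l} (X i) :: ennreal)" for X :: "int ^ 'd \<Rightarrow> real"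
    by (auto simp: confined_def indicator_def prod_eq_1_iff prod_zero_iff finite_lattice_box abs_le_iff minus_le_iff)
  then have eq: "(indicator (confined N l) :: (int ^ 'd \<Rightarrow> real) \<Rightarrow> ennreal)
      = (\<lambda>X. \<Prod>i\<in>lattice_box N. indicator {-l..l} (X i))" by blast
  show ?thesis unfolding eq by measurable
qed

lemma dirichlet_form_scale: "dirichlet_form N (\<lambda>i. a * X i) = a\<^sup>2 * dirichlet_form N X"
  by (simp add: dirichlet_form_def sum_distrib_left case_prod_beta flip: power_mult_distrib right_diff_distrib)

lemma nearest_neighbours_sym: "nearest_neighbours i j \<longleftrightarrow> nearest_neighbours j i"
  by (simp add: nearest_neighbours_def abs_minus_commute)

lemma nearest_neighbours_irrefl: "\<not> nearest_neighbours i i"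
  by (simp add: nearest_neighbours_def)

text \<open>The two orientations of the edge make up for the factor \<open>1 / 2\<close>.\<close>

lemma edge_le_dirichlet_form:
  assumes "i \<in> lattice_box N" "nearest_neighbours i j"
  shows "(X i - X j)\<^sup>2 \<le> dirichlet_form N X"
proof -
  have ne: "i \<noteq> j" using assms nearest_neighbours_irrefl by auto
  have "(\<Sum>(i, j)\<in>{(i, j), (j, i)}. (X i - X j)\<^sup>2) \<le> (\<Sum>(i, j)\<in>oriented_edges N. (X i - X j)\<^sup>2)"
    using assms by (intro sum_mono2 finite_oriented_edges)
      (auto simp: oriented_edges_def nearest_neighbours_sym)
  then show ?thesis using ne by (simp add: dirichlet_form_def power2_commute)
qed

definition lattice_degree :: "'d::finite itself \<Rightarrow> nat" where
  "lattice_degree _ = card {j :: int ^ 'd. nearest_neighbours 0 j}"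

lemma neighbourhood_eq_image:
  "{j. nearest_neighbours i j} = (\<lambda>j. i + j) ` {j :: int ^ 'd::finite. nearest_neighbours 0 j}"
proof safe
  fix j assume "nearest_neighbours i j"
  then show "j \<in> (\<lambda>j. i + j) ` {j. nearest_neighbours 0 j}"
    by (intro image_eqI[of _ _ "j - i"]) (auto simp: nearest_neighbours_def abs_minus_commute)
qed (auto simp: nearest_neighbours_def)

lemma neighbourhood:
  fixes i :: "int ^ 'd::finite"
  shows finite_neighbourhood: "finite {j. nearest_neighbours i j}"
    and card_neighbourhood: "card {j. nearest_neighbours i j} = lattice_degree TYPE('d)"
proof -
  have "Pair (0 :: int ^ 'd) ` {j :: int ^ 'd. nearest_neighbours 0 j} \<subseteq> oriented_edges 0"
    by (auto simp: oriented_edges_def lattice_box_def)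
  then have "finite (Pair (0 :: int ^ 'd) ` {j :: int ^ 'd. nearest_neighbours 0 j})"
    by (rule finite_subset) (rule finite_oriented_edges)
  then have "finite {j. nearest_neighbours (0 :: int ^ 'd) j}"
    by (rule finite_imageD) (auto simp: inj_on_def)
  then show "finite {j. nearest_neighbours i j}"
    by (subst neighbourhood_eq_image) (rule finite_imageI)
  show "card {j. nearest_neighbours i j} = lattice_degree TYPE('d)"
    unfolding lattice_degree_def
    by (subst neighbourhood_eq_image) (rule card_image, auto simp: inj_on_def)
qed

text \<open>A bound that does not depend on \<open>N\<close>: every site has the same number of neighbours, so it suffices to
  control the gradients around each site of a set that contains the ends of all nontrivial edges.\<close>

lemma dirichlet_form_bound:
  fixes X :: "int ^ 'd::finite \<Rightarrow> real" and S :: "(int ^ 'd) set"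
  assumes "finite S"
    and b: "\<And>i j. nearest_neighbours i j \<Longrightarrow> i \<in> S \<Longrightarrow> (X i - X j)\<^sup>2 \<le> b i"
    and out: "\<And>i j. nearest_neighbours i j \<Longrightarrow> X i \<noteq> X j \<Longrightarrow> i \<in> S"
  shows "dirichlet_form N X \<le> lattice_degree TYPE('d) / 2 * (\<Sum>i\<in>S. b i)"
proof -
  have "(\<Sum>(i, j)\<in>oriented_edges N. (X i - X j)\<^sup>2) 
      = (\<Sum>(i, j)\<in>{e \<in> oriented_edges N. X (fst e) \<noteq> X (snd e)}. (X i - X j)\<^sup>2)"
    by (rule sum.mono_neutral_right) (auto simp: finite_oriented_edges)
  also have "\<dots> \<le> (\<Sum>(i, j)\<in>(SIGMA i:S. {j. nearest_neighbours i j}). (X i - X j)\<^sup>2)"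
    using assms(1) out
    by (intro sum_mono2) (auto simp: finite_neighbourhood oriented_edges_def)
  also have "\<dots> = (\<Sum>i\<in>S. \<Sum>j | nearest_neighbours i j. (X i - X j)\<^sup>2)"
    using assms(1) by (intro sum.Sigma[symmetric]) (auto simp: finite_neighbourhood)
  also have "\<dots> \<le> (\<Sum>i\<in>S. \<Sum>j | nearest_neighbours i j. b i)"
    by (intro sum_mono) (auto simp: b)
  also have "\<dots> = lattice_degree TYPE('d) * (\<Sum>i\<in>S. b i)"
    by (simp add: card_neighbourhood sum_distrib_left)
  finally show ?thesis by (simp add: dirichlet_form_def)
qed

section \<open>Energy, reflections and midpoints\<close>

text \<open>All that is used of the two-sided bound on the second derivative: strong convexity between two points
  and its midpoint, and a quadratic upper bound on symmetric second differences.\<close>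

locale convex_potential =
  fixes U :: "real \<Rightarrow> real" and c :: real
  assumes even: "U (- x) = U x"
    and c_pos: "c > 0"
    and U_measurable [measurable]: "U \<in> borel_measurable borel"
    and lower: "2 * U ((x + y) / 2) + c / 4 * (x - y)\<^sup>2 \<le> U x + U y"
    and upper: "U (x + h) + U (x - h) \<le> 2 * U x + h\<^sup>2 / c"

text \<open>Both inequalities express midpoint convexity, of \<open>U x - c x\<^sup>2 / 2\<close> and of \<open>x\<^sup>2 / (2 c) - U x\<close>.\<close>

lemma convex_potential_if_second_derivative_bounded:
  fixes U :: "real \<Rightarrow> real"
  assumes even: "\<And>x. U (- x) = U x"
    and d1: "\<And>x. U differentiable (at x)"
    and d2: "\<And>x. deriv U differentiable (at x)"
    and c: "c > 0"
    and bounds: "\<And>x. c < deriv (deriv U) x \<and> deriv (deriv U) x < 1 / c"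
  shows "convex_potential U c"
proof
  have D1 [derivative_intros]: "(U has_real_derivative deriv U x) (at x)" for x
    using d1 by (simp add: DERIV_deriv_iff_real_differentiable)
  have D2 [derivative_intros]: "(deriv U has_real_derivative deriv (deriv U) x) (at x)" for x
    using d2 by (simp add: DERIV_deriv_iff_real_differentiable)
  have "continuous_on UNIV U"
    using D1 by (auto intro!: continuous_at_imp_continuous_on DERIV_isCont)
  then show "U \<in> borel_measurable borel" by (rule borel_measurable_continuous_onI)
  have low: "convex_on UNIV (\<lambda>x. U x - c / 2 * x\<^sup>2)"
    by (rule f''_ge0_imp_convex[where f' = "\<lambda>x. deriv U x - c * x" and f'' = "\<lambda>x. deriv (deriv U) x - c"])
      (use bounds in \<open>auto intro!: derivative_eq_intros less_imp_le simp: power2_eq_square\<close>)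
  have up: "convex_on UNIV (\<lambda>x. 1 / (2 * c) * x\<^sup>2 - U x)"
    by (rule f''_ge0_imp_convex[where f' = "\<lambda>x. 1 / c * x - deriv U x" and f'' = "\<lambda>x. 1 / c - deriv (deriv U) x"])
      (use bounds c in \<open>auto intro!: derivative_eq_intros less_imp_le simp: power2_eq_square\<close>)
  show "2 * U ((x + y) / 2) + c / 4 * (x - y)\<^sup>2 \<le> U x + U y" for x y
    using convex_onD[OF low, of "1/2" x y] by (simp add: field_simps power2_eq_square)
  show "U (x + h) + U (x - h) \<le> 2 * U x + h\<^sup>2 / c" for x h
  proof -
    define k where "k = 1 / (2 * c)"
    define P where "P = k * (x + h)\<^sup>2"
    define Q where "Q = k * (x - h)\<^sup>2"
    have PQ: "P + Q = 2 * (k * x\<^sup>2) + 2 * (k * h\<^sup>2)"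
      unfolding P_def Q_def by (simp add: algebra_simps power2_eq_square)
    have mid: "(1 / 2) * (x + h) + (1 / 2) * (x - h) = x" by (simp add: field_simps)
    have "k * x\<^sup>2 - U x \<le> (1 / 2) * (P - U (x + h)) + (1 / 2) * (Q - U (x - h))"
      using convex_onD[OF up, of "1/2" "x + h" "x - h"] mid unfolding k_def P_def Q_def by simp
    then have "U (x + h) + U (x - h) \<le> 2 * U x + 2 * (k * h\<^sup>2)"
      using PQ by (simp add: field_simps)
    then show ?thesis using c by (simp add: k_def)
  qed
qed (fact even c)+

context convex_potential
begin

lemma energy_minus: "energy U N (\<lambda>i. - X i) = energy U N X"
proof -
  have "U (- X i - - X j) = U (X i - X j)" for i j
    using even[of "X i - X j"] by simp
  then show ?thesis by (simp add: energy_def)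
qed

lemma energy_symmetrised_shift:
  "energy U N (\<lambda>i. X i + \<phi> i) + energy U N (\<lambda>i. X i - \<phi> i) \<le> 2 * energy U N X + dirichlet_form N \<phi> / c"
proof -
  have "U ((X i + \<phi> i) - (X j + \<phi> j)) + U ((X i - \<phi> i) - (X j - \<phi> j)) 
      \<le> 2 * U (X i - X j) + (\<phi> i - \<phi> j)\<^sup>2 / c" for i j
    using upper[of "X i - X j" "\<phi> i - \<phi> j"] by (simp add: algebra_simps)
  then have "(\<Sum>(i, j)\<in>oriented_edges N. U ((X i + \<phi> i) - (X j + \<phi> j)) + U ((X i - \<phi> i) - (X j - \<phi> j)))
      \<le> (\<Sum>(i, j)\<in>oriented_edges N. 2 * U (X i - X j) + (\<phi> i - \<phi> j)\<^sup>2 / c)"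
    by (intro sum_mono) auto
  then show ?thesis
    unfolding energy_def dirichlet_form_def
    by (simp add: case_prod_beta sum.distrib sum_distrib_left[symmetric] sum_divide_distrib[symmetric])
qed

lemma energy_midpoint:
  "2 * energy U N (\<lambda>i. (X i + Y i) / 2) + c / 4 * dirichlet_form N (\<lambda>i. X i - Y i) \<le> energy U N X + energy U N Y"
proof -
  have "2 * U ((X i + Y i) / 2 - (X j + Y j) / 2) + c / 4 * ((X i - Y i) - (X j - Y j))\<^sup>2
     \<le> U (X i - X j) + U (Y i - Y j)" for i j
    using lower[of "X i - X j" "Y i - Y j"] by (simp add: algebra_simps diff_divide_distrib add_divide_distrib)
  then have "(\<Sum>(i, j)\<in>oriented_edges N. 2 * U ((X i + Y i) / 2 - (X j + Y j) / 2) + c / 4 * ((X i - Y i) - (X j - Y j))\<^sup>2)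
     \<le> (\<Sum>(i, j)\<in>oriented_edges N. U (X i - X j) + U (Y i - Y j))"
    by (intro sum_mono) auto
  then show ?thesis
    unfolding energy_def dirichlet_form_def
    by (simp add: case_prod_beta sum.distrib sum_distrib_left[symmetric] sum_divide_distrib[symmetric])
qed

definition weight :: "nat \<Rightarrow> (int ^ 'd::finite \<Rightarrow> real) \<Rightarrow> ennreal" where
  "weight N X = ennreal (exp (- energy U N X))"

lemma weight_measurable [measurable]: "weight N \<in> borel_measurable config_algebra"
  unfolding weight_def[abs_def] energy_def by (auto simp: case_prod_beta)

lemma weight_minus: "weight N (\<lambda>i. - X i) = weight N X"
  by (simp add: weight_def energy_minus)

lemma weight_midpoint:
  "weight N X * weight N Y \<le> 
    (ennreal (exp (- c / 8 * dirichlet_form N (\<lambda>i. X i - Y i))) * weight N (\<lambda>i. (X i + Y i) / 2))\<^sup>2"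
proof -
  have "exp (- energy U N X) * exp (- energy U N Y) \<le>
    (exp (- c / 8 * dirichlet_form N (\<lambda>i. X i - Y i)) * exp (- energy U N (\<lambda>i. (X i + Y i) / 2)))\<^sup>2"
    using energy_midpoint[of N X Y] by (simp add: power2_eq_square flip: exp_add)
  then show ?thesis
    unfolding weight_def by (simp add: ennreal_leI ennreal_power flip: ennreal_mult)
qed

lemma weight_symmetrised_shift:
  "2 * (ennreal (exp (- dirichlet_form N \<phi> / (2 * c))) * weight N X)
     \<le> weight N (\<lambda>i. X i + \<phi> i) + weight N (\<lambda>i. X i - \<phi> i)"
proof -
  define u where "u = energy U N (\<lambda>i. X i + \<phi> i)"
  define v where "v = energy U N (\<lambda>i. X i - \<phi> i)"
  have "2 * (exp (- u / 2) * exp (- v / 2)) \<le> (exp (- u / 2))\<^sup>2 + (exp (- v / 2))\<^sup>2"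
    using zero_le_power2[of "exp (- u / 2) - exp (- v / 2)"] by (simp add: power2_eq_square algebra_simps)
  then have "2 * exp (- (u + v) / 2) \<le> exp (- u) + exp (- v)"
    by (simp add: power2_eq_square add_divide_distrib diff_divide_distrib flip: exp_add)
  moreover have "exp (- dirichlet_form N \<phi> / (2 * c)) * exp (- energy U N X) \<le> exp (- (u + v) / 2)"
    using energy_symmetrised_shift[of N X \<phi>] c_pos unfolding u_def v_def
    by (simp add: field_simps flip: exp_add)
  ultimately have "2 * (exp (- dirichlet_form N \<phi> / (2 * c)) * exp (- energy U N X)) \<le> exp (- u) + exp (- v)"
    by simp
  then have "ennreal (2 * (exp (- dirichlet_form N \<phi> / (2 * c)) * exp (- energy U N X))) \<le> ennreal (exp (- u) + exp (- v))"
    by (rule ennreal_leI)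
  then show ?thesis unfolding weight_def u_def v_def by (simp add: ennreal_mult)
qed

text \<open>Moving all configurations by \<open>\<phi>\<close> changes the energy by a term that is linear in \<open>\<phi>\<close> and may be
  large. On a set that is invariant under \<open>X \<mapsto> - X\<close> the shifts by \<open>\<phi>\<close> and by \<open>- \<phi>\<close> yield the same
  integral, and averaging the two cancels the linear term; only the Dirichlet form of \<open>\<phi>\<close> remains.\<close>

lemma shifted_weight_ge:
  fixes S :: "(int ^ 'd::finite \<Rightarrow> real) set"
  assumes V: "finite V"
    and S [measurable]: "(\<lambda>X. indicator S X :: ennreal) \<in> borel_measurable config_algebra"
    and symm: "\<And>X. X \<in> supported V \<Longrightarrow> X \<in> S \<Longrightarrow> (\<lambda>i. - X i) \<in> S"
  shows "ennreal (exp (- dirichlet_form N \<phi> / (2 * c))) * box_integral V (\<lambda>X. weight N X * indicator S X)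
    \<le> box_integral V (\<lambda>X. weight N (\<lambda>i. X i + \<phi> i) * indicator S X)"
proof -
  have [measurable]: "(\<lambda>X i. X i + \<phi> i) \<in> measurable config_algebra config_algebra"
    "(\<lambda>X i. X i - \<phi> i) \<in> measurable config_algebra config_algebra"
    by (rule measurable_PiM_single'; simp)+
  let ?q = "ennreal (exp (- dirichlet_form N \<phi> / (2 * c)))"
  let ?L = "box_integral V (\<lambda>X. weight N (\<lambda>i. X i + \<phi> i) * indicator S X)"
  have "?L = box_integral V (\<lambda>X. weight N (\<lambda>i. (-1 * X i + 0) + \<phi> i) * indicator S (\<lambda>i. -1 * X i + 0))"
    using V by (subst box_integral_affine[where s = "-1" and \<phi> = "\<lambda>_. 0"
        and F = "\<lambda>X. weight N (\<lambda>i. X i + \<phi> i) * indicator S X", symmetric]) (auto simp: supported_def)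
  also have "\<dots> = box_integral V (\<lambda>X. weight N (\<lambda>i. X i - \<phi> i) * indicator S X)"
  proof (rule box_integral_cong)
    fix X assume X: "X \<in> supported V"
    have "weight N (\<lambda>i. (-1 * X i + 0) + \<phi> i) = weight N (\<lambda>i. X i - \<phi> i)"
      by (subst weight_minus[symmetric]) simp
    moreover have "(\<lambda>i. - X i) \<in> S \<longleftrightarrow> X \<in> S"
      using symm[OF X] symm[of "\<lambda>i. - X i"] X by (auto simp: supported_def)
    ultimately show "weight N (\<lambda>i. (-1 * X i + 0) + \<phi> i) * indicator S (\<lambda>i. -1 * X i + 0)
        = weight N (\<lambda>i. X i - \<phi> i) * indicator S X"
      by (simp add: indicator_def)
  qed
  finally have "2 * ?L = ?L + box_integral V (\<lambda>X. weight N (\<lambda>i. X i - \<phi> i) * indicator S X)"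
    by (simp add: mult_2)
  also have "\<dots> = box_integral V (\<lambda>X. weight N (\<lambda>i. X i + \<phi> i) * indicator S X + weight N (\<lambda>i. X i - \<phi> i) * indicator S X)"
    by (rule box_integral_add[symmetric]) measurable
  also have "\<dots> \<ge> box_integral V (\<lambda>X. 2 * ?q * (weight N X * indicator S X))"
  proof (rule box_integral_mono)
    fix X :: "int ^ 'd \<Rightarrow> real"
    show "2 * ?q * (weight N X * indicator S X)
        \<le> weight N (\<lambda>i. X i + \<phi> i) * indicator S X + weight N (\<lambda>i. X i - \<phi> i) * indicator S X"
      using weight_symmetrised_shift[of N \<phi> X] by (auto simp: indicator_def ac_simps)
  qed
  also have "box_integral V (\<lambda>X. 2 * ?q * (weight N X * indicator S X)) =
      2 * ?q * box_integral V (\<lambda>X. weight N X * indicator S X)"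
    by (rule box_integral_cmult) measurable
  finally have "2 * (?q * box_integral V (\<lambda>X. weight N X * indicator S X)) \<le> 2 * ?L"
    by (simp only: mult.assoc)
  then show ?thesis
    by (subst (asm) ennreal_mult_le_mult_iff) auto
qed


section \<open>Many disjoint copies of the confined configurations\<close>

definition free_mass :: "nat \<Rightarrow> (int ^ 'd::finite) set \<Rightarrow> ennreal" where
  "free_mass N V = box_integral V (weight N)"

definition confined_mass :: "nat \<Rightarrow> real \<Rightarrow> (int ^ 'd::finite) set \<Rightarrow> ennreal" where
  "confined_mass N l V = box_integral V (\<lambda>X. weight N X * indicator (confined N l) X)"

text \<open>Let \<open>S\<close> be a symmetric set of configurations with height at most \<open>l\<close> at \<open>t\<close>. Adding or subtracting
  \<open>3 l \<phi>\<^sub>t\<close> moves the height at \<open>t\<close> out of \<open>{- l..l}\<close>, so \<open>S\<close> and its two shifts are disjoint; each shift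
  has at least \<open>q\<close> times the mass of \<open>S\<close>. The union of the three is again symmetric, and the heights at
  the other sites of \<open>T\<close> are still confined because \<open>\<phi>\<^sub>t\<close> vanishes there. Hence the construction can be
  repeated at every site of \<open>T\<close>, and the resulting mass is bounded by the total mass.\<close>

lemma spread_confined_mass:
  fixes \<phi> :: "int ^ 'd::finite \<Rightarrow> int ^ 'd \<Rightarrow> real"
  assumes T: "finite T" "T \<subseteq> lattice_box N"
    and l: "l > 0"
    and supp: "\<And>t. t \<in> T \<Longrightarrow> \<phi> t \<in> supported (lattice_box N)"
    and peak: "\<And>t. t \<in> T \<Longrightarrow> \<phi> t t = 1"
    and zero: "\<And>s t. s \<in> T \<Longrightarrow> t \<in> T \<Longrightarrow> s \<noteq> t \<Longrightarrow> \<phi> s t = 0"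
    and D: "\<And>t. t \<in> T \<Longrightarrow> dirichlet_form N (\<phi> t) \<le> D"
  defines "q \<equiv> exp (- (9 * l\<^sup>2 * D) / (2 * c))"
  shows "(1 + 2 * ennreal q) ^ card T * confined_mass N l (lattice_box N :: (int ^ 'd) set)
    \<le> free_mass N (lattice_box N :: (int ^ 'd) set)"
proof -
  define \<Lambda> where "\<Lambda> = (lattice_box N :: (int ^ 'd) set)"
  have fin: "finite \<Lambda>" unfolding \<Lambda>_def by (rule finite_lattice_box)
  have "\<exists>S. (\<lambda>X. indicator S X :: ennreal) \<in> borel_measurable config_algebra \<and>
      (\<forall>X\<in>S. (\<lambda>i. - X i) \<in> S) \<and> (\<forall>X\<in>S. \<forall>t\<in>T - R. \<bar>X t\<bar> \<le> l) \<and>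
      (1 + 2 * ennreal q) ^ card R * confined_mass N l \<Lambda> \<le> box_integral \<Lambda> (\<lambda>X. weight N X * indicator S X)"
    if "finite R" "R \<subseteq> T" for R
    using that
  proof (induction R rule: finite_induct)
    case empty
    then show ?case
      using T(2) by (intro exI[of _ "confined N l"]) (auto simp: confined_mass_def confined_def)
  next
    case (insert t R)
    then obtain S where S [measurable]: "(\<lambda>X. indicator S X :: ennreal) \<in> borel_measurable config_algebra"
      and symm: "\<And>X. X \<in> S \<Longrightarrow> (\<lambda>i. - X i) \<in> S" and small: "\<And>X s. X \<in> S \<Longrightarrow> s \<in> T - R \<Longrightarrow> \<bar>X s\<bar> \<le> l"
      and mass: "(1 + 2 * ennreal q) ^ card R * confined_mass N l \<Lambda> \<le> box_integral \<Lambda> (\<lambda>X. weight N X * indicator S X)"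
      by auto
    let ?m = "box_integral \<Lambda> (\<lambda>X. weight N X * indicator S X)"
    define \<psi> where "\<psi> = (\<lambda>i. 3 * l * \<phi> t i)"
    have t: "t \<in> T" "t \<in> T - R" using insert by auto
    have \<psi>: "\<psi> \<in> supported \<Lambda>" "\<psi> t = 3 * l" "\<And>s. s \<in> T \<Longrightarrow> s \<noteq> t \<Longrightarrow> \<psi> s = 0"
      using supp[OF t(1)] peak[OF t(1)] zero[OF t(1)] by (auto simp: \<psi>_def supported_def \<Lambda>_def)
    define S' where "S' = {X. X \<in> S \<or> (\<lambda>i. X i + \<psi> i) \<in> S \<or> (\<lambda>i. X i - \<psi> i) \<in> S}"
    have translate [measurable]: "(\<lambda>X i. X i + a * \<psi> i) \<in> measurable config_algebra config_algebra" for a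
      by (rule measurable_PiM_single') auto
    have [measurable]: "(\<lambda>X. indicator S (\<lambda>i. X i + a * \<psi> i) :: ennreal) \<in> borel_measurable config_algebra" for a
      by measurable
    \<comment> \<open>At \<open>t\<close> the three sets differ by \<open>3 * l\<close>, hence they are disjoint.\<close>
    have ind: "indicator S' X = (indicator S X + indicator S (\<lambda>i. X i + 1 * \<psi> i) + indicator S (\<lambda>i. X i + (-1) * \<psi> i) :: ennreal)" for X
    proof -
      have "\<not> (X \<in> S \<and> (\<lambda>i. X i + \<psi> i) \<in> S)" "\<not> (X \<in> S \<and> (\<lambda>i. X i - \<psi> i) \<in> S)"
        "\<not> ((\<lambda>i. X i + \<psi> i) \<in> S \<and> (\<lambda>i. X i - \<psi> i) \<in> S)"
        using small[OF _ t(2), of X] small[OF _ t(2), of "\<lambda>i. X i + \<psi> i"] small[OF _ t(2), of "\<lambda>i. X i - \<psi> i"] \<psi>(2) l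
        by force+
      then show ?thesis by (auto simp: S'_def indicator_def)
    qed
    have summand: "(\<lambda>X. weight N X * indicator S (\<lambda>i. X i + a * \<psi> i)) \<in> borel_measurable config_algebra" for a
      by measurable
    have shift: "ennreal q * ?m \<le> box_integral \<Lambda> (\<lambda>X. weight N X * indicator S (\<lambda>i. X i + a * \<psi> i))"
      if "\<bar>a\<bar> = 1" for a
    proof -
      have a2: "a\<^sup>2 = 1" using that by (metis power2_abs one_power2)
      have "dirichlet_form N (\<lambda>i. - a * \<psi> i) \<le> 9 * l\<^sup>2 * D"
        unfolding \<psi>_def dirichlet_form_scale using D[OF t(1)] a2
        by (auto simp: power_mult_distrib intro!: mult_left_mono)
      then have "ennreal q \<le> ennreal (exp (- dirichlet_form N (\<lambda>i. - a * \<psi> i) / (2 * c)))"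
        unfolding q_def using c_pos by (intro ennreal_leI) (simp add: divide_right_mono)
      then have "ennreal q * ?m \<le> ennreal (exp (- dirichlet_form N (\<lambda>i. - a * \<psi> i) / (2 * c))) * ?m"
        by (rule mult_right_mono) simp
      also have "\<dots> \<le> box_integral \<Lambda> (\<lambda>X. weight N (\<lambda>i. X i + - a * \<psi> i) * indicator S X)"
        by (rule shifted_weight_ge) (use fin symm in auto)
      also have "\<dots> = box_integral \<Lambda> (\<lambda>X. weight N (\<lambda>i. (1 * X i + a * \<psi> i) + - a * \<psi> i) * indicator S (\<lambda>i. 1 * X i + a * \<psi> i))"
      proof (rule box_integral_affine[where s = 1 and \<phi> = "\<lambda>i. a * \<psi> i"
            and F = "\<lambda>X. weight N (\<lambda>i. X i + - a * \<psi> i) * indicator S X", symmetric])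
        show "(\<lambda>X. weight N (\<lambda>i. X i + - a * \<psi> i) * indicator S X) \<in> borel_measurable config_algebra"
          by (intro borel_measurable_times_ennreal S measurable_compose[OF translate weight_measurable])
      qed (use fin \<psi>(1) in \<open>auto simp: supported_def\<close>)
      finally show ?thesis by simp
    qed
    have "(1 + 2 * ennreal q) ^ card (insert t R) * confined_mass N l \<Lambda> \<le> (1 + 2 * ennreal q) * ?m"
      using mult_left_mono[OF mass, of "1 + 2 * ennreal q"] insert.hyps by (simp add: mult.assoc)
    also have "\<dots> = ?m + ennreal q * ?m + ennreal q * ?m"
      by (simp add: distrib_right mult_2 add.assoc)
    also have "\<dots> \<le> ?m + box_integral \<Lambda> (\<lambda>X. weight N X * indicator S (\<lambda>i. X i + 1 * \<psi> i))
         + box_integral \<Lambda> (\<lambda>X. weight N X * indicator S (\<lambda>i. X i + (-1) * \<psi> i))"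
      by (intro add_mono shift order_refl) auto
    also have "\<dots> = box_integral \<Lambda> (\<lambda>X. weight N X * indicator S' X)"
      unfolding ind distrib_left
      by (simp only: box_integral_add summand borel_measurable_add S borel_measurable_times_ennreal weight_measurable)
    finally have "(1 + 2 * ennreal q) ^ card (insert t R) * confined_mass N l \<Lambda>
        \<le> box_integral \<Lambda> (\<lambda>X. weight N X * indicator S' X)" .
    moreover have "(\<lambda>X. indicator S' X :: ennreal) \<in> borel_measurable config_algebra"
      unfolding ind by measurable
    moreover have "\<forall>X\<in>S'. (\<lambda>i. - X i) \<in> S'"
    proof
      fix X assume "X \<in> S'"
      then show "(\<lambda>i. - X i) \<in> S'"
        using symm[of X] symm[of "\<lambda>i. X i + \<psi> i"] symm[of "\<lambda>i. X i - \<psi> i"]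
        by (auto simp: S'_def)
    qed
    moreover have "\<forall>X\<in>S'. \<forall>s\<in>T - insert t R. \<bar>X s\<bar> \<le> l"
    proof (intro ballI)
      fix X s assume "X \<in> S'" "s \<in> T - insert t R"
      then show "\<bar>X s\<bar> \<le> l"
        using small[of X s] small[of "\<lambda>i. X i + \<psi> i" s] small[of "\<lambda>i. X i - \<psi> i" s] \<psi>(3)[of s]
        by (auto simp: S'_def)
    qed
    ultimately show ?case by blast
  qed
  from this[OF T(1) order_refl] obtain S where
    "(1 + 2 * ennreal q) ^ card T * confined_mass N l \<Lambda> \<le> box_integral \<Lambda> (\<lambda>X. weight N X * indicator S X)"
    by auto
  also have "\<dots> \<le> box_integral \<Lambda> (weight N)"
    by (rule box_integral_mono) (auto simp: indicator_def)
  finally show ?thesis by (simp add: free_mass_def \<Lambda>_def)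
qed

section \<open>Pinning sites to zero\<close>

definition pinning_cost :: ennreal where
  "pinning_cost = (\<integral>\<^sup>+ a. ennreal (exp (- c / 2 * a\<^sup>2)) \<partial>lborel)"

lemma pinning_cost_finite: "pinning_cost < top"
proof -
  define \<sigma> where "\<sigma> = 1 / sqrt c"
  have \<sigma>: "\<sigma> > 0" "\<sigma>\<^sup>2 = 1 / c" using c_pos by (auto simp: \<sigma>_def power_divide)
  have *: "exp (- c / 2 * a\<^sup>2) = sqrt (2 * pi * \<sigma>\<^sup>2) * normal_density 0 \<sigma> a" for a
    using \<sigma> c_pos by (simp add: normal_density_def)
  have "pinning_cost = (\<integral>\<^sup>+ a. ennreal (sqrt (2 * pi * \<sigma>\<^sup>2)) * ennreal (normal_density 0 \<sigma> a) \<partial>lborel)"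
    unfolding pinning_cost_def * by (subst ennreal_mult) (auto)
  also have "\<dots> = ennreal (sqrt (2 * pi * \<sigma>\<^sup>2)) * (\<integral>\<^sup>+ a. ennreal (normal_density 0 \<sigma> a) \<partial>lborel)"
    by (rule nn_integral_cmult) measurable
  also have "(\<integral>\<^sup>+ a. ennreal (normal_density 0 \<sigma> a) \<partial>lborel) = 1"
    using prob_space.emeasure_space_1[OF prob_space_normal_density[OF \<sigma>(1), of 0]]
    by (simp add: emeasure_density)
  finally show ?thesis by simp
qed

text \<open>As a function of the height \<open>a\<close> at \<open>i\<close>, the mass is even, and the midpoint of configurations with
  heights \<open>a\<close> and \<open>- a\<close> has height \<open>0\<close>; by Prekopa-Leindler the mass is largest for \<open>a = 0\<close>. The edge from
  \<open>i\<close> to the vanishing height at \<open>j\<close> contributes \<open>(2 a)\<^sup>2\<close> to the Dirichlet form of the difference, and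
  strong convexity turns this into Gaussian decay in \<open>a\<close>, uniformly in \<open>V\<close>.\<close>

lemma free_mass_pin_site:
  assumes V: "finite V" "i \<notin> V" "j \<notin> V" and i: "i \<in> lattice_box N" "nearest_neighbours i j"
  shows "free_mass N (insert i V) \<le> pinning_cost * free_mass N V"
proof -
  have "j \<noteq> i" using i(2) nearest_neighbours_irrefl by auto
  have slice: "box_integral V (\<lambda>X. weight N (X(i := a))) \<le> ennreal (exp (- c / 2 * a\<^sup>2)) * free_mass N V" for a
  proof (rule ennreal_le_if_square_le)
    let ?q = "ennreal (exp (- c / 2 * a\<^sup>2))"
    have "box_integral V (\<lambda>X. weight N (X(i := a))) * box_integral V (\<lambda>X. weight N (X(i := - a)))
        \<le> (box_integral V (\<lambda>X. ?q * weight N X))\<^sup>2"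
    proof (rule prekopa_leindler_midpoint[OF V(1)])
      fix X Y assume XY: "X \<in> supported V" "Y \<in> supported V"
      let ?X = "X(i := a)" and ?Y = "Y(i := - a)"
      have "(2 * a)\<^sup>2 \<le> dirichlet_form N (\<lambda>k. ?X k - ?Y k)"
        using edge_le_dirichlet_form[OF i, of "\<lambda>k. ?X k - ?Y k"] \<open>j \<noteq> i\<close> V(3) XY by (auto simp: supported_def)
      then have "exp (- c / 8 * dirichlet_form N (\<lambda>k. ?X k - ?Y k)) \<le> exp (- c / 2 * a\<^sup>2)"
        using c_pos by (simp add: power_mult_distrib)
      moreover have "(\<lambda>k. (?X k + ?Y k) / 2) = (\<lambda>k. (X k + Y k) / 2)"
        using XY V(2) by (auto simp: supported_def)
      ultimately show "weight N ?X * weight N ?Y \<le> (?q * weight N (\<lambda>k. (X k + Y k) / 2))\<^sup>2"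
        by (intro order_trans[OF weight_midpoint] power_mono mult_mono) (auto intro: ennreal_leI)
    qed measurable
    also have "box_integral V (\<lambda>X. ?q * weight N X) = ?q * free_mass N V"
      unfolding free_mass_def by (rule box_integral_cmult) measurable
    also have "box_integral V (\<lambda>X. weight N (X(i := - a))) = box_integral V (\<lambda>X. weight N (X(i := a)))"
    proof -
      have *: "weight N ((\<lambda>k. -1 * X k + 0)(i := - a)) = weight N (X(i := a))" for X
        by (subst weight_minus[symmetric], rule arg_cong[of _ _ "weight N"]) auto
      have "box_integral V (\<lambda>X. weight N ((\<lambda>k. -1 * X k + 0)(i := - a))) = box_integral V (\<lambda>X. weight N (X(i := - a)))"
        by (rule box_integral_affine) (use V(1) in \<open>auto simp: supported_def\<close>)
      then show ?thesis unfolding * by simp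
    qed
    finally show "(box_integral V (\<lambda>X. weight N (X(i := a))))\<^sup>2 \<le> (?q * free_mass N V)\<^sup>2"
      by (simp only: power2_eq_square)
  qed
  have "free_mass N (insert i V) = (\<integral>\<^sup>+ a. box_integral V (\<lambda>X. weight N (X(i := a))) \<partial>lborel)"
    unfolding free_mass_def by (rule box_integral_insert) (use V in auto)
  also have "\<dots> \<le> (\<integral>\<^sup>+ a. ennreal (exp (- c / 2 * a\<^sup>2)) * free_mass N V \<partial>lborel)"
    by (intro nn_integral_mono slice)
  also have "\<dots> = pinning_cost * free_mass N V"
    unfolding pinning_cost_def by (rule nn_integral_multc) measurable
  finally show ?thesis .
qed

text \<open>The sites of \<open>G\<close> are pinned in order of decreasing \<open>height\<close>, so that each of them has a neighbour
  that is already zero when its turn comes.\<close>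

lemma free_mass_pin:
  fixes height :: "int ^ 'd::finite \<Rightarrow> int"
  assumes "finite V" "finite G" "G \<inter> V = {}" "G \<subseteq> lattice_box N"
    and "\<And>i. i \<in> G \<Longrightarrow> \<exists>j. nearest_neighbours i j \<and> height j > height i \<and> j \<notin> V"
  shows "free_mass N (V \<union> G) \<le> pinning_cost ^ card G * free_mass N V"
  using assms(2-5)
proof (induction "card G" arbitrary: G)
  case 0
  then show ?case by simp
next
  case (Suc n)
  have "G \<noteq> {}" using Suc(2) by auto
  then have "Max (height ` G) \<in> height ` G" using Suc(3) by (intro Max_in) auto
  then obtain i where "i \<in> G" "height i = Max (height ` G)" by auto
  then have i: "i \<in> G" "\<And>k. k \<in> G \<Longrightarrow> height k \<le> height i" using Suc(3) by auto
  obtain j where j: "nearest_neighbours i j" "height j > height i" "j \<notin> V" using Suc(6)[OF i(1)] by auto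
  have "j \<notin> G" using i(2) j(2) by force
  have "free_mass N (V \<union> G) = free_mass N (insert i (V \<union> (G - {i})))"
    using i by (intro arg_cong[of _ _ "free_mass N"]) auto
  also have "\<dots> \<le> pinning_cost * free_mass N (V \<union> (G - {i}))"
    using i j Suc assms(1) \<open>j \<notin> G\<close> by (intro free_mass_pin_site[of _ i j]) auto
  also have "\<dots> \<le> pinning_cost * (pinning_cost ^ card (G - {i}) * free_mass N V)"
    using Suc i by (intro mult_left_mono Suc(1)) auto
  also have "\<dots> = pinning_cost ^ Suc (card (G - {i})) * free_mass N V"
    by (simp add: mult.assoc)
  also have "Suc (card (G - {i})) = card G"
    using i Suc(3) by (intro card_Suc_Diff1)
  finally show ?case .
qed

end

lemma nearest_neighbours_add_axis: "nearest_neighbours i (i + axis k 1)"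
  by (simp add: nearest_neighbours_def axis_def if_distrib cong: if_cong)

lemma sum_coordinates_add_axis: "(\<Sum>k\<in>UNIV. (i + axis m (1::int)) $ k) = (\<Sum>k\<in>UNIV. i $ k) + 1"
  by (simp add: sum.distrib axis_def)

lemma dirichlet_form_point_mass:
  fixes i :: "int ^ 'd::finite"
  shows "dirichlet_form N (\<lambda>j. if j = i then 1 else 0)
    \<le> lattice_degree TYPE('d) * (1 + real (lattice_degree TYPE('d))) / 2"
proof -
  have "dirichlet_form N (\<lambda>j. if j = i then 1 else 0)
      \<le> lattice_degree TYPE('d) / 2 * (\<Sum>j\<in>insert i {j. nearest_neighbours i j}. 1)"
    by (rule dirichlet_form_bound)
      (auto simp: finite_neighbourhood split: if_splits intro: nearest_neighbours_sym[THEN iffD1])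
  also have "(\<Sum>j\<in>insert i {j. nearest_neighbours i j}. 1) = 1 + real (lattice_degree TYPE('d))"
    by (simp add: finite_neighbourhood card_neighbourhood nearest_neighbours_irrefl)
  finally show ?thesis by simp
qed

context convex_potential
begin

definition pin_factor :: "'d::finite itself \<Rightarrow> real" where
  "pin_factor d = exp (- (real (lattice_degree d) * (1 + real (lattice_degree d)) / (4 * c)))"

text \<open>Restricting the height at \<open>i\<close> to \<open>{0..1}\<close> keeps the confinement and loses a constant factor only, by
  the sign-averaged shift with a multiple of the point mass at \<open>i\<close>.\<close>

lemma confined_mass_pin_site:
  fixes V :: "(int ^ 'd::finite) set"
  assumes V: "finite V" "i \<notin> V" and l: "l \<ge> 1"
  shows "ennreal (pin_factor TYPE('d)) * confined_mass N l V \<le> confined_mass N l (insert i V)"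
proof -
  let ?p = "ennreal (pin_factor TYPE('d))" and ?n = "lattice_degree TYPE('d)"
  let ?f = "\<lambda>X. weight N X * indicator (confined N l) X"
  define \<delta> where "\<delta> = (\<lambda>j. if j = i then 1 else 0 :: real)"
  have D: "dirichlet_form N \<delta> \<le> ?n * (1 + real ?n) / 2"
    unfolding \<delta>_def by (rule dirichlet_form_point_mass)
  have slice: "?p * confined_mass N l V \<le> box_integral V (\<lambda>X. ?f (X(i := a)))" if a: "\<bar>a\<bar> \<le> 1" for a
  proof -
    have "dirichlet_form N (\<lambda>j. a * \<delta> j) \<le> 1 * dirichlet_form N \<delta>"
      unfolding dirichlet_form_scale
      using a by (intro mult_right_mono) (auto simp: abs_square_le_1 dirichlet_form_def case_prod_beta intro!: sum_nonneg)
    then have "pin_factor TYPE('d) \<le> exp (- dirichlet_form N (\<lambda>j. a * \<delta> j) / (2 * c))"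
    proof -
      have "dirichlet_form N (\<lambda>j. a * \<delta> j) \<le> ?n * (1 + real ?n) / 2"
        using D \<open>dirichlet_form N (\<lambda>j. a * \<delta> j) \<le> 1 * dirichlet_form N \<delta>\<close> by simp
      then have "dirichlet_form N (\<lambda>j. a * \<delta> j) / (2 * c) \<le> ?n * (1 + real ?n) / 2 / (2 * c)"
        using c_pos by (intro divide_right_mono) auto
      then have "dirichlet_form N (\<lambda>j. a * \<delta> j) / (2 * c) \<le> ?n * (1 + real ?n) / (4 * c)" by simp
      then show ?thesis unfolding pin_factor_def by (simp only: exp_le_cancel_iff neg_le_iff_le minus_divide_left[symmetric])
    qed
    then have "?p * confined_mass N l V \<le> ennreal (exp (- dirichlet_form N (\<lambda>j. a * \<delta> j) / (2 * c))) * confined_mass N l V"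
      by (intro mult_right_mono ennreal_leI) auto
    also have "\<dots> \<le> box_integral V (\<lambda>X. weight N (\<lambda>j. X j + a * \<delta> j) * indicator (confined N l) X)"
      unfolding confined_mass_def by (rule shifted_weight_ge) (use V in \<open>auto simp: confined_def\<close>)
    also have "\<dots> \<le> box_integral V (\<lambda>X. ?f (X(i := a)))"
    proof (rule box_integral_mono)
      fix X assume "X \<in> supported V"
      then have "(\<lambda>j. X j + a * \<delta> j) = X(i := a)"
        using V by (auto simp: supported_def \<delta>_def)
      then show "weight N (\<lambda>j. X j + a * \<delta> j) * indicator (confined N l) X \<le> ?f (X(i := a))"
        using a l by (auto simp: indicator_def confined_def)
    qed
    finally show ?thesis .
  qed
  have "?p * confined_mass N l V = (\<integral>\<^sup>+ a. ?p * confined_mass N l V * indicator {0..1::real} a \<partial>lborel)"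
    by (subst nn_integral_cmult_indicator) auto
  also have "\<dots> \<le> (\<integral>\<^sup>+ a. box_integral V (\<lambda>X. ?f (X(i := a))) \<partial>lborel)"
    using slice by (intro nn_integral_mono) (auto simp: indicator_def)
  also have "\<dots> = confined_mass N l (insert i V)"
    unfolding confined_mass_def by (rule box_integral_insert[symmetric]) (use V in auto)
  finally show ?thesis .
qed

lemma confined_mass_pin:
  fixes V G :: "(int ^ 'd::finite) set"
  assumes "finite V" "l \<ge> 1"
  shows "finite G \<Longrightarrow> G \<inter> V = {} \<Longrightarrow>
    ennreal (pin_factor TYPE('d)) ^ card G * confined_mass N l V \<le> confined_mass N l (V \<union> G)"
proof (induction G rule: finite_induct)
  case (insert i G)
  let ?p = "ennreal (pin_factor TYPE('d))"
  have "?p ^ card (insert i G) * confined_mass N l V = ?p * (?p ^ card G * confined_mass N l V)"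
    using insert by (simp add: mult.assoc)
  also have "\<dots> \<le> ?p * confined_mass N l (V \<union> G)"
    using insert by (intro mult_left_mono) auto
  also have "\<dots> \<le> confined_mass N l (insert i (V \<union> G))"
    using insert assms by (intro confined_mass_pin_site) auto
  finally show ?case by simp
qed simp

lemma confined_mass_le_free_mass: "confined_mass N l V \<le> free_mass N V"
  unfolding confined_mass_def free_mass_def by (rule box_integral_mono) (auto simp: indicator_def)

section \<open>Confinement in a cell\<close>

text \<open>Prekopa-Leindler is applied to the restrictions of the weight to \<open>X i > l\<close> and to \<open>X i < - l\<close>, which
  have equal mass. The difference of two such configurations exceeds \<open>2 l\<close> at \<open>i\<close>, so its Dirichlet form
  is at least \<open>4 l\<^sup>2 / K\<close>, and strong convexity yields the exponent. The best constant \<open>K\<close> is the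
  Green function of \<open>V\<close> at \<open>i\<close>.\<close>

lemma tail_mass:
  assumes V: "finite V" and K: "K > 0" and l: "l \<ge> 0"
    and green: "\<And>X. X \<in> supported V \<Longrightarrow> (X i)\<^sup>2 \<le> K * dirichlet_form N X"
  shows "box_integral V (\<lambda>X. weight N X * indicator {x. \<bar>x\<bar> > l} (X i))
    \<le> ennreal (2 * exp (- c * l\<^sup>2 / (2 * K))) * free_mass N V"
proof -
  let ?q = "ennreal (exp (- c * l\<^sup>2 / (2 * K)))"
  let ?F = "\<lambda>X. weight N X * indicator {l<..} (X i)" and ?G = "\<lambda>X. weight N X * indicator {..<-l} (X i)"
  have "box_integral V ?G = box_integral V (\<lambda>X. ?G (\<lambda>k. -1 * X k + 0))"
    by (rule box_integral_affine[symmetric]) (use V in \<open>auto simp: supported_def\<close>)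
  also have "\<dots> = box_integral V ?F"
    by (simp add: weight_minus indicator_def)
  finally have GF: "box_integral V ?G = box_integral V ?F" .
  have "box_integral V ?F * box_integral V ?G \<le> (box_integral V (\<lambda>X. ?q * weight N X))\<^sup>2"
  proof (rule prekopa_leindler_midpoint[OF V])
    fix X Y assume XY: "X \<in> supported V" "Y \<in> supported V"
    show "?F X * ?G Y \<le> (?q * weight N (\<lambda>k. (X k + Y k) / 2))\<^sup>2"
    proof (cases "X i > l \<and> Y i < - l")
      case True
      have "(2 * l)\<^sup>2 \<le> (X i - Y i)\<^sup>2"
        using True l by (intro power_mono) auto
      also have "\<dots> \<le> K * dirichlet_form N (\<lambda>k. X k - Y k)"
        using green[of "\<lambda>k. X k - Y k"] XY by (simp add: supported_def)
      finally have "c * (4 * l\<^sup>2) \<le> c * (K * dirichlet_form N (\<lambda>k. X k - Y k))"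
        using c_pos by (intro mult_left_mono) (auto simp: power_mult_distrib)
      then have "exp (- c / 8 * dirichlet_form N (\<lambda>k. X k - Y k)) \<le> exp (- c * l\<^sup>2 / (2 * K))"
        using K by (simp add: field_simps)
      then have "weight N X * weight N Y \<le> (?q * weight N (\<lambda>k. (X k + Y k) / 2))\<^sup>2"
        by (intro order_trans[OF weight_midpoint] power_mono mult_mono) (auto intro: ennreal_leI)
      then show ?thesis using True by simp
    qed auto
  qed measurable
  also have "box_integral V (\<lambda>X. ?q * weight N X) = ?q * free_mass N V"
    unfolding free_mass_def by (rule box_integral_cmult) measurable
  finally have "(box_integral V ?F)\<^sup>2 \<le> (?q * free_mass N V)\<^sup>2"
    by (simp only: GF power2_eq_square)
  then have F: "box_integral V ?F \<le> ?q * free_mass N V" by (rule ennreal_le_if_square_le)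
  have "box_integral V (\<lambda>X. weight N X * indicator {x. \<bar>x\<bar> > l} (X i)) \<le> box_integral V (\<lambda>X. ?F X + ?G X)"
    by (rule box_integral_mono) (auto simp: indicator_def)
  also have "\<dots> = box_integral V ?F + box_integral V ?F"
    unfolding GF[symmetric] by (subst box_integral_add) (auto simp: GF)
  also have "\<dots> \<le> ?q * free_mass N V + ?q * free_mass N V"
    by (intro add_mono F)
  also have "\<dots> = ennreal (2 * exp (- c * l\<^sup>2 / (2 * K))) * free_mass N V"
    by (simp add: ennreal_mult mult_2[symmetric] mult.assoc)
  finally show ?thesis .
qed

text \<open>All sites of \<open>V\<close> are pinned, in order of decreasing coordinate sum.\<close>

lemma free_mass_finite:
  fixes V :: "(int ^ 'd::finite) set"
  assumes "V \<subseteq> lattice_box N"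
  shows "free_mass N V < top"
proof -
  have "finite V" using assms finite_lattice_box by (rule finite_subset)
  have "free_mass N ({} \<union> V) \<le> pinning_cost ^ card V * free_mass N ({} :: (int ^ 'd) set)"
  proof (rule free_mass_pin[where height = "\<lambda>i. \<Sum>k\<in>UNIV. i $ k"])
    fix i :: "int ^ 'd"
    \<comment> \<open>A step in any direction increases the coordinate sum; \<open>undefined\<close> stands for an arbitrary one.\<close>
    show "\<exists>j. nearest_neighbours i j \<and> (\<Sum>k\<in>UNIV. j $ k) > (\<Sum>k\<in>UNIV. i $ k) \<and> j \<notin> {}"
      using nearest_neighbours_add_axis[of i undefined]
      by (intro exI[of _ "i + axis undefined 1"]) (simp add: sum_coordinates_add_axis del: vector_add_component)
  qed (use assms \<open>finite V\<close> in auto)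
  also have "\<dots> < top"
    using pinning_cost_finite
    by (simp add: ennreal_mult_less_top free_mass_def box_integral_empty weight_def power_less_top_ennreal)
  finally show ?thesis by simp
qed

text \<open>A union bound over the sites of \<open>V\<close>, which is affordable as long as \<open>V\<close> has fewer than
  \<open>exp (c l\<^sup>2 / (2 K))\<close> sites, up to a constant. The estimate is written as an exponential of \<open>card V\<close> so that
  it can be multiplied over cells without counting them.\<close>

lemma confined_mass_cell:
  fixes V :: "(int ^ 'd::finite) set"
  assumes V: "V \<subseteq> lattice_box N" and K: "K > 0" and l: "l \<ge> 0"
    and green: "\<And>X i. X \<in> supported V \<Longrightarrow> (X i)\<^sup>2 \<le> K * dirichlet_form N X"
    and small: "4 * exp (- c * l\<^sup>2 / (2 * K)) * card V \<le> 1"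
  shows "ennreal (exp (- 4 * exp (- c * l\<^sup>2 / (2 * K)) * card V)) * free_mass N V \<le> confined_mass N l V"
proof -
  have fin: "finite V" using V finite_lattice_box by (rule finite_subset)
  define \<epsilon> where "\<epsilon> = 2 * exp (- c * l\<^sup>2 / (2 * K))"
  have \<epsilon>: "0 \<le> \<epsilon>" "2 * \<epsilon> * card V \<le> 1" using small by (auto simp: \<epsilon>_def)
  obtain z where z: "free_mass N V = ennreal z" "z \<ge> 0"
    using free_mass_finite[OF V] by (cases "free_mass N V") auto
  have "confined_mass N l V \<le> free_mass N V" by (rule confined_mass_le_free_mass)
  then obtain a where a: "confined_mass N l V = ennreal a" "a \<ge> 0"
    using z by (cases "confined_mass N l V") (auto simp: top_unique)
  have "free_mass N V \<le> box_integral V (\<lambda>X. weight N X * indicator (confined N l) X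
      + (\<Sum>i\<in>V. weight N X * indicator {x. \<bar>x\<bar> > l} (X i)))"
    unfolding free_mass_def
  proof (rule box_integral_mono)
    fix X :: "int ^ 'd \<Rightarrow> real" assume X: "X \<in> supported V"
    show "weight N X \<le> weight N X * indicator (confined N l) X
      + (\<Sum>i\<in>V. weight N X * indicator {x. \<bar>x\<bar> > l} (X i))"
    proof (cases "X \<in> confined N l")
      case False
      then obtain i where i: "\<bar>X i\<bar> > l" by (auto simp: confined_def not_le)
      then have "i \<in> V" using X l by (auto simp: supported_def)
      then have "weight N X * indicator {x. \<bar>x\<bar> > l} (X i) \<le> (\<Sum>i\<in>V. weight N X * indicator {x. \<bar>x\<bar> > l} (X i))"
        using fin by (intro member_le_sum) auto
      then show ?thesis using False i by simp
    qed simp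
  qed
  also have "\<dots> = confined_mass N l V + (\<Sum>i\<in>V. box_integral V (\<lambda>X. weight N X * indicator {x. \<bar>x\<bar> > l} (X i)))"
    unfolding confined_mass_def by (subst box_integral_add) (auto simp: box_integral_sum)
  also have "\<dots> \<le> confined_mass N l V + (\<Sum>i\<in>V. ennreal \<epsilon> * free_mass N V)"
    unfolding \<epsilon>_def using fin K l green by (intro add_mono sum_mono tail_mass) auto
  also have "\<dots> = ennreal (a + card V * (\<epsilon> * z))"
    using a z \<epsilon> by (simp add: ennreal_of_nat_eq_real_of_nat ennreal_mult[symmetric] ennreal_plus[symmetric] del: ennreal_plus)
  finally have "z \<le> a + card V * (\<epsilon> * z)"
    using z a \<epsilon> by (subst (asm) z, subst (asm) ennreal_le_iff) auto
  then have az: "(1 - card V * \<epsilon>) * z \<le> a" by (simp add: algebra_simps)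
  have "exp (- (2 * (card V * \<epsilon>))) \<le> 1 - card V * \<epsilon>"
  proof -
    let ?x = "card V * \<epsilon>"
    have x: "0 \<le> ?x" "?x \<le> 1 / 2" using \<epsilon> by (auto simp: ac_simps)
    have "1 \<le> (1 - ?x) * (1 + 2 * ?x)" using mult_left_mono[of ?x "1/2" ?x] x by (simp add: algebra_simps)
    also have "\<dots> \<le> (1 - ?x) * exp (2 * ?x)" using x by (intro mult_left_mono exp_ge_add_one_self) auto
    finally show ?thesis by (simp add: exp_minus field_simps)
  qed
  then have "exp (- (2 * (card V * \<epsilon>))) * z \<le> a"
    using az z(2) by (meson mult_right_mono order_trans)
  then show ?thesis
    using z a by (simp add: \<epsilon>_def ac_simps ennreal_leI flip: ennreal_mult)
qed

text \<open>The energy is additive only up to the energy of the zero configuration, whence \<open>weight N (\<lambda>_. 0)\<close>.\<close>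

lemma weight_add_if_separated:
  fixes V B :: "(int ^ 'd::finite) set"
  assumes disj: "V \<inter> B = {}" and sep: "\<And>i j. i \<in> V \<Longrightarrow> j \<in> B \<Longrightarrow> \<not> nearest_neighbours i j"
    and X: "X \<in> supported V" and Y: "Y \<in> supported B"
  shows "weight N (\<lambda>_ :: int ^ 'd. 0) * weight N (\<lambda>i. X i + Y i) = weight N X * weight N Y"
proof -
  have "U (X i + Y i - (X j + Y j)) + U (0 - 0) = U (X i - X j) + U (Y i - Y j)"
    if "(i, j) \<in> oriented_edges N" for i j
  proof -
    have "nearest_neighbours i j" "nearest_neighbours j i"
      using that by (auto simp: oriented_edges_def nearest_neighbours_sym)
    then have "i \<notin> V \<or> j \<notin> B" "j \<notin> V \<or> i \<notin> B" "i \<notin> V \<or> i \<notin> B" "j \<notin> V \<or> j \<notin> B"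
      using sep disj by auto
    then have "(X i = 0 \<and> X j = 0) \<or> (Y i = 0 \<and> Y j = 0)"
      using X Y by (auto simp: supported_def)
    then show ?thesis by auto
  qed
  then have "(\<Sum>(i, j)\<in>oriented_edges N. U (X i + Y i - (X j + Y j)) + U (0 - 0)) =
      (\<Sum>(i, j)\<in>oriented_edges N. U (X i - X j) + U (Y i - Y j))"
    by (intro sum.cong) auto
  then have "energy U N (\<lambda>i. X i + Y i) + energy U N (\<lambda>_ :: int ^ 'd. 0) = energy U N X + energy U N Y"
    unfolding energy_def by (simp only: case_prod_unfold sum.distrib flip: add_divide_distrib)
  then have "exp (- energy U N (\<lambda>_ :: int ^ 'd. 0)) * exp (- energy U N (\<lambda>i. X i + Y i)) = exp (- energy U N X) * exp (- energy U N Y)"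
    by (simp flip: exp_add)
  then show ?thesis by (simp add: weight_def flip: ennreal_mult)
qed

lemma mass_union:
  fixes V B :: "(int ^ 'd::finite) set"
  assumes fin: "finite V" "finite B" and l: "l \<ge> 0"
    and disj: "V \<inter> B = {}" and sep: "\<And>i j. i \<in> V \<Longrightarrow> j \<in> B \<Longrightarrow> \<not> nearest_neighbours i j"
  shows free_mass_union: "weight N (\<lambda>_ :: int ^ 'd. 0) * free_mass N (V \<union> B) = free_mass N V * free_mass N B"
    and confined_mass_union: "weight N (\<lambda>_ :: int ^ 'd. 0) * confined_mass N l (V \<union> B) = confined_mass N l V * confined_mass N l B"
proof -
  have "box_integral (V \<union> B) (\<lambda>X. weight N (\<lambda>_ :: int ^ 'd. 0) * weight N X) = free_mass N V * free_mass N B"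
    unfolding free_mass_def
    by (rule box_integral_product) (use fin disj weight_add_if_separated[OF disj sep] in auto)
  then show "weight N (\<lambda>_ :: int ^ 'd. 0) * free_mass N (V \<union> B) = free_mass N V * free_mass N B"
    by (simp add: box_integral_cmult free_mass_def)
  have "box_integral (V \<union> B) (\<lambda>X. weight N (\<lambda>_ :: int ^ 'd. 0) * (weight N X * indicator (confined N l) X))
      = confined_mass N l V * confined_mass N l B"
    unfolding confined_mass_def
  proof (rule box_integral_product)
    fix X Y assume XY: "X \<in> supported V" "Y \<in> supported B"
    have "indicator (confined N l) (\<lambda>i. X i + Y i) = (indicator (confined N l) X * indicator (confined N l) Y :: ennreal)"
    proof -
      have "X i = 0 \<or> Y i = 0" for i using XY disj by (auto simp: supported_def)
      then have "\<bar>X i + Y i\<bar> \<le> l \<longleftrightarrow> \<bar>X i\<bar> \<le> l \<and> \<bar>Y i\<bar> \<le> l" for i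
        using l by (metis abs_zero add.left_neutral add.right_neutral)
      then show ?thesis by (auto simp: confined_def indicator_def)
    qed
    then show "weight N (\<lambda>_ :: int ^ 'd. 0) * (weight N (\<lambda>i. X i + Y i) * indicator (confined N l) (\<lambda>i. X i + Y i)) =
       weight N X * indicator (confined N l) X * (weight N Y * indicator (confined N l) Y)"
      using weight_add_if_separated[OF disj sep XY] by (simp add: mult.assoc[symmetric]) (simp add: ac_simps)
  qed (use fin disj in auto)
  then show "weight N (\<lambda>_ :: int ^ 'd. 0) * confined_mass N l (V \<union> B) = confined_mass N l V * confined_mass N l B"
    by (simp add: box_integral_cmult confined_mass_def)
qed

text \<open>Without edges between different cells the masses factorise, hence so do the lower bounds.\<close>

lemma confined_mass_of_cells:
  fixes \<kappa> :: "int ^ 'd::finite \<Rightarrow> 'k" and \<epsilon> :: real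
  assumes V: "finite V" and l: "l \<ge> 0"
    and sep: "\<And>i j. i \<in> V \<Longrightarrow> j \<in> V \<Longrightarrow> nearest_neighbours i j \<Longrightarrow> \<kappa> i = \<kappa> j"
    and cell: "\<And>t. ennreal (exp (- \<epsilon> * card {i \<in> V. \<kappa> i = t})) * free_mass N {i \<in> V. \<kappa> i = t}
      \<le> confined_mass N l {i \<in> V. \<kappa> i = t}"
  shows "ennreal (exp (- \<epsilon> * card V)) * free_mass N V \<le> confined_mass N l V"
proof -
  have "ennreal (exp (- \<epsilon> * card {i \<in> V. \<kappa> i \<in> T})) * free_mass N {i \<in> V. \<kappa> i \<in> T} 
      \<le> confined_mass N l {i \<in> V. \<kappa> i \<in> T}" if "finite T" for T
    using that
  proof (induction T rule: finite_induct)
    case empty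
    then show ?case using l by (simp add: free_mass_def confined_mass_def box_integral_empty confined_def)
  next
    case (insert t T)
    let ?A = "{i \<in> V. \<kappa> i \<in> T}" and ?B = "{i \<in> V. \<kappa> i = t}"
    let ?w = "weight N (\<lambda>_ :: int ^ 'd. 0)"
    have AB: "{i \<in> V. \<kappa> i \<in> insert t T} = ?A \<union> ?B" by auto
    have disj: "?A \<inter> ?B = {}" using insert by auto
    have s: "\<not> nearest_neighbours i j" if "i \<in> ?A" "j \<in> ?B" for i j
      using sep[of i j] that insert by auto
    have card: "card (?A \<union> ?B) = card ?A + card ?B"
      using V disj by (intro card_Un_disjoint) auto
    have ex: "ennreal (exp (- \<epsilon> * card (?A \<union> ?B))) = ennreal (exp (- \<epsilon> * card ?A)) * ennreal (exp (- \<epsilon> * card ?B))"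
      unfolding card by (simp add: algebra_simps flip: ennreal_mult exp_add)
    \<comment> \<open>Multiplying by \<open>?w\<close> accounts for the energy of the zero configuration, which both factors contain.\<close>
    have "?w * (ennreal (exp (- \<epsilon> * card (?A \<union> ?B))) * free_mass N (?A \<union> ?B)) =
       ennreal (exp (- \<epsilon> * card (?A \<union> ?B))) * (?w * free_mass N (?A \<union> ?B))"
      by (simp only: ac_simps)
    also have "\<dots> = (ennreal (exp (- \<epsilon> * card ?A)) * free_mass N ?A) * (ennreal (exp (- \<epsilon> * card ?B)) * free_mass N ?B)"
      unfolding ex using V by (subst free_mass_union[OF _ _ l disj s]) (auto simp: ac_simps)
    also have "\<dots> \<le> confined_mass N l ?A * confined_mass N l ?B"
      by (intro mult_mono insert cell) auto
    also have "\<dots> = ?w * confined_mass N l (?A \<union> ?B)"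
      using V by (subst confined_mass_union[OF _ _ l disj s]) auto
    finally have "?w * (ennreal (exp (- \<epsilon> * card (?A \<union> ?B))) * free_mass N (?A \<union> ?B)) \<le> ?w * confined_mass N l (?A \<union> ?B)" .
    then show ?case
      unfolding AB by (subst (asm) ennreal_mult_le_mult_iff) (auto simp: weight_def)
  qed
  from this[of "\<kappa> ` V"] have "ennreal (exp (- \<epsilon> * card {i \<in> V. \<kappa> i \<in> \<kappa> ` V})) * free_mass N {i \<in> V. \<kappa> i \<in> \<kappa> ` V} 
      \<le> confined_mass N l {i \<in> V. \<kappa> i \<in> \<kappa> ` V}" using V by auto
  moreover have "{i \<in> V. \<kappa> i \<in> \<kappa> ` V} = V" by auto
  ultimately show ?thesis by simp
qed

section \<open>Confinement probability as a ratio of masses\<close>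

lemma confinement_probability_eq:
  "confinement_probability U N l TYPE('d::finite) =
    enn2real (confined_mass N l (lattice_box N :: (int ^ 'd) set) / free_mass N (lattice_box N :: (int ^ 'd) set))"
proof -
  let ?\<Lambda> = "lattice_box N :: (int ^ 'd) set"
  have Z: "partition_function U N TYPE('d) = free_mass N ?\<Lambda>"
    unfolding partition_function_def reference_measure_def free_mass_def box_integral_def
    by (subst nn_integral_distr) (auto simp: weight_def simp flip: weight_def)
  have [measurable]: "(confined N l :: (int ^ 'd \<Rightarrow> real) set) \<in> sets config_algebra"
  proof -
    have "(\<lambda>X :: int ^ 'd \<Rightarrow> real. indicator (confined N l) X :: ennreal) \<in> borel_measurable config_algebra"
      by measurable
    then show ?thesis by (simp add: borel_measurable_indicator_iff space_PiM)
  qed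
  have "emeasure (gibbs_measure U N) (confined N l :: (int ^ 'd \<Rightarrow> real) set) =
     (\<integral>\<^sup>+ X. weight N X / free_mass N ?\<Lambda> * indicator (confined N l :: (int ^ 'd \<Rightarrow> real) set) X \<partial>reference_measure N)"
    unfolding gibbs_measure_def Z weight_def[symmetric]
    by (rule emeasure_density) (simp_all add: reference_measure_def)
  also have "\<dots> = box_integral ?\<Lambda> (\<lambda>X. weight N X / free_mass N ?\<Lambda> * indicator (confined N l) X)"
    unfolding reference_measure_def box_integral_def by (subst nn_integral_distr) auto
  also have "\<dots> = box_integral ?\<Lambda> (\<lambda>X. inverse (free_mass N ?\<Lambda>) * (weight N X * indicator (confined N l) X))"
    by (simp add: divide_ennreal_def ac_simps)
  also have "\<dots> = confined_mass N l ?\<Lambda> / free_mass N ?\<Lambda>"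
    unfolding confined_mass_def by (subst box_integral_cmult) (auto simp: divide_ennreal_def ac_simps)
  finally show ?thesis
    by (simp add: confinement_probability_def measure_def confined_def)
qed

lemma confinement_probability_le:
  assumes "r > 0" "ennreal r * confined_mass N l (lattice_box N :: (int ^ 'd::finite) set)
    \<le> free_mass N (lattice_box N :: (int ^ 'd) set)"
  shows "confinement_probability U N l TYPE('d) \<le> 1 / r"
proof -
  let ?\<Lambda> = "lattice_box N :: (int ^ 'd) set"
  obtain z where z: "free_mass N ?\<Lambda> = ennreal z" "z \<ge> 0"
    using free_mass_finite[of ?\<Lambda> N] by (cases "free_mass N ?\<Lambda>") auto
  then obtain a where a: "confined_mass N l ?\<Lambda> = ennreal a" "a \<ge> 0"
    using confined_mass_le_free_mass[of N l ?\<Lambda>] by (cases "confined_mass N l ?\<Lambda>") (auto simp: top_unique)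
  have "r * a \<le> z" using assms z a by (simp flip: ennreal_mult)
  show ?thesis
  proof (cases "z = 0")
    case True
    then have "a = 0" using \<open>r * a \<le> z\<close> assms(1) a by (simp add: mult_le_0_iff)
    then show ?thesis using assms(1) a z by (simp add: confinement_probability_eq)
  next
    case False
    then have "confinement_probability U N l TYPE('d) = a / z"
      using a z by (simp add: confinement_probability_eq divide_ennreal)
    moreover have "a \<le> z / r" using \<open>r * a \<le> z\<close> assms(1) by (simp add: pos_le_divide_eq mult.commute)
    then have "a / z \<le> z / r / z" using z by (intro divide_right_mono) auto
    ultimately show ?thesis using False by simp
  qed
qed

lemma confinement_probability_ge:
  assumes "r > 0" "l \<ge> 1" "ennreal r * free_mass N (lattice_box N :: (int ^ 'd::finite) set)
    \<le> confined_mass N l (lattice_box N :: (int ^ 'd) set)"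
  shows "r \<le> confinement_probability U N l TYPE('d)"
proof -
  let ?\<Lambda> = "lattice_box N :: (int ^ 'd) set"
  have "0 < ennreal (pin_factor TYPE('d)) ^ card ?\<Lambda> * confined_mass N l ({} :: (int ^ 'd) set)"
    using assms(2) by (simp add: confined_mass_def box_integral_empty weight_def confined_def pin_factor_def ennreal_zero_less_mult_iff ennreal_power)
  also have "\<dots> \<le> confined_mass N l ({} \<union> ?\<Lambda>)"
    by (rule confined_mass_pin) (use assms(2) finite_lattice_box in auto)
  also have "\<dots> \<le> free_mass N ?\<Lambda>"
    using confined_mass_le_free_mass[of N l ?\<Lambda>] by simp
  finally have pos: "free_mass N ?\<Lambda> > 0" .
  obtain z where z: "free_mass N ?\<Lambda> = ennreal z" "z \<ge> 0"
    using free_mass_finite[of ?\<Lambda> N] by (cases "free_mass N ?\<Lambda>") auto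
  then obtain a where a: "confined_mass N l ?\<Lambda> = ennreal a" "a \<ge> 0"
    using confined_mass_le_free_mass[of N l ?\<Lambda>] by (cases "confined_mass N l ?\<Lambda>") (auto simp: top_unique)
  have "z > 0" using pos z by simp
  then have "confinement_probability U N l TYPE('d) = a / z"
    using a z by (simp add: confinement_probability_eq divide_ennreal)
  moreover have "r * z \<le> a" using assms z a by (simp flip: ennreal_mult)
  ultimately show ?thesis using \<open>z > 0\<close> by (simp add: pos_le_divide_eq)
qed

end

section \<open>Boxes and spheres of the lattice\<close>

lemma card_coordinatewise:
  fixes S :: "'d::finite \<Rightarrow> int set"
  assumes "\<And>k. finite (S k)"
  shows "card {i :: int ^ 'd. \<forall>k. i $ k \<in> S k} = (\<Prod>k\<in>UNIV. card (S k))"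
proof -
  have "{i :: int ^ 'd. \<forall>k. i $ k \<in> S k} = vec_lambda ` (PiE UNIV S)"
  proof safe
    fix i :: "int ^ 'd" assume "\<forall>k. i $ k \<in> S k"
    then show "i \<in> vec_lambda ` PiE UNIV S"
      by (intro image_eqI[of _ _ "\<lambda>k. i $ k"]) auto
  qed auto
  then show ?thesis
    by (simp add: card_image vec_lambda_inject inj_on_def card_PiE)
qed

lemma card_lattice_box: "card (lattice_box N :: (int ^ 'd::finite) set) = (2 * N + 1) ^ CARD('d)"
proof -
  have "(lattice_box N :: (int ^ 'd) set) = {i. \<forall>k. i $ k \<in> {- int N..int N}}"
    by (auto simp: lattice_box_def abs_le_iff minus_le_iff)
  also have "card \<dots> = (\<Prod>k\<in>(UNIV :: 'd set). card {- int N..int N})"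
    by (rule card_coordinatewise) auto
  finally show ?thesis by (simp add: nat_add_distrib nat_mult_distrib)
qed

definition sup_norm :: "int ^ 'd::finite \<Rightarrow> nat" where
  "sup_norm i = (LEAST r. i \<in> lattice_box r)"

lemma sup_norm_le_iff: "sup_norm i \<le> r \<longleftrightarrow> i \<in> lattice_box r"
proof
  have "i \<in> lattice_box (nat (\<Sum>k\<in>UNIV. \<bar>i $ k\<bar>))"
    by (auto simp: lattice_box_def sum_nonneg intro!: member_le_sum)
  then have "i \<in> lattice_box (sup_norm i)" unfolding sup_norm_def by (rule LeastI)
  then show "sup_norm i \<le> r \<Longrightarrow> i \<in> lattice_box r"
    unfolding lattice_box_def by (auto intro: order_trans)
  show "i \<in> lattice_box r \<Longrightarrow> sup_norm i \<le> r"
    unfolding sup_norm_def by (rule Least_le)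
qed

lemma sup_norm_eq_0_iff: "sup_norm i = 0 \<longleftrightarrow> i = 0"
  using sup_norm_le_iff[of i 0] by (auto simp: lattice_box_def vec_eq_iff)

lemma abs_component_le_sup_norm: "\<bar>i $ k\<bar> \<le> int (sup_norm i)"
  using sup_norm_le_iff[of i "sup_norm i"] by (auto simp: lattice_box_def)

lemma sup_norm_triangle: "sup_norm (i + j) \<le> sup_norm i + sup_norm j"
proof -
  have "\<bar>i $ k + j $ k\<bar> \<le> int (sup_norm i) + int (sup_norm j)" for k
    using abs_component_le_sup_norm[of i k] abs_component_le_sup_norm[of j k] by linarith
  then show ?thesis by (simp add: sup_norm_le_iff lattice_box_def)
qed

lemma sup_norm_neighbour:
  assumes "nearest_neighbours i j"
  shows "sup_norm j \<le> sup_norm i + 1"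
proof -
  have "\<bar>(j - i) $ k\<bar> \<le> 1" for k
    using assms member_le_sum[of k UNIV "\<lambda>k. \<bar>i $ k - j $ k\<bar>"]
    by (auto simp: nearest_neighbours_def abs_minus_commute)
  then have "sup_norm (j - i) \<le> 1" by (simp add: sup_norm_le_iff lattice_box_def)
  then show ?thesis using sup_norm_triangle[of i "j - i"] by simp
qed

lemma nearest_neighbours_diff: "nearest_neighbours (i - t) (j - t) = nearest_neighbours i j"
  by (simp add: nearest_neighbours_def)

lemma sum_inverse_le_ln: "(\<Sum>r<n. 1 / (real r + 1)) \<le> 1 + ln (real (max n 1))"
proof (induction n)
  case (Suc n)
  show ?case
  proof (cases "n = 0")
    case False
    have "ln (real n / (real n + 1)) \<le> real n / (real n + 1) - 1"
      using False by (intro ln_le_minus_one) auto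
    then have "1 / (real n + 1) \<le> ln (real n + 1) - ln (real n)"
      using False by (simp add: ln_div field_simps)
    moreover have "real (max n 1) = real n" "real (max (Suc n) 1) = real n + 1" using False by auto
    ultimately show ?thesis using Suc by (simp add: add.commute)
  qed simp
qed simp


lemma sum_inverse_squares_le: "(\<Sum>r<n. 1 / (real r + 1)\<^sup>2) \<le> 2"
proof -
  have "(\<Sum>r<n. 1 / (real r + 1)\<^sup>2) \<le> 2 - 1 / real (max n 1)"
  proof (induction n)
    case (Suc n)
    show ?case
    proof (cases "n = 0")
      case False
      have "1 / (real n + 1)\<^sup>2 \<le> 1 / (real n * (real n + 1))"
        using False by (intro divide_left_mono) (auto simp: power2_eq_square)
      also have "\<dots> = 1 / real n - 1 / (real n + 1)" using False by (simp add: field_simps)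
      finally have "1 / (real n + 1)\<^sup>2 \<le> 1 / real n - 1 / (real n + 1)" .
      moreover have "real (max n 1) = real n" "real (max (Suc n) 1) = real n + 1" using False by auto
      ultimately show ?thesis using Suc by (simp add: add.commute)
    qed simp
  qed simp
  also have "\<dots> \<le> 2" by simp
  finally show ?thesis .
qed

lemma card_sphere:
  assumes "CARD('d::finite) = 2"
  shows "card {i :: int ^ 'd. sup_norm i = r} \<le> 8 * (r + 1)"
proof (cases r)
  case 0
  have "{i :: int ^ 'd. sup_norm i = 0} = {0}" by (auto simp: sup_norm_eq_0_iff)
  then show ?thesis using 0 by simp
next
  case (Suc m)
  have "{i :: int ^ 'd. sup_norm i = r} = lattice_box r - lattice_box m"
    using Suc by (auto simp: sup_norm_le_iff[symmetric])
  moreover have "(lattice_box m :: (int ^ 'd) set) \<subseteq> lattice_box r"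
    using Suc by (auto simp: sup_norm_le_iff[symmetric])
  ultimately have "card {i :: int ^ 'd. sup_norm i = r} = (2 * r + 1)\<^sup>2 - (2 * m + 1)\<^sup>2"
    using assms by (simp add: card_Diff_subset finite_lattice_box card_lattice_box)
  then show ?thesis using Suc by (simp add: power2_eq_square)
qed

section \<open>A logarithmic bump in two dimensions\<close>

text \<open>A truncated version of the planar potential kernel: equal to \<open>1\<close> at the centre, vanishing from radius
  \<open>R\<close> on, and with a Dirichlet form of order \<open>1 / ln R\<close>, which is the optimal order in two dimensions.\<close>

definition log_profile :: "nat \<Rightarrow> nat \<Rightarrow> real" where
  "log_profile R r = max 0 (1 - ln (1 + real r) / ln (1 + real R))"

lemma log_profile_eq_0: "R \<ge> 1 \<Longrightarrow> r \<ge> R \<Longrightarrow> log_profile R r = 0"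
  by (auto simp: log_profile_def intro!: max_absorb1)

lemma log_profile_0: "log_profile R 0 = 1"
  by (simp add: log_profile_def)

lemma log_profile_diff:
  assumes R: "R \<ge> 1" and rs: "r \<le> s + 1" "s \<le> r + 1"
  shows "\<bar>log_profile R r - log_profile R s\<bar> \<le> 2 / ((real r + 1) * ln (1 + real R))"
proof -
  let ?L = "ln (1 + real R)"
  have L: "?L > 0" using R by simp
  have step: "ln (1 + real (Suc n)) - ln (1 + real n) \<le> 1 / (real n + 1)" for n
  proof -
    have "ln ((2 + real n) / (1 + real n)) \<le> (2 + real n) / (1 + real n) - 1"
      by (intro ln_le_minus_one) auto
    also have "\<dots> = 1 / (real n + 1)" by (simp add: field_simps)
    finally show ?thesis by (simp add: ln_div add.commute)
  qed
  have ln: "\<bar>ln (1 + real r) - ln (1 + real s)\<bar> \<le> 2 / (real r + 1)"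
  proof -
    consider "s = r" | "s = Suc r" | "r = Suc s" using rs by linarith
    then show ?thesis
    proof cases
      case 2
      have "\<bar>ln (1 + real r) - ln (1 + real s)\<bar> \<le> 1 / (real r + 1)"
        using step[of r] 2 by simp
      also have "\<dots> \<le> 2 / (real r + 1)" by (simp add: divide_right_mono)
      finally show ?thesis .
    next
      case 3
      have "\<bar>ln (1 + real r) - ln (1 + real s)\<bar> \<le> 1 / (real s + 1)"
        using step[of s] 3 by simp
      also have "\<dots> \<le> 2 / (real r + 1)" using 3 by (simp add: field_simps)
      finally show ?thesis .
    qed simp
  qed
  have "\<bar>log_profile R r - log_profile R s\<bar> \<le> \<bar>ln (1 + real r) / ?L - ln (1 + real s) / ?L\<bar>"
    unfolding log_profile_def by linarith
  also have "\<dots> = \<bar>ln (1 + real r) - ln (1 + real s)\<bar> / ?L"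
    using L by (simp flip: diff_divide_distrib)
  also have "\<dots> \<le> 2 / (real r + 1) / ?L"
    using L ln by (intro divide_right_mono) auto
  finally show ?thesis by simp
qed

text \<open>The gradient at radius \<open>r\<close> is of order \<open>1 / (r ln R)\<close> and there are of the order of \<open>r\<close> sites at this
  radius, so the sum of the squares is a harmonic sum divided by \<open>(ln R)\<^sup>2\<close>.\<close>

lemma dirichlet_form_log_profile:
  fixes t :: "int ^ 'd::finite"
  assumes d: "CARD('d) = 2" and R: "R \<ge> 2"
  shows "dirichlet_form N (\<lambda>i. log_profile R (sup_norm (i - t))) \<le> 64 * lattice_degree TYPE('d) / ln (1 + real R)"
proof -
  let ?L = "ln (1 + real R)" and ?b = "\<lambda>r. (2 / ((real r + 1) * ln (1 + real R)))\<^sup>2"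
  have "1 < ln (3 :: real)" by (rule ln3_gt_1)
  also have "\<dots> \<le> ?L" using R by simp
  finally have L: "?L \<ge> 1" by simp
  define S where "S = (\<lambda>i. i + t) ` lattice_box R"
  have S: "i \<in> S \<longleftrightarrow> sup_norm (i - t) \<le> R" for i
    unfolding S_def sup_norm_le_iff by (auto intro: image_eqI[of _ _ "i - t"])
  have "dirichlet_form N (\<lambda>i. log_profile R (sup_norm (i - t))) \<le>
      lattice_degree TYPE('d) / 2 * (\<Sum>i\<in>S. ?b (sup_norm (i - t)))"
  proof (rule dirichlet_form_bound)
    show "finite S" by (simp add: S_def finite_lattice_box)
    fix i j :: "int ^ 'd" assume nn: "nearest_neighbours i j"
    have le: "sup_norm (i - t) \<le> sup_norm (j - t) + 1" "sup_norm (j - t) \<le> sup_norm (i - t) + 1"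
      using sup_norm_neighbour[of "j - t" "i - t"] sup_norm_neighbour[of "i - t" "j - t"] nn
      by (simp_all add: nearest_neighbours_diff nearest_neighbours_sym[of j])
    show "(log_profile R (sup_norm (i - t)) - log_profile R (sup_norm (j - t)))\<^sup>2 \<le> ?b (sup_norm (i - t))"
      using log_profile_diff[OF _ le] R L by (intro abs_le_square_iff[THEN iffD1]) auto
    show "i \<in> S" if "log_profile R (sup_norm (i - t)) \<noteq> log_profile R (sup_norm (j - t))"
    proof (rule ccontr)
      assume "i \<notin> S"
      then have "sup_norm (i - t) \<ge> R" "sup_norm (j - t) \<ge> R" using S le by auto
      then have "log_profile R (sup_norm (i - t)) = 0" "log_profile R (sup_norm (j - t)) = 0"
        using R by (auto intro!: log_profile_eq_0)
      then show False using that by simp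
    qed
  qed
  also have "(\<Sum>i\<in>S. ?b (sup_norm (i - t))) = (\<Sum>i\<in>(lattice_box R :: (int ^ 'd) set). ?b (sup_norm i))"
    unfolding S_def by (subst sum.reindex) (auto simp: inj_on_def)
  also have "\<dots> = (\<Sum>r<R + 1. \<Sum>i | i \<in> (lattice_box R :: (int ^ 'd) set) \<and> sup_norm i = r. ?b (sup_norm i))"
    by (rule sum.group[symmetric]) (auto simp: finite_lattice_box sup_norm_le_iff[symmetric])
  also have "\<dots> \<le> (\<Sum>r<R + 1. 32 / ?L\<^sup>2 * (1 / (real r + 1)))"
  proof (rule sum_mono)
    fix r assume "r \<in> {..<R + 1}"
    then have eq: "{i. i \<in> (lattice_box R :: (int ^ 'd) set) \<and> sup_norm i = r} = {i. sup_norm i = r}"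
      by (auto simp: sup_norm_le_iff[symmetric])
    have "(\<Sum>i | i \<in> (lattice_box R :: (int ^ 'd) set) \<and> sup_norm i = r. ?b (sup_norm i)) =
        real (card {i :: int ^ 'd. sup_norm i = r}) * ?b r"
      unfolding eq by simp
    also have "\<dots> \<le> (8 * (real r + 1)) * ?b r"
      using of_nat_mono[OF card_sphere[OF d, of r], where 'a = real]
      by (intro mult_right_mono) auto
    also have "\<dots> = 32 / ?L\<^sup>2 * (1 / (real r + 1))"
    proof -
      have "(8 * u) * (2 / (u * ?L))\<^sup>2 = 32 / ?L\<^sup>2 * (1 / u)" if "u > 0" for u
        using that L by (simp add: power2_eq_square field_simps)
      from this[of "real r + 1"] show ?thesis by (simp only: of_nat_0_le_iff add_nonneg_pos zero_less_one)
    qed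
    finally show "(\<Sum>i | i \<in> (lattice_box R :: (int ^ 'd) set) \<and> sup_norm i = r. ?b (sup_norm i)) \<le> 32 / ?L\<^sup>2 * (1 / (real r + 1))" .
  qed
  also have "\<dots> = 32 / ?L\<^sup>2 * (\<Sum>r<R + 1. 1 / (real r + 1))"
    by (simp only: sum_distrib_left)
  also have "\<dots> \<le> 32 / ?L\<^sup>2 * (4 * ?L)"
    using sum_inverse_le_ln[of "R + 1"] L by (intro mult_left_mono) (auto simp: add.commute)
  also have "\<dots> = 128 / ?L" using L by (simp add: power2_eq_square field_simps)
  finally have "dirichlet_form N (\<lambda>i. log_profile R (sup_norm (i - t))) \<le> lattice_degree TYPE('d) / 2 * (128 / ?L)"
    by (simp add: mult_left_mono)
  then show ?thesis by simp
qed

section \<open>Green function bounds in wedges\<close>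

lemma square_sum_le: "(\<Sum>i\<in>I. f i)\<^sup>2 \<le> real (card I) * (\<Sum>i\<in>I. (f i)\<^sup>2)" for f :: "'a \<Rightarrow> real"
  using Cauchy_Schwarz_ineq_sum[of "\<lambda>_. 1" f I] by simp

lemma square_sum_le_weighted:
  fixes \<delta> a e :: "'a \<Rightarrow> real"
  assumes "\<And>n. n \<in> I \<Longrightarrow> a n \<ge> 0" "\<And>n. n \<in> I \<Longrightarrow> e n \<ge> 0" "\<And>n. n \<in> I \<Longrightarrow> (\<delta> n)\<^sup>2 \<le> a n * e n"
  shows "(\<Sum>n\<in>I. \<delta> n)\<^sup>2 \<le> (\<Sum>n\<in>I. a n) * (\<Sum>n\<in>I. e n)"
proof -
  have "\<bar>\<Sum>n\<in>I. \<delta> n\<bar> \<le> (\<Sum>n\<in>I. \<bar>\<delta> n\<bar>)" by (rule sum_abs)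
  also have "\<dots> \<le> (\<Sum>n\<in>I. sqrt (a n) * sqrt (e n))"
  proof (rule sum_mono)
    fix n assume n: "n \<in> I"
    have "\<bar>\<delta> n\<bar> = sqrt ((\<delta> n)\<^sup>2)" by simp
    also have "\<dots> \<le> sqrt (a n * e n)" using assms(3)[OF n] by (rule real_sqrt_le_mono)
    finally show "\<bar>\<delta> n\<bar> \<le> sqrt (a n) * sqrt (e n)" by (simp add: real_sqrt_mult)
  qed
  finally have "(\<Sum>n\<in>I. \<delta> n)\<^sup>2 \<le> (\<Sum>n\<in>I. sqrt (a n) * sqrt (e n))\<^sup>2"
    by (intro abs_le_square_iff[THEN iffD1]) auto
  also have "\<dots> \<le> (\<Sum>n\<in>I. (sqrt (a n))\<^sup>2) * (\<Sum>n\<in>I. (sqrt (e n))\<^sup>2)"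
    by (rule Cauchy_Schwarz_ineq_sum)
  finally show ?thesis using assms by simp
qed

definition average :: "nat \<Rightarrow> (nat \<Rightarrow> real) \<Rightarrow> real" where
  "average n f = (\<Sum>y\<le>n. f y) / (real n + 1)"

lemma average_diff: "average n f - average n g = average n (\<lambda>y. f y - g y)"
  by (simp add: average_def sum_subtractf diff_divide_distrib)

lemma average_square_le: "(average n f)\<^sup>2 \<le> (\<Sum>y\<le>n. (f y)\<^sup>2) / (real n + 1)"
proof -
  have "(average n f)\<^sup>2 = (\<Sum>y\<le>n. f y)\<^sup>2 / (real n + 1)\<^sup>2" by (simp add: average_def power_divide)
  also have "\<dots> \<le> ((real n + 1) * (\<Sum>y\<le>n. (f y)\<^sup>2)) / (real n + 1)\<^sup>2"
    using square_sum_le[of f "{..n}"] by (intro divide_right_mono) (auto simp: add.commute)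
  also have "\<dots> = (\<Sum>y\<le>n. (f y)\<^sup>2) / (real n + 1)" by (simp add: power2_eq_square)
  finally show ?thesis .
qed

text \<open>By summation by parts the difference of the two averages is an average of increments of \<open>f\<close> with
  coefficients at most \<open>1\<close>. The factor \<open>1 / (n + 1)\<close> makes the bounds on the Green
  function logarithmic in two dimensions and uniform in three.\<close>

lemma average_step: "(average n f - average (Suc n) f)\<^sup>2 \<le> (\<Sum>y\<le>n. (f y - f (Suc y))\<^sup>2) / (real n + 1)"
proof -
  have abel: "(\<Sum>y\<le>n. (real y + 1) * (f y - f (Suc y))) = (\<Sum>y\<le>n. f y) - (real n + 1) * f (Suc n)"
    by (induction n) (auto simp: algebra_simps)
  have "average n f - average (Suc n) f = ((\<Sum>y\<le>n. f y) - (real n + 1) * f (Suc n)) / ((real n + 1) * (real n + 2))"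
    by (simp add: average_def field_simps)
  also have "\<dots> = average n (\<lambda>y. (real y + 1) / (real n + 2) * (f y - f (Suc y)))"
    unfolding abel[symmetric] average_def by (simp add: sum_divide_distrib mult.commute)
  finally have "(average n f - average (Suc n) f)\<^sup>2 \<le>
      (\<Sum>y\<le>n. ((real y + 1) / (real n + 2) * (f y - f (Suc y)))\<^sup>2) / (real n + 1)"
    using average_square_le by simp
  also have "\<dots> \<le> (\<Sum>y\<le>n. (f y - f (Suc y))\<^sup>2) / (real n + 1)"
  proof (intro divide_right_mono sum_mono)
    fix y assume "y \<in> {..n}"
    then have "((real y + 1) / (real n + 2))\<^sup>2 \<le> 1" by (intro power_le_one) (auto simp: field_simps)
    then show "((real y + 1) / (real n + 2) * (f y - f (Suc y)))\<^sup>2 \<le> (f y - f (Suc y))\<^sup>2"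
      unfolding power_mult_distrib by (rule mult_left_le_one_le[rotated 2]) auto
  qed auto
  finally show ?thesis .
qed

lemma square_sum_of_two_le: "(a + b)\<^sup>2 \<le> 2 * (a\<^sup>2 + b\<^sup>2)" for a b :: real
  using zero_le_power2[of "a - b"] by (simp add: power2_eq_square algebra_simps)

lemma square_sum_of_three_le: "(a + b + c)\<^sup>2 \<le> 3 * (a\<^sup>2 + b\<^sup>2 + c\<^sup>2)" for a b c :: real
  using zero_le_power2[of "a - b"] zero_le_power2[of "a - c"] zero_le_power2[of "b - c"]
  by (simp add: power2_eq_square algebra_simps)

text \<open>The value at the tip of the wedge \<open>{(n, y). y \<le> n}\<close> is the sum of the differences of consecutive column
  averages, and the \<open>n\<close>-th difference is controlled by the gradients next to column \<open>n\<close> with a factor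
  \<open>1 / (n + 1)\<close>. In terms of electrical networks, the estimate comes from a unit flow that
  spreads uniformly over the columns.\<close>

lemma wedge_bound_planar:
  fixes Z :: "nat \<Rightarrow> nat \<Rightarrow> real"
  assumes far: "\<And>y. y \<le> M \<Longrightarrow> Z M y = 0"
    and E1: "(\<Sum>n<M. \<Sum>y\<le>n. (Z n y - Z (Suc n) y)\<^sup>2) \<le> E"
    and E2: "(\<Sum>n<M. \<Sum>y\<le>n. (Z (Suc n) y - Z (Suc n) (Suc y))\<^sup>2) \<le> E"
  shows "(Z 0 0)\<^sup>2 \<le> 4 * (\<Sum>n<M. 1 / (real n + 1)) * E"
proof -
  define A where "A n = average n (Z n)" for n
  let ?e = "\<lambda>n. (\<Sum>y\<le>n. (Z n y - Z (Suc n) y)\<^sup>2) + (\<Sum>y\<le>n. (Z (Suc n) y - Z (Suc n) (Suc y))\<^sup>2)"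
  have step: "(A n - A (Suc n))\<^sup>2 \<le> (2 * (1 / (real n + 1))) * ?e n" for n
  proof -
    have "A n - A (Suc n) = average n (\<lambda>y. Z n y - Z (Suc n) y) + (average n (Z (Suc n)) - average (Suc n) (Z (Suc n)))"
      by (simp add: A_def average_diff[symmetric])
    then have "(A n - A (Suc n))\<^sup>2 \<le> 2 * ((average n (\<lambda>y. Z n y - Z (Suc n) y))\<^sup>2
        + (average n (Z (Suc n)) - average (Suc n) (Z (Suc n)))\<^sup>2)"
      using square_sum_of_two_le by simp
    also have "\<dots> \<le> 2 * ((\<Sum>y\<le>n. (Z n y - Z (Suc n) y)\<^sup>2) / (real n + 1)
        + (\<Sum>y\<le>n. (Z (Suc n) y - Z (Suc n) (Suc y))\<^sup>2) / (real n + 1))"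
      by (intro mult_left_mono add_mono average_square_le average_step) auto
    finally show ?thesis by (simp add: add_divide_distrib distrib_left)
  qed
  have "A M = 0" using far by (simp add: A_def average_def)
  moreover have "A 0 = Z 0 0" by (simp add: A_def average_def)
  ultimately have "Z 0 0 = (\<Sum>n<M. A n - A (Suc n))"
    by (simp add: sum_lessThan_telescope')
  then have "(Z 0 0)\<^sup>2 \<le> (\<Sum>n<M. 2 * (1 / (real n + 1))) * (\<Sum>n<M. ?e n)"
    using step by (simp only:) (rule square_sum_le_weighted, auto intro!: add_nonneg_nonneg sum_nonneg)
  also have "\<dots> \<le> (\<Sum>n<M. 2 * (1 / (real n + 1))) * (2 * E)"
    using E1 E2 by (intro mult_left_mono) (auto simp: sum.distrib intro!: sum_nonneg)
  also have "(\<Sum>n<M. 2 * (1 / (real n + 1))) = 2 * (\<Sum>n<M. 1 / (real n + 1))"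
    by (simp only: sum_distrib_left)
  finally show ?thesis by (simp add: ac_simps)
qed

text \<open>The same argument with columns of size \<open>(n + 1)\<^sup>2\<close>: the factors \<open>1 / (n + 1)\<^sup>2\<close> are summable,
  whence a bound that does not depend on \<open>M\<close>. The two transversal coordinates are spread one after
  the other.\<close>

lemma wedge_bound_spatial:
  fixes Z :: "nat \<Rightarrow> nat \<Rightarrow> nat \<Rightarrow> real"
  assumes far: "\<And>y w. Z M y w = 0"
    and E1: "(\<Sum>n<M. \<Sum>y\<le>n. \<Sum>w\<le>n. (Z n y w - Z (Suc n) y w)\<^sup>2) \<le> E"
    and E2: "(\<Sum>n<M. \<Sum>y\<le>n. \<Sum>w\<le>n. (Z (Suc n) y w - Z (Suc n) y (Suc w))\<^sup>2) \<le> E"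
    and E3: "(\<Sum>n<M. \<Sum>y\<le>n. \<Sum>w\<le>Suc n. (Z (Suc n) y w - Z (Suc n) (Suc y) w)\<^sup>2) \<le> E"
  shows "(Z 0 0 0)\<^sup>2 \<le> 18 * E"
proof -
  define A where "A n = average n (\<lambda>y. average n (Z n y))" for n
  let ?e1 = "\<lambda>n. \<Sum>y\<le>n. \<Sum>w\<le>n. (Z n y w - Z (Suc n) y w)\<^sup>2"
  let ?e2 = "\<lambda>n. \<Sum>y\<le>n. \<Sum>w\<le>n. (Z (Suc n) y w - Z (Suc n) y (Suc w))\<^sup>2"
  let ?e3 = "\<lambda>n. \<Sum>y\<le>n. \<Sum>w\<le>Suc n. (Z (Suc n) y w - Z (Suc n) (Suc y) w)\<^sup>2"
  have step: "(A n - A (Suc n))\<^sup>2 \<le> (3 * (1 / (real n + 1)\<^sup>2)) * (?e1 n + ?e2 n + ?e3 n)" for n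
  proof -
    define a where "a = average n (\<lambda>y. average n (\<lambda>w. Z n y w - Z (Suc n) y w))"
    define b where "b = average n (\<lambda>y. average n (Z (Suc n) y) - average (Suc n) (Z (Suc n) y))"
    \<comment> \<open>The step in the first transversal direction is taken last, hence the averages up to \<open>Suc n\<close>.\<close>
    define c where "c = average n (\<lambda>y. average (Suc n) (Z (Suc n) y)) - average (Suc n) (\<lambda>y. average (Suc n) (Z (Suc n) y))"
    have eq: "A n - A (Suc n) = a + b + c"
      by (simp add: A_def a_def b_def c_def average_diff[symmetric])
    have a: "a\<^sup>2 \<le> ?e1 n / (real n + 1)\<^sup>2"
    proof -
      have "a\<^sup>2 \<le> (\<Sum>y\<le>n. (average n (\<lambda>w. Z n y w - Z (Suc n) y w))\<^sup>2) / (real n + 1)"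
        unfolding a_def by (rule average_square_le)
      also have "\<dots> \<le> (\<Sum>y\<le>n. (\<Sum>w\<le>n. (Z n y w - Z (Suc n) y w)\<^sup>2) / (real n + 1)) / (real n + 1)"
        by (intro divide_right_mono sum_mono average_square_le) auto
      finally show ?thesis by (simp add: power2_eq_square flip: sum_divide_distrib)
    qed
    have b: "b\<^sup>2 \<le> ?e2 n / (real n + 1)\<^sup>2"
    proof -
      have "b\<^sup>2 \<le> (\<Sum>y\<le>n. (average n (Z (Suc n) y) - average (Suc n) (Z (Suc n) y))\<^sup>2) / (real n + 1)"
        unfolding b_def by (rule average_square_le)
      also have "\<dots> \<le> (\<Sum>y\<le>n. (\<Sum>w\<le>n. (Z (Suc n) y w - Z (Suc n) y (Suc w))\<^sup>2) / (real n + 1)) / (real n + 1)"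
        by (intro divide_right_mono sum_mono average_step) auto
      finally show ?thesis by (simp add: power2_eq_square flip: sum_divide_distrib)
    qed
    have c: "c\<^sup>2 \<le> ?e3 n / (real n + 1)\<^sup>2"
    proof -
      have "c\<^sup>2 \<le> (\<Sum>y\<le>n. (average (Suc n) (Z (Suc n) y) - average (Suc n) (Z (Suc n) (Suc y)))\<^sup>2) / (real n + 1)"
        unfolding c_def by (rule average_step)
      also have "\<dots> \<le> (\<Sum>y\<le>n. (\<Sum>w\<le>Suc n. (Z (Suc n) y w - Z (Suc n) (Suc y) w)\<^sup>2) / (real n + 1)) / (real n + 1)"
      proof (intro divide_right_mono sum_mono)
        fix y
        have "(average (Suc n) (Z (Suc n) y) - average (Suc n) (Z (Suc n) (Suc y)))\<^sup>2
           \<le> (\<Sum>w\<le>Suc n. (Z (Suc n) y w - Z (Suc n) (Suc y) w)\<^sup>2) / (real (Suc n) + 1)"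
          unfolding average_diff by (rule average_square_le)
        also have "\<dots> \<le> (\<Sum>w\<le>Suc n. (Z (Suc n) y w - Z (Suc n) (Suc y) w)\<^sup>2) / (real n + 1)"
          by (intro divide_left_mono sum_nonneg) auto
        finally show "(average (Suc n) (Z (Suc n) y) - average (Suc n) (Z (Suc n) (Suc y)))\<^sup>2
           \<le> (\<Sum>w\<le>Suc n. (Z (Suc n) y w - Z (Suc n) (Suc y) w)\<^sup>2) / (real n + 1)" .
      qed auto
      finally show ?thesis by (simp only: power2_eq_square divide_divide_eq_left flip: sum_divide_distrib)
    qed
    have "(A n - A (Suc n))\<^sup>2 \<le> 3 * (a\<^sup>2 + b\<^sup>2 + c\<^sup>2)" unfolding eq by (rule square_sum_of_three_le)
    also have "\<dots> \<le> 3 * (?e1 n / (real n + 1)\<^sup>2 + ?e2 n / (real n + 1)\<^sup>2 + ?e3 n / (real n + 1)\<^sup>2)"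
      by (intro mult_left_mono add_mono a b c) auto
    finally show ?thesis by (simp only: add_divide_distrib distrib_left times_divide_eq_left times_divide_eq_right mult_1_left mult_1_right)
  qed
  have "A M = 0" using far by (simp add: A_def average_def)
  moreover have "A 0 = Z 0 0 0" by (simp add: A_def average_def)
  ultimately have "Z 0 0 0 = (\<Sum>n<M. A n - A (Suc n))"
    by (simp add: sum_lessThan_telescope')
  then have "(Z 0 0 0)\<^sup>2 \<le> (\<Sum>n<M. 3 * (1 / (real n + 1)\<^sup>2)) * (\<Sum>n<M. ?e1 n + ?e2 n + ?e3 n)"
    using step by (simp only:) (rule square_sum_le_weighted, auto intro!: add_nonneg_nonneg sum_nonneg simp del: sum.atMost_Suc)
  also have "(\<Sum>n<M. 3 * (1 / (real n + 1)\<^sup>2)) = 3 * (\<Sum>n<M. 1 / (real n + 1)\<^sup>2)"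
    by (simp only: sum_distrib_left)
  also have "3 * (\<Sum>n<M. 1 / (real n + 1)\<^sup>2) * (\<Sum>n<M. ?e1 n + ?e2 n + ?e3 n) \<le> (3 * 2) * (3 * E)"
    using E1 E2 E3 sum_inverse_squares_le[of M]
    by (intro mult_mono) (auto simp: sum.distrib simp del: sum.atMost_Suc intro!: add_nonneg_nonneg sum_nonneg)
  finally show ?thesis by simp
qed

text \<open>Edges with both ends outside the box do not belong to \<open>oriented_edges N\<close>, but they carry no
  gradient of a configuration that vanishes there. A family of edges that are determined by their first
  ends can therefore be summed without asking which of them lie in the box.\<close>

lemma sum_edges_le_dirichlet_form:
  fixes X :: "int ^ 'd::finite \<Rightarrow> real"
  assumes X: "X \<in> supported (lattice_box N)" and P: "finite P" and inj: "inj_on f P"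
    and nn: "\<And>p. p \<in> P \<Longrightarrow> nearest_neighbours (f p) (g p)"
  shows "(\<Sum>p\<in>P. (X (f p) - X (g p))\<^sup>2) \<le> 2 * dirichlet_form N X"
proof -
  define Q where "Q = {p \<in> P. X (f p) \<noteq> X (g p)}"
  have "(\<Sum>p\<in>P. (X (f p) - X (g p))\<^sup>2) = (\<Sum>p\<in>Q. (X (f p) - X (g p))\<^sup>2)"
    by (rule sum.mono_neutral_right) (auto simp: Q_def P)
  also have "\<dots> = (\<Sum>(i, j)\<in>(\<lambda>p. (f p, g p)) ` Q. (X i - X j)\<^sup>2)"
    using inj by (subst sum.reindex) (auto simp: inj_on_def Q_def)
  also have "\<dots> \<le> (\<Sum>(i, j)\<in>oriented_edges N. (X i - X j)\<^sup>2)"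
  proof (rule sum_mono2)
    show "(\<lambda>p. (f p, g p)) ` Q \<subseteq> oriented_edges N"
      using X nn by (fastforce simp: Q_def oriented_edges_def supported_def)
  qed (auto simp: finite_oriented_edges)
  finally show ?thesis by (simp add: dirichlet_form_def)
qed

lemma supported_mono: "V \<subseteq> W \<Longrightarrow> supported V \<subseteq> supported W"
  by (auto simp: supported_def)

lemma axis_component: "(axis k (a :: int)) $ m = (if m = k then a else 0)"
  by (simp add: axis_def)

text \<open>A wedge with tip \<open>i\<close> in two coordinate directions leaves a set of width less than \<open>M\<close> after \<open>M\<close>
  steps.\<close>

lemma green_bound_planar:
  fixes V :: "(int ^ 'd::finite) set"
  assumes d: "CARD('d) \<ge> 2" and V: "V \<subseteq> lattice_box N"
    and width: "\<And>i j k. i \<in> V \<Longrightarrow> j \<in> V \<Longrightarrow> \<bar>i $ k - j $ k\<bar> < int M"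
    and X: "X \<in> supported V"
  shows "(X i)\<^sup>2 \<le> 8 * (1 + ln (real (max M 1))) * dirichlet_form N X"
proof (cases "i \<in> V")
  case False
  have "0 \<le> dirichlet_form N X" by (auto simp: dirichlet_form_def intro!: sum_nonneg)
  then show ?thesis using False X by (simp add: supported_def)
next
  case True
  have XN: "X \<in> supported (lattice_box N)" using supported_mono[OF V] X by auto
  obtain T :: "'d set" where "card T = 2" using obtain_subset_with_card_n[OF d] by metis
  then obtain k m :: 'd where km: "k \<noteq> m" by (auto simp: card_2_iff)
  define p where "p = (\<lambda>(n::nat, y::nat). i + axis k (int n) + axis m (int y))"
  have p_eq: "p (n, y) $ k = i $ k + int n" "p (n, y) $ m = i $ m + int y" for n y
    using km by (auto simp: p_def axis_component)
  have p_inj: "p a = p b \<longleftrightarrow> a = b" for a b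
  proof
    assume "p a = p b"
    then have "p (fst a, snd a) $ r = p (fst b, snd b) $ r" for r by simp
    from this[of k] this[of m] show "a = b" by (simp only: p_eq) (simp add: prod_eq_iff)
  qed simp
  have pk: "p (Suc n, y) = p (n, y) + axis k 1" and pm: "p (n, Suc y) = p (n, y) + axis m 1" for n y
    by (auto simp: p_def vec_eq_iff axis_component)
  define Z where "Z = (\<lambda>n y. X (p (n, y)))"
  have "(Z 0 0)\<^sup>2 \<le> 4 * (\<Sum>n<M. 1 / (real n + 1)) * (2 * dirichlet_form N X)"
  proof (rule wedge_bound_planar[where Z = Z and M = M])
    show "Z M y = 0" for y
    proof -
      have "\<not> \<bar>p (M, y) $ k - i $ k\<bar> < int M" by (simp add: p_eq)
      then have "p (M, y) \<notin> V" using width True by blast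
      then show ?thesis using X by (simp add: Z_def supported_def)
    qed
    have edges: "(\<Sum>(n, y)\<in>(SIGMA n:{..<M}. {..n}). (X (p (s n, y)) - X (p (s n, y) + axis r 1))\<^sup>2)
        \<le> 2 * dirichlet_form N X" if "inj s" for s r
      using XN sum_edges_le_dirichlet_form[where f = "\<lambda>(n, y). p (s n, y)"
         and g = "\<lambda>(n, y). p (s n, y) + axis r 1" and P = "SIGMA n:{..<M}. {..n}" and X = X and N = N] that
      by (auto simp: case_prod_unfold inj_on_def p_inj nearest_neighbours_add_axis)
    show "(\<Sum>n<M. \<Sum>y\<le>n. (Z n y - Z (Suc n) y)\<^sup>2) \<le> 2 * dirichlet_form N X"
      using edges[of "\<lambda>n. n" k] by (simp add: sum.Sigma Z_def pk)
    show "(\<Sum>n<M. \<Sum>y\<le>n. (Z (Suc n) y - Z (Suc n) (Suc y))\<^sup>2) \<le> 2 * dirichlet_form N X"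
      using edges[of Suc m] by (simp add: sum.Sigma Z_def pm)
  qed
  also have "\<dots> \<le> 4 * (1 + ln (real (max M 1))) * (2 * dirichlet_form N X)"
    by (intro mult_left_mono mult_right_mono sum_inverse_le_ln) (auto simp: dirichlet_form_def intro!: sum_nonneg)
  finally have "(Z 0 0)\<^sup>2 \<le> 4 * (1 + ln (real (max M 1))) * (2 * dirichlet_form N X)" .
  moreover have "p (0, 0) = i" by (simp add: p_def vec_eq_iff axis_component)
  ultimately show ?thesis by (simp add: Z_def algebra_simps)
qed

text \<open>From dimension three on, a wedge in three coordinate directions is enough, whatever the dimension.\<close>

lemma green_bound_spatial:
  fixes V :: "(int ^ 'd::finite) set"
  assumes d: "CARD('d) \<ge> 3" and V: "V \<subseteq> lattice_box N"
    and width: "\<And>i j k. i \<in> V \<Longrightarrow> j \<in> V \<Longrightarrow> \<bar>i $ k - j $ k\<bar> < int M"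
    and X: "X \<in> supported V"
  shows "(X i)\<^sup>2 \<le> 36 * dirichlet_form N X"
proof (cases "i \<in> V")
  case False
  have "0 \<le> dirichlet_form N X" by (auto simp: dirichlet_form_def intro!: sum_nonneg)
  then show ?thesis using False X by (simp add: supported_def)
next
  case True
  have XN: "X \<in> supported (lattice_box N)" using supported_mono[OF V] X by auto
  obtain T :: "'d set" where "card T = 3" using d obtain_subset_with_card_n[OF d] by metis
  then obtain k m q where "T = {k, m, q}" and kmq: "k \<noteq> m" "m \<noteq> q" "k \<noteq> q" by (auto simp: card_3_iff)
  define p where "p = (\<lambda>(n::nat, y::nat, w::nat). i + axis k (int n) + axis m (int y) + axis q (int w))"
  have p_eq: "p (n, y, w) $ k = i $ k + int n" "p (n, y, w) $ m = i $ m + int y" "p (n, y, w) $ q = i $ q + int w" for n y w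
    using kmq by (auto simp: p_def axis_component)
  have p_inj: "p a = p b \<longleftrightarrow> a = b" for a b
  proof
    assume "p a = p b"
    then have "p (fst a, fst (snd a), snd (snd a)) $ r = p (fst b, fst (snd b), snd (snd b)) $ r" for r by simp
    from this[of k] this[of m] this[of q] show "a = b" by (simp only: p_eq) (simp add: prod_eq_iff)
  qed simp
  have pk: "p (Suc n, y, w) = p (n, y, w) + axis k 1" and pm: "p (n, Suc y, w) = p (n, y, w) + axis m 1"
    and pq: "p (n, y, Suc w) = p (n, y, w) + axis q 1" for n y w
    by (auto simp: p_def vec_eq_iff axis_component)
  define Z where "Z = (\<lambda>n y w. X (p (n, y, w)))"
  have sum3: "(\<Sum>n<M. \<Sum>y\<le>n. \<Sum>w\<le>h n. F n y w) = (\<Sum>(n, y, w)\<in>(SIGMA n:{..<M}. {..n} \<times> {..h n}). F n y w)"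
    for F :: "nat \<Rightarrow> nat \<Rightarrow> nat \<Rightarrow> real" and h
  proof -
    have "(\<Sum>n<M. \<Sum>y\<le>n. \<Sum>w\<le>h n. F n y w) = (\<Sum>n<M. \<Sum>(y, w)\<in>{..n} \<times> {..h n}. F n y w)"
      by (simp add: sum.cartesian_product)
    then show ?thesis by (simp add: sum.Sigma)
  qed
  have "(Z 0 0 0)\<^sup>2 \<le> 18 * (2 * dirichlet_form N X)"
  proof (rule wedge_bound_spatial[where Z = Z and M = M])
    show "Z M y w = 0" for y w
    proof -
      have "\<not> \<bar>p (M, y, w) $ k - i $ k\<bar> < int M" by (simp add: p_eq)
      then have "p (M, y, w) \<notin> V" using width True by blast
      then show ?thesis using X by (simp add: Z_def supported_def)
    qed
    have edges: "(\<Sum>(n, y, w)\<in>(SIGMA n:{..<M}. {..n} \<times> {..h n}). (X (p (s n, y, w)) - X (p (s n, y, w) + axis r 1))\<^sup>2)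
        \<le> 2 * dirichlet_form N X" if "inj s" for h s r
      using XN sum_edges_le_dirichlet_form[where f = "\<lambda>(n, y, w). p (s n, y, w)"
         and g = "\<lambda>(n, y, w). p (s n, y, w) + axis r 1" and P = "SIGMA n:{..<M}. {..n} \<times> {..h n}" and X = X and N = N] that
      by (auto simp: case_prod_unfold inj_on_def p_inj nearest_neighbours_add_axis)
    show "(\<Sum>n<M. \<Sum>y\<le>n. \<Sum>w\<le>n. (Z n y w - Z (Suc n) y w)\<^sup>2) \<le> 2 * dirichlet_form N X"
      using edges[where s = "\<lambda>n. n" and h = "\<lambda>n. n" and r = k] by (simp add: sum3 Z_def pk)
    show "(\<Sum>n<M. \<Sum>y\<le>n. \<Sum>w\<le>n. (Z (Suc n) y w - Z (Suc n) y (Suc w))\<^sup>2) \<le> 2 * dirichlet_form N X"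
      using edges[where s = Suc and h = "\<lambda>n. n" and r = q] by (simp add: sum3 Z_def pq)
    show "(\<Sum>n<M. \<Sum>y\<le>n. \<Sum>w\<le>Suc n. (Z (Suc n) y w - Z (Suc n) (Suc y) w)\<^sup>2) \<le> 2 * dirichlet_form N X"
      using edges[where s = Suc and h = Suc and r = m] unfolding sum3 by (simp add: Z_def pm)
  qed
  moreover have "p (0, 0, 0) = i" by (simp add: p_def vec_eq_iff axis_component)
  ultimately show ?thesis by (simp add: Z_def)
qed

section \<open>The grid and its cells\<close>

definition grid :: "nat \<Rightarrow> nat \<Rightarrow> (int ^ 'd::finite) set" where
  "grid M N = {i \<in> lattice_box N. \<exists>k. int M dvd i $ k}"

definition cell_index :: "nat \<Rightarrow> int ^ 'd::finite \<Rightarrow> int ^ 'd" where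
  "cell_index M i = (\<chi> k. i $ k div int M)"

lemma card_multiples:
  assumes M: "M \<ge> 1"
  shows "card {x \<in> {- int N..int N}. int M dvd x} \<le> 2 * (N div M) + 1"
proof -
  have "{x \<in> {- int N..int N}. int M dvd x} \<subseteq> (\<lambda>y. int M * y) ` {- int (N div M)..int (N div M)}"
  proof
    fix x assume "x \<in> {x \<in> {- int N..int N}. int M dvd x}"
    then have x: "\<bar>x\<bar> \<le> int N" "int M dvd x" by auto
    from x(2) obtain y where y: "x = int M * y" by (rule dvdE)
    have "int (nat \<bar>y\<bar> * M) \<le> int N" using x(1) by (simp add: y abs_mult mult.commute)
    then have "nat \<bar>y\<bar> * M \<le> N" by (simp only: of_nat_le_iff)
    then have "nat \<bar>y\<bar> \<le> N div M" using M by (simp add: less_eq_div_iff_mult_less_eq)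
    then have "\<bar>y\<bar> \<le> int (N div M)" by linarith
    then show "x \<in> (\<lambda>y. int M * y) ` {- int (N div M)..int (N div M)}"
      unfolding y by (intro imageI) auto
  qed
  then have "card {x \<in> {- int N..int N}. int M dvd x} \<le> card {- int (N div M)..int (N div M)}"
    by (rule surj_card_le[rotated]) simp
  also have "\<dots> = 2 * (N div M) + 1" by simp
  finally show ?thesis .
qed

lemma card_grid:
  assumes M: "M \<ge> 1" "M \<le> N"
  shows "M * card (grid M N :: (int ^ 'd::finite) set) \<le> 2 * CARD('d) * card (lattice_box N :: (int ^ 'd) set)"
proof -
  define S where "S k m = (if m = k then {x \<in> {- int N..int N}. int M dvd x} else {- int N..int N})" for k m :: 'd
  have fin: "finite {i :: int ^ 'd. \<forall>m. i $ m \<in> S k m}" for k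
    by (rule finite_subset[OF _ finite_lattice_box[of N]])
      (auto simp: S_def lattice_box_def abs_le_iff minus_le_iff split: if_splits)
  have "(grid M N :: (int ^ 'd) set) \<subseteq> (\<Union>k. {i. \<forall>m. i $ m \<in> S k m})"
    by (auto simp: grid_def S_def lattice_box_def abs_le_iff minus_le_iff)
  then have "card (grid M N :: (int ^ 'd) set) \<le> card (\<Union>k. {i :: int ^ 'd. \<forall>m. i $ m \<in> S k m})"
    using fin by (intro card_mono) auto
  also have "\<dots> \<le> (\<Sum>k\<in>UNIV. card {i :: int ^ 'd. \<forall>m. i $ m \<in> S k m})"
    by (rule card_UN_le) simp
  finally have "M * card (grid M N :: (int ^ 'd) set) \<le> (\<Sum>k\<in>UNIV. M * card {i :: int ^ 'd. \<forall>m. i $ m \<in> S k m})"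
    by (simp flip: sum_distrib_left)
  also have "\<dots> \<le> (\<Sum>k\<in>(UNIV :: 'd set). 2 * card (lattice_box N :: (int ^ 'd) set))"
  proof (rule sum_mono)
    fix k :: 'd
    have "card {i :: int ^ 'd. \<forall>m. i $ m \<in> S k m} = (\<Prod>m\<in>UNIV. card (S k m))"
    proof (rule card_coordinatewise)
      show "finite (S k m)" for m
        by (rule finite_subset[of _ "{- int N..int N}"]) (auto simp: S_def)
    qed
    also have "\<dots> = card (S k k) * (\<Prod>m\<in>UNIV - {k}. card (S k m))"
      by (rule prod.remove) auto
    also have "(\<Prod>m\<in>UNIV - {k}. card (S k m)) = (\<Prod>m\<in>UNIV - {k}. 2 * N + 1)"
      by (rule prod.cong) (auto simp: S_def nat_add_distrib nat_mult_distrib)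
    finally have eq: "card {i :: int ^ 'd. \<forall>m. i $ m \<in> S k m} = card (S k k) * (2 * N + 1) ^ (CARD('d) - 1)"
      by (simp add: card_Diff_singleton)
    have "M * (2 * (N div M) + 1) \<le> 2 * N + M"
      by (simp add: distrib_left mult.left_commute)
    also have "\<dots> \<le> 2 * (2 * N + 1)" using M by simp
    finally have "M * card (S k k) \<le> 2 * (2 * N + 1)"
      using mult_le_mono2[OF card_multiples[OF M(1), of N], of M] by (simp add: S_def)
    then have "M * card {i :: int ^ 'd. \<forall>m. i $ m \<in> S k m} \<le> 2 * (2 * N + 1) * (2 * N + 1) ^ (CARD('d) - 1)"
      unfolding eq mult.assoc[symmetric] by (rule mult_le_mono1)
    also have "\<dots> = 2 * (2 * N + 1) ^ CARD('d)"
      by (simp only: mult.assoc power_eq_if[of _ "CARD('d)"]) simp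
    finally show "M * card {i :: int ^ 'd. \<forall>m. i $ m \<in> S k m} \<le> 2 * card (lattice_box N :: (int ^ 'd) set)"
      by (simp add: card_lattice_box)
  qed
  finally show ?thesis by (simp add: mult.assoc mult.left_commute)
qed

lemma cell_width:
  assumes M: "M \<ge> 1" and "cell_index M i = cell_index M j"
  shows "\<bar>i $ k - j $ k\<bar> < int M"
proof -
  have "i $ k div int M = j $ k div int M"
    using assms(2) by (simp add: cell_index_def vec_eq_iff)
  then have "i $ k div int M * int M = j $ k div int M * int M" by simp
  then have "i $ k - j $ k = i $ k mod int M - j $ k mod int M"
    using div_mult_mod_eq[of "i $ k" "int M"] div_mult_mod_eq[of "j $ k" "int M"] by linarith
  moreover have "0 \<le> i $ k mod int M" "i $ k mod int M < int M" "0 \<le> j $ k mod int M" "j $ k mod int M < int M"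
    using M by auto
  ultimately show ?thesis by linarith
qed

lemma card_cell:
  fixes V :: "(int ^ 'd::finite) set"
  assumes M: "M \<ge> 1"
  shows "card {i \<in> V. cell_index M i = t} \<le> M ^ CARD('d)"
proof -
  let ?S = "\<lambda>k. {t $ k * int M..<t $ k * int M + int M}"
  have card: "card {i :: int ^ 'd. \<forall>k. i $ k \<in> ?S k} = M ^ CARD('d)"
    by (subst card_coordinatewise) auto
  have sub: "{i \<in> V. cell_index M i = t} \<subseteq> {i. \<forall>k. i $ k \<in> ?S k}"
  proof (intro subsetI CollectI allI)
    fix i :: "int ^ 'd" and k assume "i \<in> {i \<in> V. cell_index M i = t}"
    then have "t $ k = i $ k div int M" by (auto simp: cell_index_def)
    moreover have "i $ k div int M * int M \<le> i $ k" "i $ k < i $ k div int M * int M + int M"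
      using div_mult_mod_eq[of "i $ k" "int M"] pos_mod_bound[of "int M" "i $ k"] pos_mod_sign[of "int M" "i $ k"] M
      by linarith+
    ultimately show "i $ k \<in> ?S k" by (simp only: atLeastLessThan_iff)
  qed
  have "finite {i :: int ^ 'd. \<forall>k. i $ k \<in> ?S k}"
    using card M by (intro card_ge_0_finite) simp
  from card_mono[OF this sub] show ?thesis using card by simp
qed

text \<open>Passing from one cell to the next requires a step onto a multiple of \<open>M\<close>.\<close>

lemma cell_index_neighbour:
  fixes i j :: "int ^ 'd::finite"
  assumes M: "M \<ge> 1" and nn: "nearest_neighbours i j"
    and i: "\<And>k. \<not> int M dvd i $ k" and j: "\<And>k. \<not> int M dvd j $ k"
  shows "cell_index M i = cell_index M j"
proof -
  have le: "y div int M \<le> x div int M" if "y \<le> x + 1" "\<not> int M dvd x" "\<not> int M dvd y" for x y :: int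
  proof (rule ccontr)
    assume "\<not> y div int M \<le> x div int M"
    then have "(x div int M + 1) * int M \<le> y div int M * int M"
      by (intro mult_right_mono) auto
    then have "x div int M * int M + int M \<le> y div int M * int M" by (simp add: distrib_right)
    moreover have "y mod int M \<ge> 1" using M that(3) by (simp add: dvd_eq_mod_eq_0 order_less_le pos_mod_sign int_one_le_iff_zero_less)
    moreover have "x mod int M < int M" using M by simp
    ultimately show False
      using that(1) div_mult_mod_eq[of x "int M"] div_mult_mod_eq[of y "int M"] by linarith
  qed
  have "i $ k div int M = j $ k div int M" for k
  proof -
    have "\<bar>i $ k - j $ k\<bar> \<le> 1"
      using nn member_le_sum[of k UNIV "\<lambda>k. \<bar>i $ k - j $ k\<bar>"] by (auto simp: nearest_neighbours_def)
    then show ?thesis using le[of "i $ k" "j $ k"] le[of "j $ k" "i $ k"] i[of k] j[of k] by linarith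
  qed
  then show ?thesis by (simp add: cell_index_def vec_eq_iff)
qed

context convex_potential
begin

section \<open>The two bounds at a fixed scale\<close>

definition pin_exponent :: "'d::finite itself \<Rightarrow> real" where
  "pin_exponent d = ln ((1 + enn2real pinning_cost) / pin_factor d)"

lemma pin_exponent_nonneg: "pin_exponent d \<ge> 0"
proof -
  have "pin_factor d > 0" "pin_factor d \<le> 1" using c_pos by (auto simp: pin_factor_def)
  then show ?thesis unfolding pin_exponent_def
    by (intro ln_ge_zero) (simp add: add_increasing2)
qed

text \<open>Pinning the grid in both masses costs a factor \<open>exp (- pin_exponent)\<close> per grid site, and the grid has at most
  \<open>2 d / M\<close> of the sites. A site of the grid can be pinned starting from the boundary: its
  coordinate that is divisible by \<open>M\<close> stays fixed while another one increases, and so the path towards the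
  boundary does not leave the grid.\<close>

lemma confinement_ge_of_green_bound:
  fixes M N :: nat
  assumes d: "CARD('d::finite) \<ge> 2" and M: "M \<ge> 1" "M \<le> N" and l: "l \<ge> 1" and K: "K > 0"
    and green: "\<And>(V :: (int ^ 'd) set) X i. V \<subseteq> lattice_box N \<Longrightarrow> (\<And>i j k. i \<in> V \<Longrightarrow> j \<in> V \<Longrightarrow> \<bar>i $ k - j $ k\<bar> < int M)
      \<Longrightarrow> X \<in> supported V \<Longrightarrow> (X i)\<^sup>2 \<le> K * dirichlet_form N X"
    and small: "4 * exp (- c * l\<^sup>2 / (2 * K)) * real M ^ CARD('d) \<le> 1"
  shows "exp (- (2 * CARD('d) * pin_exponent TYPE('d) / M + 4 * exp (- c * l\<^sup>2 / (2 * K))) * card (lattice_box N :: (int ^ 'd) set))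
      \<le> confinement_probability U N l TYPE('d)"
proof -
  define \<Lambda> where "\<Lambda> = (lattice_box N :: (int ^ 'd) set)"
  define G where "G = (grid M N :: (int ^ 'd) set)"
  define V where "V = \<Lambda> - G"
  define \<epsilon> where "\<epsilon> = 4 * exp (- c * l\<^sup>2 / (2 * K))"
  define p where "p = pin_factor TYPE('d)"
  define C where "C = 1 + enn2real pinning_cost"
  have fin: "finite \<Lambda>" "finite G" "finite V" and VG: "V \<union> G = \<Lambda>" "G \<inter> V = {}" "V \<subseteq> \<Lambda>" "G \<subseteq> \<Lambda>"
    by (auto simp: \<Lambda>_def G_def V_def grid_def finite_lattice_box)
  have p: "p > 0" and C: "C > 0" by (auto simp: p_def C_def pin_factor_def add_pos_nonneg)
  have cost: "pinning_cost \<le> ennreal C"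
    using pinning_cost_finite by (cases pinning_cost) (auto simp: C_def simp flip: ennreal_1)
  have grid_pinned: "free_mass N \<Lambda> \<le> ennreal C ^ card G * free_mass N V"
  proof -
    have "free_mass N (V \<union> G) \<le> pinning_cost ^ card G * free_mass N V"
    proof (rule free_mass_pin[where height = "\<lambda>i. \<Sum>k\<in>UNIV. i $ k"])
      fix i assume "i \<in> G"
      then obtain k where k: "int M dvd i $ k" by (auto simp: G_def grid_def)
      have "\<exists>m. m \<noteq> k"
      proof (rule ccontr)
        assume "\<nexists>m. m \<noteq> k"
        then have "(UNIV :: 'd set) = {k}" by auto
        then have "CARD('d) = card {k}" by (rule arg_cong)
        then show False using d by simp
      qed
      then obtain m where m: "m \<noteq> k" by blast
      have "(i + axis m 1) $ k = i $ k" using m by (simp add: axis_component)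
      then have "int M dvd (i + axis m 1) $ k" using k by simp
      then have "i + axis m 1 \<notin> V" by (auto simp: V_def G_def \<Lambda>_def grid_def simp del: vector_add_component)
      then show "\<exists>j. nearest_neighbours i j \<and> (\<Sum>k\<in>UNIV. j $ k) > (\<Sum>k\<in>UNIV. i $ k) \<and> j \<notin> V"
        using nearest_neighbours_add_axis[of i m] sum_coordinates_add_axis[of i m]
        by (intro exI[of _ "i + axis m 1"] conjI) (simp_all only: less_add_one simp_thms)
    qed (use fin VG in \<open>auto simp: \<Lambda>_def\<close>)
    also have "\<dots> \<le> ennreal C ^ card G * free_mass N V"
      by (intro mult_right_mono power_mono cost) auto
    finally show ?thesis using VG by simp
  qed
  have cells: "ennreal (exp (- \<epsilon> * card V)) * free_mass N V \<le> confined_mass N l V"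
  proof (rule confined_mass_of_cells[where \<kappa> = "cell_index M :: int ^ 'd \<Rightarrow> _"])
    fix i j assume "i \<in> V" "j \<in> V" "nearest_neighbours i j"
    then show "cell_index M i = cell_index M j"
      by (intro cell_index_neighbour M) (auto simp: V_def G_def \<Lambda>_def grid_def)
  next
    fix t
    let ?B = "{i \<in> V. cell_index M i = t}"
    have "real (card ?B) \<le> real M ^ CARD('d)"
      using card_cell[OF M(1), of V t] by (metis of_nat_le_iff of_nat_power)
    then have "4 * exp (- c * l\<^sup>2 / (2 * K)) * card ?B \<le> 4 * exp (- c * l\<^sup>2 / (2 * K)) * real M ^ CARD('d)"
      by (rule mult_left_mono) simp
    then have "4 * exp (- c * l\<^sup>2 / (2 * K)) * card ?B \<le> 1" using small by (rule order_trans)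
    then have "ennreal (exp (- 4 * exp (- c * l\<^sup>2 / (2 * K)) * card ?B)) * free_mass N ?B \<le> confined_mass N l ?B"
    proof (intro confined_mass_cell)
      show "?B \<subseteq> lattice_box N" using VG by (auto simp: \<Lambda>_def)
      then show "(X i)\<^sup>2 \<le> K * dirichlet_form N X" if "X \<in> supported ?B" for X i
      proof (rule green)
        fix i j k assume "i \<in> ?B" "j \<in> ?B"
        then show "\<bar>i $ k - j $ k\<bar> < int M" by (intro cell_width M) simp
      qed fact
    qed (use K l in auto)
    then show "ennreal (exp (- \<epsilon> * card ?B)) * free_mass N ?B \<le> confined_mass N l ?B"
      by (simp add: \<epsilon>_def)
  qed (use fin l in auto)
  let ?r = "(p / C) ^ card G * exp (- \<epsilon> * card V)"
  have "ennreal ?r * free_mass N \<Lambda> \<le> ennreal ?r * (ennreal C ^ card G * free_mass N V)"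
    by (intro mult_left_mono grid_pinned) auto
  also have "\<dots> = ennreal p ^ card G * (ennreal (exp (- \<epsilon> * card V)) * free_mass N V)"
  proof -
    have "ennreal ?r * ennreal C ^ card G = ennreal p ^ card G * ennreal (exp (- \<epsilon> * card V))"
      using p C by (simp add: ennreal_power power_divide flip: ennreal_mult)
    then show ?thesis by (simp only: mult.assoc[symmetric])
  qed
  also have "\<dots> \<le> ennreal p ^ card G * confined_mass N l V"
    by (intro mult_left_mono cells) auto
  also have "\<dots> \<le> confined_mass N l (V \<union> G)"
    unfolding p_def using fin VG l by (intro confined_mass_pin) auto
  finally have "?r \<le> confinement_probability U N l TYPE('d)"
    using p C l VG by (intro confinement_probability_ge) (auto simp: \<Lambda>_def)
  moreover have "exp (- (2 * CARD('d) * pin_exponent TYPE('d) / M + \<epsilon>) * card \<Lambda>) \<le> ?r"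
  proof -
    let ?b = "pin_exponent TYPE('d)"
    have "p / C = exp (- ?b)"
      using p C by (simp add: pin_exponent_def p_def[symmetric] C_def[symmetric] exp_minus)
    then have r: "?r = exp (- (card G * ?b + \<epsilon> * card V))"
      by (simp add: exp_add[symmetric] exp_of_nat_mult[symmetric])
    have "real M * card G \<le> 2 * CARD('d) * card \<Lambda>"
      using card_grid[OF M, where 'd='d] unfolding G_def \<Lambda>_def by (metis of_nat_le_iff of_nat_mult of_nat_numeral)
    then have "card G \<le> 2 * CARD('d) * card \<Lambda> / M" using M by (simp add: pos_le_divide_eq mult.commute)
    then have "card G * ?b \<le> 2 * CARD('d) * card \<Lambda> / M * ?b"
      by (intro mult_right_mono pin_exponent_nonneg)
    moreover have "\<epsilon> * card V \<le> \<epsilon> * card \<Lambda>"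
      using fin VG by (intro mult_left_mono) (auto simp: \<epsilon>_def intro: card_mono)
    ultimately have "card G * ?b + \<epsilon> * card V \<le> (2 * CARD('d) * ?b / M + \<epsilon>) * card \<Lambda>"
    proof -
      have "(2 * CARD('d) * ?b / M + \<epsilon>) * card \<Lambda> = 2 * CARD('d) * card \<Lambda> / M * ?b + \<epsilon> * card \<Lambda>"
        by (simp add: distrib_right)
      then show ?thesis
        using \<open>card G * ?b \<le> 2 * CARD('d) * card \<Lambda> / M * ?b\<close> \<open>\<epsilon> * card V \<le> \<epsilon> * card \<Lambda>\<close> by linarith
    qed
    then show ?thesis unfolding r by (simp only: exp_le_cancel_iff mult_minus_left neg_le_iff_le)
  qed
  ultimately show ?thesis by (simp add: \<Lambda>_def \<epsilon>_def)
qed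

text \<open>The bumps are centred at the multiples of \<open>R\<close>, where all other bumps vanish. There are of the order of
  \<open>card (lattice_box N) / R ^ d\<close> of them with support in the box.\<close>

lemma confinement_le_of_profile:
  fixes g :: "nat \<Rightarrow> real"
  assumes R: "R \<ge> 1" "R \<le> N" and l: "l > 0" and D: "D \<ge> 0"
    and g: "g 0 = 1" "\<And>r. r \<ge> R \<Longrightarrow> g r = 0"
    and dir: "\<And>t :: int ^ 'd::finite. dirichlet_form N (\<lambda>i. g (sup_norm (i - t))) \<le> D"
  shows "confinement_probability U N l TYPE('d) \<le>
    exp (- (exp (- (9 * l\<^sup>2 * D) / (2 * c)) * card (lattice_box N :: (int ^ 'd) set) / (4 * real R) ^ CARD('d)))"
proof -
  \<comment> \<open>The largest \<open>q\<close> for which bumps of radius \<open>R\<close> centred in \<open>R\<close> times \<open>lattice_box q\<close> fit into the box.\<close>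
  define q where "q = (N + 1) div R - 1"
  have q: "R * (q + 1) \<le> N + 1" "N + 1 < R * (q + 2)"
  proof -
    have "(N + 1) div R \<ge> 1" using R by (simp add: div_greater_zero_iff Suc_le_eq)
    then have "q + 1 = (N + 1) div R" by (simp add: q_def)
    then show "R * (q + 1) \<le> N + 1" "N + 1 < R * (q + 2)"
      using R dividend_less_times_div[of R "N + 1"] by (auto simp: div_times_less_eq_dividend mult.commute)
  qed
  define T where "T = (\<lambda>m :: int ^ 'd. (\<chi> k. int R * m $ k)) ` lattice_box q"
  have inj: "inj_on (\<lambda>m :: int ^ 'd. (\<chi> k. int R * m $ k)) (lattice_box q)"
    using R by (auto simp: inj_on_def vec_eq_iff)
  have cardT: "card T = (2 * q + 1) ^ CARD('d)"
    unfolding T_def by (simp add: card_image[OF inj] card_lattice_box)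
  have T_box: "sup_norm t \<le> R * q" if "t \<in> T" for t
    using that unfolding T_def sup_norm_le_iff by (auto simp: lattice_box_def abs_mult intro!: mult_left_mono)
  have box: "R * q + R \<le> N + 1" using q(1) by (simp add: distrib_left)
  define \<phi> where "\<phi> = (\<lambda>t i :: int ^ 'd. g (sup_norm (i - t)))"
  define e where "e = exp (- (9 * l\<^sup>2 * D) / (2 * c))"
  have e: "0 < e" "e \<le> 1" using D c_pos by (auto simp: e_def)
  have "(1 + 2 * ennreal e) ^ card T * confined_mass N l (lattice_box N :: (int ^ 'd) set) \<le> free_mass N (lattice_box N :: (int ^ 'd) set)"
    unfolding e_def
  proof (rule spread_confined_mass[where \<phi> = \<phi>])
    show "finite T" by (simp add: T_def finite_lattice_box)
    show "T \<subseteq> lattice_box N"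
      using T_box box R by (fastforce simp: sup_norm_le_iff[symmetric])
    fix t assume t: "t \<in> T"
    show "\<phi> t \<in> supported (lattice_box N)"
      unfolding supported_def
    proof (safe, rule ccontr)
      fix i assume i: "i \<notin> lattice_box N" "\<phi> t i \<noteq> 0"
      then have "sup_norm (i - t) < R" using g(2)[of "sup_norm (i - t)"] unfolding \<phi>_def by force
      then show False
        using i(1) T_box[OF t] box sup_norm_triangle[of "i - t" t] by (simp add: sup_norm_le_iff[symmetric])
    qed
    show "\<phi> t t = 1" using g(1) sup_norm_eq_0_iff[of "0 :: int ^ 'd"] by (simp add: \<phi>_def)
    show "dirichlet_form N (\<phi> t) \<le> D" using dir by (simp add: \<phi>_def)
    fix s assume s: "s \<in> T" "s \<noteq> t"
    show "\<phi> s t = 0"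
      unfolding \<phi>_def
    proof (rule g(2))
      obtain a b where ab: "s = (\<chi> k. int R * a $ k)" "t = (\<chi> k. int R * b $ k)"
        using s t by (auto simp: T_def)
      then obtain k where "a $ k \<noteq> b $ k" using s(2) by (auto simp: vec_eq_iff)
      then have "int R * 1 \<le> int R * \<bar>b $ k - a $ k\<bar>" by (intro mult_left_mono) auto
      also have "\<dots> = \<bar>(t - s) $ k\<bar>" using ab by (simp add: abs_mult flip: right_diff_distrib)
      also have "\<dots> \<le> int (sup_norm (t - s))" by (rule abs_component_le_sup_norm)
      finally show "sup_norm (t - s) \<ge> R" by simp
    qed
  qed (use l in auto)
  moreover have "(1 + 2 * ennreal e) ^ card T = ennreal ((1 + 2 * e) ^ card T)"
    using e by (simp add: ennreal_power[symmetric] ennreal_mult)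
  ultimately have "confinement_probability U N l TYPE('d) \<le> 1 / (1 + 2 * e) ^ card T"
    using e by (intro confinement_probability_le) auto
  also have "\<dots> \<le> 1 / exp (e * card T)"
  proof -
    have "e\<^sup>2 \<le> e" using e by (simp add: power2_eq_square mult_left_le_one_le)
    then have "exp e \<le> 1 + 2 * e" using exp_bound[of e] e by simp
    then have "exp e ^ card T \<le> (1 + 2 * e) ^ card T" by (intro power_mono) auto
    then have "exp (e * card T) \<le> (1 + 2 * e) ^ card T"
      by (subst mult.commute) (simp only: exp_of_nat_mult)
    then show ?thesis by (intro divide_left_mono) (use e in auto)
  qed
  also have "\<dots> = exp (- (e * card T))" by (simp add: exp_minus inverse_eq_divide)
  also have "\<dots> \<le> exp (- (e * card (lattice_box N :: (int ^ 'd) set) / (4 * real R) ^ CARD('d)))"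
  proof -
    have "2 * N + 1 \<le> 2 * (R * (q + 2))" using q(2) by linarith
    also have "\<dots> = R * (2 * q + 4)" by (simp add: algebra_simps)
    also have "\<dots> \<le> R * (4 * (2 * q + 1))" by (intro mult_left_mono) auto
    also have "\<dots> = 4 * R * (2 * q + 1)" by (simp only: ac_simps)
    finally have "(2 * N + 1) ^ CARD('d) \<le> (4 * R * (2 * q + 1)) ^ CARD('d)"
      by (rule power_mono) simp
    then have "card (lattice_box N :: (int ^ 'd) set) \<le> (4 * R) ^ CARD('d) * card T"
      by (simp only: card_lattice_box cardT power_mult_distrib)
    then have "real (card (lattice_box N :: (int ^ 'd) set)) \<le> (4 * real R) ^ CARD('d) * card T"
      by (metis of_nat_le_iff of_nat_mult of_nat_power of_nat_numeral)
    then have "card (lattice_box N :: (int ^ 'd) set) / (4 * real R) ^ CARD('d) \<le> card T"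
      using R by (simp add: divide_le_eq mult.commute)
    then have "e * (card (lattice_box N :: (int ^ 'd) set) / (4 * real R) ^ CARD('d)) \<le> e * card T"
      using e by (intro mult_left_mono) auto
    then show ?thesis by simp
  qed
  finally show ?thesis by (simp add: e_def)
qed


section \<open>Choice of the scales\<close>

text \<open>With bumps of radius \<open>exp l\<close> and height \<open>3 l\<close> the cost of a bump is of order \<open>l\<^sup>2 / ln (exp l) = l\<close>, and the
  density \<open>exp (- 2 l)\<close> of the bumps is of the same exponential order.\<close>

lemma confinement_le_dim_2:
  assumes d: "CARD('d::finite) = 2" and l: "l \<ge> 1" and N: "real N > exp (2 * l)"
  shows "confinement_probability U N l TYPE('d) \<le>
    exp (- exp (- (288 * real (lattice_degree TYPE('d)) / c + 2 + ln 64) * l) * card (lattice_box N :: (int ^ 'd) set))"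
proof -
  define R where "R = nat \<lceil>exp l\<rceil>"
  define n where "n = real (lattice_degree TYPE('d))"
  have e2: "exp l \<ge> 2" using exp_ge_add_one_self[of l] l by linarith
  have R1: "exp l \<le> real R" unfolding R_def by linarith
  have R2: "real R \<le> 2 * exp l" using e2 unfolding R_def by linarith
  have "R \<ge> 2" using R1 e2 by linarith
  have "2 * exp l \<le> exp l * exp l" using e2 by (intro mult_right_mono) auto
  also have "\<dots> = exp (2 * l)" by (simp flip: exp_add)
  finally have RN: "R \<le> N" using R2 N by linarith
  have L: "l \<le> ln (1 + real R)"
    using R1 by (subst ln_ge_iff) auto
  then have "ln (1 + real R) * l > 0" using L l by (intro mult_pos_pos) linarith+
  then have D: "dirichlet_form N (\<lambda>i. log_profile R (sup_norm (i - t))) \<le> 64 * n / l" for t :: "int ^ 'd"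
    using dirichlet_form_log_profile[OF d \<open>R \<ge> 2\<close>, of N t] L l
    by (intro order_trans[OF _ divide_left_mono[OF L]]) (auto simp: n_def)
  have "confinement_probability U N l TYPE('d) \<le>
    exp (- (exp (- (9 * l\<^sup>2 * (64 * n / l)) / (2 * c)) * card (lattice_box N :: (int ^ 'd) set) / (4 * real R) ^ CARD('d)))"
    by (rule confinement_le_of_profile[where g = "log_profile R"])
      (use RN \<open>R \<ge> 2\<close> l D log_profile_0 log_profile_eq_0 in \<open>auto simp: n_def\<close>)
  also have "\<dots> \<le> exp (- exp (- (288 * n / c + 2 + ln 64) * l) * card (lattice_box N :: (int ^ 'd) set))"
  proof -
    have "(4 * real R)\<^sup>2 \<le> (8 * exp l)\<^sup>2" using R2 by (intro power_mono) auto
    also have "\<dots> = 64 * exp (2 * l)" by (simp add: power_mult_distrib power2_eq_square flip: exp_add)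
    also have "\<dots> = exp (ln 64 + 2 * l)" by (simp add: exp_add)
    also have "\<dots> \<le> exp ((2 + ln 64) * l)"
      using l mult_left_mono[of 1 l "ln 64"] by (simp add: algebra_simps)
    finally have R4: "(4 * real R)\<^sup>2 \<le> exp ((2 + ln 64) * l)" .
    have "exp (- (288 * n / c + 2 + ln 64) * l) = exp (- (9 * l\<^sup>2 * (64 * n / l)) / (2 * c)) / exp ((2 + ln 64) * l)"
      using l c_pos by (simp add: power2_eq_square field_simps flip: exp_diff)
    also have "\<dots> \<le> exp (- (9 * l\<^sup>2 * (64 * n / l)) / (2 * c)) / (4 * real R)\<^sup>2"
      using \<open>R \<ge> 2\<close> by (intro divide_left_mono R4) auto
    finally have "exp (- (288 * n / c + 2 + ln 64) * l) * card (lattice_box N :: (int ^ 'd) set)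
       \<le> exp (- (9 * l\<^sup>2 * (64 * n / l)) / (2 * c)) / (4 * real R)\<^sup>2 * card (lattice_box N :: (int ^ 'd) set)"
      by (rule mult_right_mono) simp
    then show ?thesis using d by simp
  qed
  finally show ?thesis by (simp add: n_def)
qed

text \<open>Point masses as bumps, of Dirichlet form proportional to \<open>l\<^sup>2\<close>.\<close>

lemma confinement_le_dim_ge_3:
  assumes l: "l \<ge> 1" and N: "N \<ge> 1"
  defines "D \<equiv> lattice_degree TYPE('d::finite) * (1 + real (lattice_degree TYPE('d))) / 2"
  shows "confinement_probability U N l TYPE('d) \<le>
    exp (- exp (- (9 * D / (2 * c) + CARD('d) * ln 4) * l\<^sup>2) * card (lattice_box N :: (int ^ 'd) set))"
proof -
  have "confinement_probability U N l TYPE('d) \<le>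
    exp (- (exp (- (9 * l\<^sup>2 * D) / (2 * c)) * card (lattice_box N :: (int ^ 'd) set) / (4 * real 1) ^ CARD('d)))"
  proof (rule confinement_le_of_profile[where g = "\<lambda>r. if r = 0 then 1 else 0"])
    show "dirichlet_form N (\<lambda>i. if sup_norm (i - t) = 0 then 1 else 0) \<le> D" for t :: "int ^ 'd"
      using dirichlet_form_point_mass[of N t] by (simp add: sup_norm_eq_0_iff D_def)
  qed (use l N in \<open>auto simp: D_def\<close>)
  also have "\<dots> \<le> exp (- exp (- (9 * D / (2 * c) + CARD('d) * ln 4) * l\<^sup>2) * card (lattice_box N :: (int ^ 'd) set))"
  proof -
    have "1 \<le> l\<^sup>2" using l by simp
    then have "CARD('d) * ln 4 * 1 \<le> CARD('d) * ln 4 * l\<^sup>2" by (intro mult_left_mono) auto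
    then have "exp (- (9 * D / (2 * c) + CARD('d) * ln 4) * l\<^sup>2) \<le> exp (- (9 * l\<^sup>2 * D) / (2 * c) - CARD('d) * ln 4)"
      by (simp add: algebra_simps)
    also have "\<dots> = exp (- (9 * l\<^sup>2 * D) / (2 * c)) / 4 ^ CARD('d)"
      by (simp add: exp_diff exp_of_nat_mult)
    finally have "exp (- (9 * D / (2 * c) + CARD('d) * ln 4) * l\<^sup>2) * card (lattice_box N :: (int ^ 'd) set)
       \<le> exp (- (9 * l\<^sup>2 * D) / (2 * c)) / 4 ^ CARD('d) * card (lattice_box N :: (int ^ 'd) set)"
      by (rule mult_right_mono) simp
    then show ?thesis by simp
  qed
  finally show ?thesis .
qed

text \<open>The mesh is \<open>M = exp (a s)\<close>. The condition \<open>rate\<close> leaves a spare factor \<open>exp (- a s)\<close> in the union bound over the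
  \<open>M ^ d\<close> sites of a cell; the constants are then absorbed by passing from \<open>a\<close> to \<open>a / 2\<close>.\<close>

lemma confinement_ge_exponential:
  fixes M N :: nat and a s l K :: real
  assumes d: "CARD('d::finite) \<ge> 2" and a: "a > 0" and s: "s \<ge> 0" and l: "l \<ge> 1" and K: "K > 0"
    and M: "M = nat \<lceil>exp (a * s)\<rceil>" "M \<le> N"
    and green: "\<And>(V :: (int ^ 'd) set) X i. V \<subseteq> lattice_box N \<Longrightarrow> (\<And>i j k. i \<in> V \<Longrightarrow> j \<in> V \<Longrightarrow> \<bar>i $ k - j $ k\<bar> < int M)
      \<Longrightarrow> X \<in> supported V \<Longrightarrow> (X i)\<^sup>2 \<le> K * dirichlet_form N X"
    and rate: "(CARD('d) + 1) * (a * s) \<le> c * l\<^sup>2 / (2 * K)"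
    and large: "4 * 2 ^ CARD('d) \<le> exp (a / 2 * s)" "2 * CARD('d) * pin_exponent TYPE('d) + 4 \<le> exp (a / 2 * s)"
  shows "exp (- exp (- (a / 2) * s) * card (lattice_box N :: (int ^ 'd) set)) \<le> confinement_probability U N l TYPE('d)"
proof -
  define E where "E = exp (a * s)"
  define B where "B = 2 * CARD('d) * pin_exponent TYPE('d)"
  have E: "E \<ge> 1" using a s by (simp add: E_def)
  have B: "B \<ge> 0" using pin_exponent_nonneg[of "TYPE('d)"] by (simp add: B_def)
  have half: "exp (a / 2 * s) * exp (a / 2 * s) = E" by (simp add: E_def flip: exp_add)
  have half1: "exp (a / 2 * s) \<ge> 1" using a s by simp
  have M1: "E \<le> real M" unfolding M(1) E_def by linarith
  have M2: "real M \<le> 2 * E" using E unfolding M(1) E_def by linarith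
  define t where "t = exp (- c * l\<^sup>2 / (2 * K))"
  have "t \<le> exp (- ((CARD('d) + 1) * (a * s)))" unfolding t_def using rate by simp
  also have "\<dots> = 1 / (E ^ CARD('d) * E)"
  proof -
    have "E ^ CARD('d) * E = exp ((CARD('d) + 1) * (a * s))"
      by (simp add: E_def distrib_right exp_add flip: exp_of_nat_mult)
    then show ?thesis by (simp only: exp_minus inverse_eq_divide)
  qed
  finally have t: "t \<le> 1 / (E ^ CARD('d) * E)" .
  have "t \<ge> 0" by (simp add: t_def)
  have small: "4 * t * real M ^ CARD('d) \<le> 1"
  proof -
    have "4 * t * real M ^ CARD('d) \<le> 4 * (1 / (E ^ CARD('d) * E)) * (2 * E) ^ CARD('d)"
      using t M2 \<open>t \<ge> 0\<close> by (intro mult_mono power_mono) auto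
    also have "\<dots> = 4 * 2 ^ CARD('d) / E" using E by (simp add: power_mult_distrib)
    also have "\<dots> \<le> 1"
      using large(1) half half1 mult_mono[OF large(1) half1] E by (simp add: divide_le_eq)
    finally show ?thesis .
  qed
  have "B / M + 4 * t \<le> exp (- (a / 2) * s)"
  proof -
    have "B / M \<le> B / E" using M1 E B by (intro divide_left_mono) auto
    moreover have "t \<le> 1 / E"
    proof -
      have "E \<le> E ^ CARD('d) * E" using E by (simp add: mult_le_cancel_right1)
      then show ?thesis using t E by (intro order_trans[OF t] divide_left_mono) auto
    qed
    ultimately have "B / M + 4 * t \<le> (B + 4) / E" by (simp add: add_divide_distrib)
    also have "\<dots> \<le> exp (a / 2 * s) / E"
      using large(2) E by (intro divide_right_mono) (auto simp: B_def)
    also have "\<dots> = exp (- (a / 2) * s)"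
      unfolding half[symmetric] by (simp add: exp_minus inverse_eq_divide)
    finally show ?thesis .
  qed
  then have "exp (- exp (- (a / 2) * s) * card (lattice_box N :: (int ^ 'd) set))
      \<le> exp (- (B / M + 4 * t) * card (lattice_box N :: (int ^ 'd) set))"
    by (simp only: exp_le_cancel_iff mult_minus_left neg_le_iff_le mult_right_mono of_nat_0_le_iff)
  also have "\<dots> \<le> confinement_probability U N l TYPE('d)"
    unfolding B_def t_def
    using M1 E small by (intro confinement_ge_of_green_bound d M(2) l K green) (auto simp: t_def)
  finally show ?thesis .
qed

lemma exp_ge_if_ge_ln:
  fixes C a s :: real
  assumes "a > 0" "C > 0" "s \<ge> 2 * ln C / a"
  shows "C \<le> exp (a / 2 * s)"
proof -
  have "ln C \<le> a / 2 * s" using assms by (simp add: field_simps)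
  then show ?thesis using assms(2) by (metis exp_le_cancel_iff exp_ln)
qed

lemma ceiling_exp_le:
  assumes a: "a > 0" and s: "s \<ge> 1" and N: "real N > exp ((a + 2) * s)"
  shows "nat \<lceil>exp (a * s)\<rceil> \<le> N"
proof -
  have "exp (a * s) \<ge> 1" using a s by simp
  then have "real (nat \<lceil>exp (a * s)\<rceil>) \<le> 2 * exp (a * s)" by linarith
  also have "\<dots> \<le> exp (2 * s) * exp (a * s)"
  proof (rule mult_right_mono)
    show "2 \<le> exp (2 * s)" using exp_ge_add_one_self[of "2 * s"] s by linarith
  qed simp
  also have "\<dots> = exp ((a + 2) * s)" by (simp add: algebra_simps flip: exp_add)
  finally show ?thesis using N by linarith
qed

text \<open>Here \<open>K\<close> is of order \<open>ln M = a l\<close>, so the tail exponent \<open>c l\<^sup>2 / (2 K)\<close> is at least \<open>c l / (32 a)\<close>. The value of \<open>a\<close>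
  makes this equal to \<open>3 a l\<close>.\<close>

lemma confinement_ge_dim_2:
  assumes d: "CARD('d::finite) = 2"
  defines "a \<equiv> sqrt (c / 96)"
  assumes l: "l \<ge> 1" "l \<ge> 2 / a" and N: "real N > exp ((a + 2) * l)"
    and large: "4 * 2 ^ CARD('d) \<le> exp (a / 2 * l)" "2 * CARD('d) * pin_exponent TYPE('d) + 4 \<le> exp (a / 2 * l)"
  shows "exp (- exp (- (a / 2) * l) * card (lattice_box N :: (int ^ 'd) set)) \<le> confinement_probability U N l TYPE('d)"
proof -
  define M where "M = nat \<lceil>exp (a * l)\<rceil>"
  define K where "K = 8 * (1 + ln (real (max M 1)))"
  have a: "a > 0" "a * a = c / 96" using c_pos by (auto simp: a_def)
  have e1: "exp (a * l) \<ge> 1" using a l by simp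
  then have M1: "real M \<ge> 1" and M2: "real M \<le> 2 * exp (a * l)" unfolding M_def by linarith+
  have "ln (real M) \<le> ln (2 * exp (a * l))" using M1 M2 by simp
  also have "\<dots> = ln 2 + a * l" by (simp add: ln_mult)
  also have "\<dots> \<le> 1 + a * l" using ln_2_less_1 by simp
  finally have "ln (real M) \<le> 1 + a * l" .
  moreover have "2 \<le> a * l" using l(2) a by (simp add: field_simps)
  ultimately have K2: "K \<le> 16 * (a * l)" using M1 by (simp add: K_def max_def)
  have K: "K > 0" using M1 by (simp add: K_def add_pos_nonneg)
  have "(2 + 1) * (a * l) * (2 * K) \<le> (2 + 1) * (a * l) * (2 * (16 * (a * l)))"
    using K2 a l by (intro mult_left_mono) auto
  also have "\<dots> = 96 * (a * a) * l\<^sup>2" by (simp add: power2_eq_square)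
  also have "\<dots> = c * l\<^sup>2" using a(2) by simp
  finally have rate: "(2 + 1) * (a * l) \<le> c * l\<^sup>2 / (2 * K)"
    using K by (simp add: pos_le_divide_eq)
  show ?thesis
  proof (rule confinement_ge_exponential[where M = M and K = K])
    show "M \<le> N" unfolding M_def using a(1) l(1) N by (rule ceiling_exp_le)
    show "(X i)\<^sup>2 \<le> K * dirichlet_form N X"
      if "V \<subseteq> lattice_box N" "\<And>i j k. i \<in> V \<Longrightarrow> j \<in> V \<Longrightarrow> \<bar>i $ k - j $ k\<bar> < int M" "X \<in> supported V"
      for V :: "(int ^ 'd) set" and X i
      unfolding K_def using d that by (intro green_bound_planar[where V = V]) auto
  qed (use d a l K M_def rate large in auto)
qed

text \<open>Here \<open>K = 36\<close> does not depend on the mesh, and the tail exponent is \<open>c l\<^sup>2 / 72\<close>.\<close>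

lemma confinement_ge_dim_ge_3:
  assumes d: "CARD('d::finite) \<ge> 3"
  defines "a \<equiv> c / (72 * (CARD('d) + 1))"
  assumes l: "l \<ge> 1" and N: "real N > exp ((a + 2) * l\<^sup>2)"
    and large: "4 * 2 ^ CARD('d) \<le> exp (a / 2 * l\<^sup>2)" "2 * CARD('d) * pin_exponent TYPE('d) + 4 \<le> exp (a / 2 * l\<^sup>2)"
  shows "exp (- exp (- (a / 2) * l\<^sup>2) * card (lattice_box N :: (int ^ 'd) set)) \<le> confinement_probability U N l TYPE('d)"
proof -
  define M where "M = nat \<lceil>exp (a * l\<^sup>2)\<rceil>"
  have a: "a > 0" using c_pos by (simp add: a_def)
  have rate: "(CARD('d) + 1) * (a * l\<^sup>2) \<le> c * l\<^sup>2 / (2 * 36)" by (simp add: a_def field_simps)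
  show ?thesis
  proof (rule confinement_ge_exponential[where M = M and K = 36])
    show "M \<le> N" unfolding M_def using a _ N by (rule ceiling_exp_le) (use l in simp)
    show "(X i)\<^sup>2 \<le> 36 * dirichlet_form N X"
      if "V \<subseteq> lattice_box N" "\<And>i j k. i \<in> V \<Longrightarrow> j \<in> V \<Longrightarrow> \<bar>i $ k - j $ k\<bar> < int M" "X \<in> supported V"
      for V :: "(int ^ 'd) set" and X i
      using d that by (intro green_bound_spatial[where V = V]) auto
  qed (use d a l M_def rate large in auto)
qed

end

theorem theorem2:
  fixes U :: "real \<Rightarrow> real" and c\<^sub>0 :: real
  assumes "CARD('d::finite) \<ge> 2"
    and "\<And>x. U (- x) = U x"
    and "\<And>x. U differentiable (at x)"
    and "\<And>x. deriv U differentiable (at x)"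
    and "c\<^sub>0 > 0"
    and "\<And>x. c\<^sub>0 < deriv (deriv U) x \<and> deriv (deriv U) x < 1 / c\<^sub>0"
  shows "\<exists>c\<^sub>m c\<^sub>p c l\<^sub>0 :: real. c\<^sub>m > 0 \<and> c\<^sub>p > 0 \<and> c > 0 \<and> l\<^sub>0 > 0 \<and>
    (\<forall>l>l\<^sub>0.
      (CARD('d) = 2 \<longrightarrow>
        (\<forall>N::nat. real N > exp (c * l) \<longrightarrow>
          exp (- exp (- c\<^sub>p * l) * real (card (lattice_box N :: (int ^ 'd) set)))
            \<ge> confinement_probability U N l TYPE('d) \<and>
          confinement_probability U N l TYPE('d)
            \<ge> exp (- exp (- c\<^sub>m * l) * real (card (lattice_box N :: (int ^ 'd) set))))) \<and>
      (CARD('d) \<ge> 3 \<longrightarrow>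
        (\<forall>N::nat. real N > exp (c * l^2) \<longrightarrow>
          exp (- exp (- c\<^sub>p * l^2) * real (card (lattice_box N :: (int ^ 'd) set)))
            \<ge> confinement_probability U N l TYPE('d) \<and>
          confinement_probability U N l TYPE('d)
            \<ge> exp (- exp (- c\<^sub>m * l^2) * real (card (lattice_box N :: (int ^ 'd) set))))))"
proof -
  interpret convex_potential U c\<^sub>0
    using assms(2-6) by (rule convex_potential_if_second_derivative_bounded)
  define n where "n = real (lattice_degree TYPE('d))"
  define C where "C = max (4 * 2 ^ CARD('d)) (2 * CARD('d) * pin_exponent TYPE('d) + 4)"
  have C: "C > 0" by (simp add: C_def less_max_iff_disj)
  have large: "4 * 2 ^ CARD('d) \<le> exp (a / 2 * s) \<and> 2 * CARD('d) * pin_exponent TYPE('d) + 4 \<le> exp (a / 2 * s)"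
    if "a > 0" "s \<ge> 2 * ln C / a" for a s :: real
    using exp_ge_if_ge_ln[OF that(1) C that(2)] by (simp add: C_def)
  show ?thesis
  proof (cases "CARD('d) = 2")
    case d: True
    define a where "a = sqrt (c\<^sub>0 / 96)"
    have a: "a > 0" using assms(5) by (simp add: a_def)
    define l\<^sub>0 where "l\<^sub>0 = max 1 (max (2 / a) (2 * ln C / a))"
    show ?thesis
    proof (rule exI[of _ "a / 2"], rule exI[of _ "288 * n / c\<^sub>0 + 2 + ln 64"], rule exI[of _ "a + 2"],
        rule exI[of _ l\<^sub>0], intro conjI allI impI)
      show "288 * n / c\<^sub>0 + 2 + ln 64 > 0" using assms(5) by (intro add_nonneg_pos add_nonneg_nonneg) (auto simp: n_def)
      fix l :: real and N :: nat assume l: "l > l\<^sub>0" and N: "real N > exp ((a + 2) * l)"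
      have l': "l \<ge> 1" "l \<ge> 2 / a" "l \<ge> 2 * ln C / a" using l by (auto simp: l\<^sub>0_def)
      have "exp (2 * l) \<le> exp ((a + 2) * l)" using a l' by (simp add: distrib_right)
      then have "exp (2 * l) < real N" using N by (rule le_less_trans)
      then show "confinement_probability U N l TYPE('d) \<le>
          exp (- exp (- (288 * n / c\<^sub>0 + 2 + ln 64) * l) * real (card (lattice_box N :: (int ^ 'd) set)))"
        unfolding n_def by (intro confinement_le_dim_2 d l')
      show "exp (- exp (- (a / 2) * l) * real (card (lattice_box N :: (int ^ 'd) set))) \<le> confinement_probability U N l TYPE('d)"
        unfolding a_def using large[OF a l'(3)] l' N by (intro confinement_ge_dim_2 d) (auto simp: a_def)
    qed (use a d in \<open>auto simp: l\<^sub>0_def\<close>)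
  next
    case False
    then have d: "CARD('d) \<ge> 3" using assms(1) by simp
    define a where "a = c\<^sub>0 / (72 * (CARD('d) + 1))"
    define D where "D = n * (1 + n) / 2"
    have a: "a > 0" using assms(5) by (simp add: a_def)
    define l\<^sub>0 where "l\<^sub>0 = max 1 (2 * ln C / a)"
    show ?thesis
    proof (rule exI[of _ "a / 2"], rule exI[of _ "9 * D / (2 * c\<^sub>0) + CARD('d) * ln 4"], rule exI[of _ "a + 2"],
        rule exI[of _ l\<^sub>0], intro conjI allI impI)
      show "9 * D / (2 * c\<^sub>0) + CARD('d) * ln 4 > 0" using assms(5) by (intro add_nonneg_pos) (auto simp: D_def n_def)
      fix l :: real and N :: nat assume l: "l > l\<^sub>0" and N: "real N > exp ((a + 2) * l\<^sup>2)"
      have l': "l \<ge> 1" "l \<ge> 2 * ln C / a" using l by (auto simp: l\<^sub>0_def)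
      have "l * 1 \<le> l * l" using l' by (intro mult_left_mono) auto
      then have "l \<le> l\<^sup>2" by (simp add: power2_eq_square)
      then have l2: "l\<^sup>2 \<ge> 2 * ln C / a" using l' by linarith
      have "N \<ge> 1" using N exp_gt_zero[of "(a + 2) * l\<^sup>2"] by linarith
      then show "confinement_probability U N l TYPE('d) \<le>
          exp (- exp (- (9 * D / (2 * c\<^sub>0) + CARD('d) * ln 4) * l\<^sup>2) * real (card (lattice_box N :: (int ^ 'd) set)))"
        unfolding D_def n_def by (intro confinement_le_dim_ge_3 l')
      show "exp (- exp (- (a / 2) * l\<^sup>2) * real (card (lattice_box N :: (int ^ 'd) set))) \<le> confinement_probability U N l TYPE('d)"
        unfolding a_def using large[OF a l2] l' N by (intro confinement_ge_dim_ge_3 d) (auto simp: a_def)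
    qed (use a False in \<open>auto simp: l\<^sub>0_def\<close>)
  qed
qed

end
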